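(* In the setting described in the context, with POD space $X=L^2(\Omega)$, there is a constant $C>0$, not depending on any discretization parameter (i.e. not on $V^h$, $N$, $\Delta t$ or $r$), such that the errors $e^n=u^n-u_r^n$, $n=1,\dots,N$, between the backward Euler finite element solution and the BE-POD-ROM solution satisfy $$\|e^N\|_{L^2}^2+\nu\Delta t\sum_{n=1}^{N-1}\|\nabla e^{n+1}\|_{L^2}^2\le C\left(\sum_{i=r+1}^s\lambda_i^{DQ1}\big(\|\varphi_i-R_r\varphi_i\|_{L^2}^2+\|\varphi_i-R_r\varphi_i\|_{H_0^1}^2\big)+\|\phi_r^1\|_{L^2}^2\right).$$
   Context: All function spaces are real. $\Omega\subset\mathbb{R}^d$ ($d\ge1$) is an open bounded domain with Lipschitz continuous boundary, $V=H_0^1(\Omega)$ with inner product $(g,h)_{H_0^1}=(\nabla g,\nabla h)_{L^2}$, $\nu>0$ is a constant, $T>0$ is fixed, $N\ge2$, $\Delta t=T/(N-1)$, $t_n=(n-1)\Delta t$, and $f$ is a given forcing function, with $f^n=f(t_n)$. $V^h\subset V$ is a standard conforming (finite-dimensional) finite element space. Backward Euler finite element solution: $\{u^n\}_{n=1}^N\subset V^h$, with $u^1$ the given initial condition and, for $n=1,\dots,N-1$, $$\Big(\tfrac{u^{n+1}-u^n}{\Delta t},v\Big)_{L^2}+\nu(\nabla u^{n+1},\nabla v)_{L^2}=(f^{n+1},v)_{L^2}\quad\forall v\in V^h.$$ POD modes: write $\partial z^n=(z^{n+1}-z^n)/\Delta t$. Let $S=\mathbb{R}^N$ with inner product $(g,h)_S=g^1h^1+\Delta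 t\sum_{j=2}^Ng^jh^j$, and $K_1:S\to X$, $K_1f=f^1u^1+\sum_{j=1}^{N-1}\Delta t f^{j+1}\partial u^j$. Its singular value decomposition has singular values $(\lambda_i^{DQ1})^{1/2}$ (nonincreasing) and orthonormal singular vectors $f_i\in S$, $\varphi_i\in X$, with $K_1f_i=(\lambda_i^{DQ1})^{1/2}\varphi_i$. The $\varphi_i$ are the POD modes, the $\lambda_i^{DQ1}$ the POD eigenvalues, and $s$ is the number of positive POD eigenvalues. $r$ is a positive integer with $\varphi_1,\dots,\varphi_r\in V^h$, and $V_r^h=\mathrm{span}\{\varphi_j\}_{j=1}^r\subset V^h$. $\Pi_r^X:X\to X$ is the orthogonal projection onto $V_r^h$. BE-POD-ROM: $\{u_r^n\}_{n=1}^N\subset V_r^h$ with $u_r^1=\Pi_r^Xu^1$ and, for $n=1,\dots,N-1$, $$\Big(\tfrac{u_r^{n+1}-u_r^n}{\Delta t},v_r\Big)_{L^2}+\nu(\nabla u_r^{n+1},\nabla v_r)_{L^2}=(f^{n+1},v_r)_{L^2}\quad\forall v_r\in V_r^h.$$ The Ritz projection $R_r:V\to V_r^h$ is defined by $(\nabla(w-R_rw),\nabla v_r)_{L^2}=0$ for all $v_r\in V_r^h$. Finally $\phi_r^n=u_r^n-R_ru^n$ (distinct from the POD modes $\varphi_i$). *)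

theory Defs
  imports "HOL-Analysis.Analysis"
begin

text \<open>
  Functions on \<open>\<Omega>\<close> are represented by total functions; only their values on \<open>\<Omega>\<close>, up to null
  sets, matter. The function spaces below (other than the test functions) are closed under almost
  everywhere equality on \<open>\<Omega>\<close>.
\<close>

subsection \<open>Domains\<close>

text \<open>
  Near each boundary point, \<open>\<Omega>\<close> is the set strictly above the graph of a Lipschitz function over
  the hyperplane orthogonal to some unit vector \<open>e\<close>.
\<close>

definition lipschitz_boundary :: "'a::euclidean_space set \<Rightarrow> bool" where
  "lipschitz_boundary \<Omega> \<longleftrightarrow>
     (\<forall>x\<in>frontier \<Omega>. \<exists>\<rho>>0. \<exists>e. norm e = 1 \<and>
        (\<exists>(g::'a \<Rightarrow> real) L. L-lipschitz_on {y. y \<bullet> e = 0} g \<and>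
           \<Omega> \<inter> ball x \<rho> = {y \<in> ball x \<rho>. g (y - (y \<bullet> e) *\<^sub>R e) < y \<bullet> e}))"

definition bounded_lipschitz_domain :: "'a::euclidean_space set \<Rightarrow> bool" where
  "bounded_lipschitz_domain \<Omega> \<longleftrightarrow>
     open \<Omega> \<and> connected \<Omega> \<and> \<Omega> \<noteq> {} \<and> bounded \<Omega> \<and> lipschitz_boundary \<Omega>"

subsection \<open>Lebesgue and Sobolev spaces\<close>

text \<open>Used both for real-valued functions and for vector fields such as gradients.\<close>

definition L2 :: "'a::euclidean_space set \<Rightarrow> ('a \<Rightarrow> 'b::euclidean_space) set" where
  "L2 \<Omega> = {g. g \<in> borel_measurable (lebesgue_on \<Omega>) \<and>
             integrable (lebesgue_on \<Omega>) (\<lambda>x. (norm (g x))\<^sup>2)}"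

definition L2_inner ::
    "'a::euclidean_space set \<Rightarrow> ('a \<Rightarrow> 'b::euclidean_space) \<Rightarrow> ('a \<Rightarrow> 'b) \<Rightarrow> real" where
  "L2_inner \<Omega> g h = (LINT x|lebesgue_on \<Omega>. g x \<bullet> h x)"

definition L2_norm :: "'a::euclidean_space set \<Rightarrow> ('a \<Rightarrow> 'b::euclidean_space) \<Rightarrow> real" where
  "L2_norm \<Omega> g = sqrt (L2_inner \<Omega> g g)"

primrec Ck_function :: "nat \<Rightarrow> ('a::euclidean_space \<Rightarrow> real) \<Rightarrow> bool" where
  "Ck_function 0 g \<longleftrightarrow> continuous_on UNIV g"
| "Ck_function (Suc k) g \<longleftrightarrow>
     (\<forall>x. g differentiable (at x)) \<and>
     (\<forall>b\<in>Basis. Ck_function k (\<lambda>x. frechet_derivative g (at x) b))"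

definition test_functions :: "'a::euclidean_space set \<Rightarrow> ('a \<Rightarrow> real) set" where
  "test_functions \<Omega> =
     {\<psi>. (\<forall>k. Ck_function k \<psi>) \<and>
          compact (closure {x. \<psi> x \<noteq> 0}) \<and> closure {x. \<psi> x \<noteq> 0} \<subseteq> \<Omega>}"

definition is_weak_grad ::
    "'a::euclidean_space set \<Rightarrow> ('a \<Rightarrow> real) \<Rightarrow> ('a \<Rightarrow> 'a) \<Rightarrow> bool" where
  "is_weak_grad \<Omega> w G \<longleftrightarrow>
     (\<forall>\<psi>\<in>test_functions \<Omega>. \<forall>b\<in>Basis.
        (LINT x|lebesgue_on \<Omega>. w x * frechet_derivative \<psi> (at x) b) =
        - (LINT x|lebesgue_on \<Omega>. (G x \<bullet> b) * \<psi> x))"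

definition H1 :: "'a::euclidean_space set \<Rightarrow> ('a \<Rightarrow> real) set" where
  "H1 \<Omega> = {w \<in> L2 \<Omega>. \<exists>G\<in>L2 \<Omega>. is_weak_grad \<Omega> w G}"

text \<open>A representative of the weak gradient, which is unique up to null sets.\<close>

definition weak_grad :: "'a::euclidean_space set \<Rightarrow> ('a \<Rightarrow> real) \<Rightarrow> 'a \<Rightarrow> 'a" where
  "weak_grad \<Omega> w = (SOME G. G \<in> L2 \<Omega> \<and> is_weak_grad \<Omega> w G)"

definition H1_norm :: "'a::euclidean_space set \<Rightarrow> ('a \<Rightarrow> real) \<Rightarrow> real" where
  "H1_norm \<Omega> w = sqrt ((L2_norm \<Omega> w)\<^sup>2 + (L2_norm \<Omega> (weak_grad \<Omega> w))\<^sup>2)"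

text \<open>The closure of the test functions in \<open>H1 \<Omega>\<close>.\<close>

definition H01 :: "'a::euclidean_space set \<Rightarrow> ('a \<Rightarrow> real) set" where
  "H01 \<Omega> = {w \<in> H1 \<Omega>. \<exists>\<psi>::nat \<Rightarrow> 'a \<Rightarrow> real. (\<forall>k. \<psi> k \<in> test_functions \<Omega>) \<and>
              (\<lambda>k. H1_norm \<Omega> (\<lambda>x. w x - \<psi> k x)) \<longlonglongrightarrow> 0}"

definition H01_inner :: "'a::euclidean_space set \<Rightarrow> ('a \<Rightarrow> real) \<Rightarrow> ('a \<Rightarrow> real) \<Rightarrow> real" where
  "H01_inner \<Omega> g h = L2_inner \<Omega> (weak_grad \<Omega> g) (weak_grad \<Omega> h)"

definition H01_norm :: "'a::euclidean_space set \<Rightarrow> ('a \<Rightarrow> real) \<Rightarrow> real" where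
  "H01_norm \<Omega> g = sqrt (H01_inner \<Omega> g g)"

subsection \<open>Finite-dimensional subspaces and projections\<close>

definition ae_span ::
    "'a::euclidean_space set \<Rightarrow> ('a \<Rightarrow> real) set \<Rightarrow> ('a \<Rightarrow> real) set" where
  "ae_span \<Omega> B = {w. \<exists>c. AE x in lebesgue_on \<Omega>. w x = (\<Sum>b\<in>B. c b * b x)}"

definition conforming_fe_space :: "'a::euclidean_space set \<Rightarrow> ('a \<Rightarrow> real) set \<Rightarrow> bool" where
  "conforming_fe_space \<Omega> Vh \<longleftrightarrow> (\<exists>B. finite B \<and> B \<subseteq> H01 \<Omega> \<and> Vh = ae_span \<Omega> B)"

text \<open>Both projections are determined up to null sets; the choice picks a representative.\<close>

definition L2_proj ::
    "'a::euclidean_space set \<Rightarrow> ('a \<Rightarrow> real) set \<Rightarrow> ('a \<Rightarrow> real) \<Rightarrow> 'a \<Rightarrow> real" where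
  "L2_proj \<Omega> W w = (SOME p. p \<in> W \<and> (\<forall>v\<in>W. L2_inner \<Omega> (\<lambda>x. w x - p x) v = 0))"

definition ritz_proj ::
    "'a::euclidean_space set \<Rightarrow> ('a \<Rightarrow> real) set \<Rightarrow> ('a \<Rightarrow> real) \<Rightarrow> 'a \<Rightarrow> real" where
  "ritz_proj \<Omega> W w =
     (SOME p. p \<in> W \<and>
        (\<forall>v\<in>W. L2_inner \<Omega> (weak_grad \<Omega> (\<lambda>x. w x - p x)) (weak_grad \<Omega> v) = 0))"

subsection \<open>Backward Euler\<close>

text \<open>\<open>N\<close> time nodes \<open>t\<^sub>1 = 0, \<dots>, t\<^sub>N = T\<close>, hence \<open>N - 1\<close> steps.\<close>

definition time_step :: "real \<Rightarrow> nat \<Rightarrow> real" where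
  "time_step T N = T / (real N - 1)"

definition time_node :: "real \<Rightarrow> nat \<Rightarrow> nat \<Rightarrow> real" where
  "time_node T N n = (real n - 1) * time_step T N"

definition diff_quot :: "real \<Rightarrow> (nat \<Rightarrow> 'a \<Rightarrow> real) \<Rightarrow> nat \<Rightarrow> 'a \<Rightarrow> real" where
  "diff_quot dt z n = (\<lambda>x. (z (n + 1) x - z n x) / dt)"

text \<open>Galerkin backward Euler in the trial and test space \<open>W\<close>; the initial value \<open>z 1\<close> is free.\<close>

definition backward_euler ::
    "'a::euclidean_space set \<Rightarrow> real \<Rightarrow> real \<Rightarrow> (real \<Rightarrow> 'a \<Rightarrow> real) \<Rightarrow> nat \<Rightarrow>
     ('a \<Rightarrow> real) set \<Rightarrow> (nat \<Rightarrow> 'a \<Rightarrow> real) \<Rightarrow> bool" where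
  "backward_euler \<Omega> \<nu> T f N W z \<longleftrightarrow>
     (\<forall>n\<in>{1..N}. z n \<in> W) \<and>
     (\<forall>n\<in>{1..N-1}. \<forall>v\<in>W.
        L2_inner \<Omega> (diff_quot (time_step T N) z n) v
        + \<nu> * L2_inner \<Omega> (weak_grad \<Omega> (z (n + 1))) (weak_grad \<Omega> v)
        = L2_inner \<Omega> (f (time_node T N (n + 1))) v)"

subsection \<open>Proper orthogonal decomposition\<close>

text \<open>Elements of \<open>S = \<real>\<^sup>N\<close> are functions on \<open>nat\<close>, read at the indices \<open>1, \<dots>, N\<close> only.\<close>

definition S_inner :: "real \<Rightarrow> nat \<Rightarrow> (nat \<Rightarrow> real) \<Rightarrow> (nat \<Rightarrow> real) \<Rightarrow> real" where
  "S_inner dt N g h = g 1 * h 1 + dt * (\<Sum>j=2..N. g j * h j)"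

definition K1 :: "real \<Rightarrow> nat \<Rightarrow> (nat \<Rightarrow> 'a \<Rightarrow> real) \<Rightarrow> (nat \<Rightarrow> real) \<Rightarrow> 'a \<Rightarrow> real" where
  "K1 dt N u a = (\<lambda>x. a 1 * u 1 x + (\<Sum>j=1..N-1. dt * a (j + 1) * diff_quot dt u j x))"

text \<open>
  A singular value decomposition of \<open>K1 : S \<rightarrow> L2 \<Omega>\<close>, with \<open>lam i\<close> the squares of the singular
  values. As \<open>S\<close> has dimension \<open>N\<close>, the \<open>N\<close> orthonormal right singular vectors form a basis of \<open>S\<close>,
  and the adjoint relation follows from the ones listed. The orthonormal left singular vectors
  \<open>\<phi> i\<close> are indexed by all \<open>i \<ge> 1\<close>, since \<open>L2 \<Omega>\<close> is infinite-dimensional.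
\<close>

definition pod_svd ::
    "'a::euclidean_space set \<Rightarrow> real \<Rightarrow> nat \<Rightarrow> (nat \<Rightarrow> 'a \<Rightarrow> real) \<Rightarrow>
     (nat \<Rightarrow> real) \<Rightarrow> (nat \<Rightarrow> nat \<Rightarrow> real) \<Rightarrow> (nat \<Rightarrow> 'a \<Rightarrow> real) \<Rightarrow> bool" where
  "pod_svd \<Omega> dt N u lam a \<phi> \<longleftrightarrow>
     (\<forall>i\<in>{1..N}. 0 \<le> lam i) \<and>
     (\<forall>i\<in>{1..N}. \<forall>j\<in>{1..N}. i \<le> j \<longrightarrow> lam j \<le> lam i) \<and>
     (\<forall>i\<in>{1..N}. \<forall>j\<in>{1..N}. S_inner dt N (a i) (a j) = (if i = j then 1 else 0)) \<and>
     (\<forall>i\<ge>1. \<phi> i \<in> L2 \<Omega>) \<and>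
     (\<forall>i\<ge>1. \<forall>j\<ge>1. L2_inner \<Omega> (\<phi> i) (\<phi> j) = (if i = j then 1 else 0)) \<and>
     (\<forall>i\<in>{1..N}. AE x in lebesgue_on \<Omega>. K1 dt N u (a i) x = sqrt (lam i) * \<phi> i x)"

definition num_pos_eigenvalues :: "nat \<Rightarrow> (nat \<Rightarrow> real) \<Rightarrow> nat" where
  "num_pos_eigenvalues N lam = card {i\<in>{1..N}. 0 < lam i}"

definition pod_space ::
    "'a::euclidean_space set \<Rightarrow> (nat \<Rightarrow> 'a \<Rightarrow> real) \<Rightarrow> nat \<Rightarrow> ('a \<Rightarrow> real) set" where
  "pod_space \<Omega> \<phi> r = ae_span \<Omega> (\<phi> ` {1..r})"

definition be_pod_rom ::
    "'a::euclidean_space set \<Rightarrow> real \<Rightarrow> real \<Rightarrow> (real \<Rightarrow> 'a \<Rightarrow> real) \<Rightarrow> nat \<Rightarrow>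
     (nat \<Rightarrow> 'a \<Rightarrow> real) \<Rightarrow> (nat \<Rightarrow> 'a \<Rightarrow> real) \<Rightarrow> nat \<Rightarrow> (nat \<Rightarrow> 'a \<Rightarrow> real) \<Rightarrow> bool" where
  "be_pod_rom \<Omega> \<nu> T f N u \<phi> r ur \<longleftrightarrow>
     (AE x in lebesgue_on \<Omega>. ur 1 x = L2_proj \<Omega> (pod_space \<Omega> \<phi> r) (u 1) x) \<and>
     backward_euler \<Omega> \<nu> T f N (pod_space \<Omega> \<phi> r) ur"

end

theory Submission
  imports Defs "HOL-Library.Function_Algebras"
begin

text \<open>
  Write \<open>e = \<eta> - p\<close> with \<open>\<eta> = u - R u\<close>, the Ritz projection error of the finite element solution, and
  \<open>p = u\<^sub>r - R u\<close>, which lies in the POD space. Subtracting the two schemes on the POD space removes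
  the forcing, and the defining property of \<open>R\<close> removes the gradient of \<open>\<eta>\<close>. Hence \<open>p\<close> solves a backward
  Euler scheme whose only source is the difference quotient of \<open>\<eta>\<close>. Testing it with \<open>p\<close> itself, and
  absorbing the source with Poincare's inequality, bounds \<open>p\<close> by its initial value and by the time sum of
  the squared difference quotients of \<open>\<eta>\<close> (\<open>backward_euler_stability\<close>).

  What remains is to bound \<open>\<eta>\<close> by the POD data. Projecting commutes with difference quotients, so
  the errors in question are the projection errors of the weighted POD snapshots: the initial value and the
  difference quotients of \<open>u\<close>. The right singular vectors form an orthonormal basis of the space \<open>S\<close>, so the
  weighted sum of the squared snapshot errors equals the sum of the squared errors of the images of these
  vectors under the snapshot map, and these are the multiples \<open>sqrt (lam i)\<close> of the modes. Modes
  up to \<open>r\<close> are projected exactly and eigenvalues beyond \<open>s\<close> vanish, which leaves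
  precisely the two sums in the estimate, one for the \<open>L2\<close> norm and one for the energy norm
  (\<open>pod_projection_error\<close>). Summing difference quotients recovers the pointwise errors
  \<open>\<eta>\<close> at the price of a factor \<open>1 + T\<close>, which is why the initial value must be a snapshot
  (\<open>solution_projection_error\<close>).

  This argument takes place in a real vector space with two positive semidefinite
  forms related by Poincare's inequality. Semidefinite forms are the right setting, since
  functions are identified only almost everywhere: all identities hold up to vectors of norm zero.
  To apply it, \<open>H01 \<Omega>\<close> has to be such a space. Weak gradients must be unique almost everywhere, which is the
  fundamental lemma of the calculus of variations and needs smooth bump functions; test functions
  must have their classical gradients as weak gradients; and Poincare's inequality must hold for
  test functions and hence, by density, on \<open>H01 \<Omega>\<close>.
\<close>

section \<open>Semi-inner products on subspaces\<close>

text \<open>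
  The form may vanish on nonzero vectors, such as functions that are zero almost everywhere. Vectors whose
  difference has norm zero play the role of equal vectors; \<open>ip_null\<close> and \<open>ip_self_cong\<close> below
  say that the form cannot tell them apart.
\<close>
locale semi_inner_space =
  fixes V :: "'v::real_vector set" and ip :: "'v \<Rightarrow> 'v \<Rightarrow> real"
  assumes subspace_V: "subspace V"
    and ip_add_left: "\<lbrakk>x \<in> V; y \<in> V; z \<in> V\<rbrakk> \<Longrightarrow> ip (x + y) z = ip x z + ip y z"
    and ip_scale_left: "\<lbrakk>x \<in> V; z \<in> V\<rbrakk> \<Longrightarrow> ip (c *\<^sub>R x) z = c * ip x z"
    and ip_commute: "\<lbrakk>x \<in> V; y \<in> V\<rbrakk> \<Longrightarrow> ip x y = ip y x"
    and ip_nonneg: "x \<in> V \<Longrightarrow> 0 \<le> ip x x"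
begin

lemma mem [simp]:
  "0 \<in> V"
  "x \<in> V \<Longrightarrow> y \<in> V \<Longrightarrow> x + y \<in> V"
  "x \<in> V \<Longrightarrow> y \<in> V \<Longrightarrow> x - y \<in> V"
  "x \<in> V \<Longrightarrow> c *\<^sub>R x \<in> V"
  using subspace_V by (auto intro: subspace_0 subspace_add subspace_diff subspace_scale)

lemma mem_sum [simp]: "(\<And>j. j \<in> J \<Longrightarrow> x j \<in> V) \<Longrightarrow> (\<Sum>j\<in>J. x j) \<in> V"
  using subspace_V by (rule subspace_sum)

lemma ip_zero_left: "z \<in> V \<Longrightarrow> ip 0 z = 0"
  using ip_scale_left[of z z 0] by simp

lemma ip_add_right: "\<lbrakk>x \<in> V; y \<in> V; z \<in> V\<rbrakk> \<Longrightarrow> ip z (x + y) = ip z x + ip z y"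
  by (metis ip_add_left ip_commute mem(2))

lemma ip_scale_right: "\<lbrakk>x \<in> V; z \<in> V\<rbrakk> \<Longrightarrow> ip z (c *\<^sub>R x) = c * ip z x"
  by (metis ip_scale_left ip_commute mem(4))

lemma ip_diff_left: "\<lbrakk>x \<in> V; y \<in> V; z \<in> V\<rbrakk> \<Longrightarrow> ip (x - y) z = ip x z - ip y z"
  using ip_add_left[of "x - y" y z] by simp

lemma ip_diff_right: "\<lbrakk>x \<in> V; y \<in> V; z \<in> V\<rbrakk> \<Longrightarrow> ip z (x - y) = ip z x - ip z y"
  using ip_add_right[of "x - y" y z] by simp

lemma ip_sum_left:
  assumes "\<And>j. j \<in> J \<Longrightarrow> x j \<in> V" and "z \<in> V"
  shows "ip (\<Sum>j\<in>J. x j) z = (\<Sum>j\<in>J. ip (x j) z)"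
  using assms by (induction J rule: infinite_finite_induct) (auto simp: ip_zero_left ip_add_left)

lemma ip_sum_right:
  assumes "\<And>j. j \<in> J \<Longrightarrow> x j \<in> V" and "z \<in> V"
  shows "ip z (\<Sum>j\<in>J. x j) = (\<Sum>j\<in>J. ip z (x j))"
proof -
  have "ip z (\<Sum>j\<in>J. x j) = ip (\<Sum>j\<in>J. x j) z"
    using assms by (intro ip_commute) auto
  also have "\<dots> = (\<Sum>j\<in>J. ip (x j) z)"
    using assms by (rule ip_sum_left)
  also have "\<dots> = (\<Sum>j\<in>J. ip z (x j))"
    using assms by (intro sum.cong) (auto intro: ip_commute)
  finally show ?thesis .
qed

lemmas ip_simps = ip_zero_left ip_add_left ip_add_right ip_scale_left ip_scale_right
  ip_diff_left ip_diff_right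

lemma cross_le: "\<lbrakk>x \<in> V; y \<in> V\<rbrakk> \<Longrightarrow> 2 * ip x y \<le> ip x x + ip y y"
  using ip_nonneg[of "x - y"] by (simp add: ip_simps ip_commute[of y x])

text \<open>
  Young's inequality: the previous bound, applied to \<open>c x\<close> and \<open>y\<close> and divided by \<open>c\<close>.
\<close>
lemma cross_le_scaled:
  assumes "x \<in> V" "y \<in> V" "c > 0"
  shows "2 * ip x y \<le> c * ip x x + ip y y / c"
proof -
  have "2 * ip (c *\<^sub>R x) y \<le> ip (c *\<^sub>R x) (c *\<^sub>R x) + ip y y"
    using assms by (intro cross_le) auto
  then have "2 * (c * ip x y) \<le> c * (c * ip x x) + ip y y"
    using assms by (simp add: ip_simps)
  then have "2 * ip x y \<le> (c * (c * ip x x) + ip y y) / c"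
    using assms(3) by (subst pos_le_divide_eq) (simp_all add: mult_ac)
  then show ?thesis
    using assms(3) by (simp add: add_divide_distrib)
qed

lemma ip_diff_self_le: "\<lbrakk>x \<in> V; y \<in> V\<rbrakk> \<Longrightarrow> ip (x - y) (x - y) \<le> 2 * ip x x + 2 * ip y y"
  using ip_nonneg[of "x + y"] by (simp add: ip_simps ip_commute[of y x])

lemma Cauchy_Schwarz:
  assumes "x \<in> V" "y \<in> V"
  shows "(ip x y)\<^sup>2 \<le> ip x x * ip y y"
proof -
  have *: "0 \<le> ip x x - 2 * c * ip x y + c\<^sup>2 * ip y y" for c
    using ip_nonneg[of "x - c *\<^sub>R y"] assms
    by (simp add: ip_simps ip_commute[of y x] power2_eq_square algebra_simps)
  show ?thesis
  proof (cases "ip y y = 0")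
    case True
    \<comment> \<open>The quadratic in \<open>c\<close> degenerates to a linear function, bounded below only if its slope is zero.\<close>
    have "ip x y = 0"
    proof (rule ccontr)
      assume "ip x y \<noteq> 0"
      then show False
        using *[of "(ip x x + 1) / (2 * ip x y)"] True by simp
    qed
    then show ?thesis by (simp add: True)
  next
    case False
    then have pos: "ip y y > 0"
      using ip_nonneg[OF assms(2)] by linarith
    have "0 \<le> ip x x - (ip x y)\<^sup>2 / ip y y"
      using *[of "ip x y / ip y y"] pos by (simp add: power2_eq_square field_simps)
    then show ?thesis
      using pos by (simp add: field_simps)
  qed
qed

lemma sqrt_ip_triangle:
  assumes "x \<in> V" "y \<in> V"
  shows "sqrt (ip (x + y) (x + y)) \<le> sqrt (ip x x) + sqrt (ip y y)"
proof (rule real_le_lsqrt)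
  have "ip x y \<le> sqrt (ip x x) * sqrt (ip y y)"
    using Cauchy_Schwarz[OF assms] by (metis real_le_rsqrt real_sqrt_mult)
  then show "ip (x + y) (x + y) \<le> (sqrt (ip x x) + sqrt (ip y y))\<^sup>2"
    using assms ip_nonneg by (simp add: ip_simps ip_commute[of y x] power2_sum)
qed (use assms ip_nonneg in auto)

lemma ip_null:
  assumes "x \<in> V" "y \<in> V" "ip y y = 0"
  shows "ip x y = 0" "ip y x = 0"
  using Cauchy_Schwarz[OF assms(1,2)] assms ip_commute[of x y] by auto

lemma ip_self_cong:
  assumes "x \<in> V" "y \<in> V" "ip (x - y) (x - y) = 0"
  shows "ip x x = ip y y"
proof -
  have "ip (x - y) x = 0" "ip (x - y) y = 0"
    using ip_null(2)[of x "x - y"] ip_null(2)[of y "x - y"] assms by auto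
  then show ?thesis
    using assms by (simp add: ip_simps ip_commute[of y x])
qed

text \<open>
  Convexity of the square, obtained by expanding both sides into double sums and comparing
  \<open>2 * ip (x j) (x k)\<close> with \<open>ip (x j) (x j) + ip (x k) (x k)\<close>.
\<close>
lemma ip_weighted_sum_le:
  assumes "finite J" and x: "\<And>j. j \<in> J \<Longrightarrow> x j \<in> V" and w: "\<And>j. j \<in> J \<Longrightarrow> 0 \<le> w j"
  shows "ip (\<Sum>j\<in>J. w j *\<^sub>R x j) (\<Sum>j\<in>J. w j *\<^sub>R x j)
         \<le> (\<Sum>j\<in>J. w j) * (\<Sum>j\<in>J. w j * ip (x j) (x j))"
proof -
  have "2 * ip (\<Sum>j\<in>J. w j *\<^sub>R x j) (\<Sum>j\<in>J. w j *\<^sub>R x j)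
      = (\<Sum>j\<in>J. \<Sum>k\<in>J. w j * w k * (2 * ip (x j) (x k)))"
  proof -
    have "ip (\<Sum>j\<in>J. w j *\<^sub>R x j) (\<Sum>j\<in>J. w j *\<^sub>R x j)
        = (\<Sum>j\<in>J. \<Sum>k\<in>J. ip (w j *\<^sub>R x j) (w k *\<^sub>R x k))"
      using x by (subst ip_sum_left) (auto intro!: sum.cong ip_sum_right)
    then show ?thesis
      using x by (simp add: ip_simps sum_distrib_left mult_ac)
  qed
  also have "\<dots> \<le> (\<Sum>j\<in>J. \<Sum>k\<in>J. w j * w k * (ip (x j) (x j) + ip (x k) (x k)))"
    using x w by (intro sum_mono mult_left_mono cross_le) auto
  also have "\<dots> = (\<Sum>j\<in>J. \<Sum>k\<in>J. w k * (w j * ip (x j) (x j)))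
                + (\<Sum>j\<in>J. \<Sum>k\<in>J. w j * (w k * ip (x k) (x k)))"
    by (simp add: sum.distrib algebra_simps)
  also have "(\<Sum>j\<in>J. \<Sum>k\<in>J. w k * (w j * ip (x j) (x j)))
      = (\<Sum>j\<in>J. w j) * (\<Sum>j\<in>J. w j * ip (x j) (x j))"
    by (simp add: sum_product) (rule sum.swap)
  also have "(\<Sum>j\<in>J. \<Sum>k\<in>J. w j * (w k * ip (x k) (x k)))
      = (\<Sum>j\<in>J. w j) * (\<Sum>j\<in>J. w j * ip (x j) (x j))"
    by (simp add: sum_product)
  finally show ?thesis by simp
qed

text \<open>
  Parseval's identity for vector-valued coefficients: the rows \<open>a i\<close> are orthonormal for the weights \<open>w\<close>,
  so the mixed terms disappear when the squared norms of the \<open>y j\<close> are summed over \<open>j\<close>.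
\<close>
lemma orthonormal_transform:
  assumes fin: "finite I" and x: "\<And>i. i \<in> I \<Longrightarrow> x i \<in> V" and y: "\<And>j. j \<in> I \<Longrightarrow> y j \<in> V"
    and orth: "\<And>i k. i \<in> I \<Longrightarrow> k \<in> I \<Longrightarrow>
      (\<Sum>j\<in>I. w j * (a i j * a k j)) = (if i = k then 1 else 0)"
    and xy: "\<And>j. j \<in> I \<Longrightarrow>
      ip (y j - (\<Sum>i\<in>I. a i j *\<^sub>R x i)) (y j - (\<Sum>i\<in>I. a i j *\<^sub>R x i)) = 0"
  shows "(\<Sum>j\<in>I. w j * ip (y j) (y j)) = (\<Sum>i\<in>I. ip (x i) (x i))"
proof -
  have "ip (y j) (y j) = (\<Sum>i\<in>I. \<Sum>k\<in>I. (a i j * a k j) * ip (x i) (x k))" if "j \<in> I" for j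
  proof -
    let ?y = "\<Sum>i\<in>I. a i j *\<^sub>R x i"
    have "ip (y j) (y j) = ip ?y ?y"
      using that x y xy by (intro ip_self_cong) auto
    also have "\<dots> = (\<Sum>i\<in>I. \<Sum>k\<in>I. ip (a i j *\<^sub>R x i) (a k j *\<^sub>R x k))"
      using x by (subst ip_sum_left) (auto intro!: sum.cong ip_sum_right)
    finally show ?thesis
      using x by (simp add: ip_simps mult_ac)
  qed
  then have "(\<Sum>j\<in>I. w j * ip (y j) (y j))
      = (\<Sum>j\<in>I. \<Sum>i\<in>I. \<Sum>k\<in>I. w j * (a i j * a k j) * ip (x i) (x k))"
    by (simp add: sum_distrib_left mult.assoc)
  also have "\<dots> = (\<Sum>i\<in>I. \<Sum>j\<in>I. \<Sum>k\<in>I. w j * (a i j * a k j) * ip (x i) (x k))"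
    by (rule sum.swap)
  also have "\<dots> = (\<Sum>i\<in>I. \<Sum>k\<in>I. \<Sum>j\<in>I. w j * (a i j * a k j) * ip (x i) (x k))"
    by (intro sum.cong refl sum.swap)
  also have "\<dots> = (\<Sum>i\<in>I. \<Sum>k\<in>I. (if i = k then ip (x i) (x k) else 0))"
    by (intro sum.cong refl) (simp add: orth flip: sum_distrib_right)
  finally show ?thesis
    using fin by simp
qed

text \<open>
  One Gram-Schmidt step per element of \<open>B\<close>. The form need not be definite on \<open>span B\<close>, so the
  projection need not be unique; it is still the solution of a consistent linear system.
\<close>
lemma orthogonal_projection_exists:
  assumes "finite B" "B \<subseteq> V" "w \<in> V"
  shows "\<exists>p \<in> span B. \<forall>v \<in> span B. ip (w - p) v = 0"
  using assms
proof (induction B arbitrary: w rule: finite_induct)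
  case empty
  then show ?case by (auto simp: ip_commute[of w 0] ip_zero_left)
next
  case (insert b B)
  have bV: "b \<in> V" and BV: "B \<subseteq> V"
    using insert.prems by auto
  have spanV: "span B \<subseteq> V" "span (insert b B) \<subseteq> V"
    using span_minimal[OF BV subspace_V] span_minimal[OF insert.prems(1) subspace_V] by auto
  obtain p where p: "p \<in> span B" "\<And>v. v \<in> span B \<Longrightarrow> ip (w - p) v = 0"
    using insert.IH[OF BV insert.prems(2)] by auto
  obtain pb where pb: "pb \<in> span B" "\<And>v. v \<in> span B \<Longrightarrow> ip (b - pb) v = 0"
    using insert.IH[OF BV bV] by auto
  define b' where "b' = b - pb"
  have V: "p \<in> V" "pb \<in> V" "b' \<in> V"
    using p(1) pb(1) spanV bV by (auto simp: b'_def)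
  \<comment> \<open>If the new direction is null then \<open>c\<close> is \<open>0\<close>, the right value, because a null vector is orthogonal to everything.\<close>
  define c where "c = ip (w - p) b' / ip b' b'"
  define p' where "p' = p + c *\<^sub>R b'"
  have p'V: "p' \<in> V"
    using V by (simp add: p'_def)
  have orth_b': "ip (w - p') b' = 0"
  proof (cases "ip b' b' = 0")
    case True
    then show ?thesis
      using V p'V insert.prems by (auto intro: ip_null(1)[of "w - p'" b'])
  next
    case False
    then show ?thesis
      using V insert.prems by (simp add: p'_def c_def ip_simps)
  qed
  have orth_B: "ip (w - p') v = 0" if "v \<in> span B" for v
  proof -
    have "ip (w - p) v = 0" "ip b' v = 0"
      using p(2) pb(2) that by (auto simp: b'_def)
    then show ?thesis
      using V insert.prems that spanV by (auto simp: p'_def ip_simps)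
  qed
  have "ip (w - p') v = 0" if v: "v \<in> span (insert b B)" for v
  proof -
    obtain k where k: "v - k *\<^sub>R b \<in> span B"
      using v span_breakdown_eq[of v b B] by auto
    define z where "z = v - k *\<^sub>R b + k *\<^sub>R pb"
    have z: "z \<in> span B"
      using k pb(1) by (auto simp: z_def intro: span_add span_scale)
    have v_eq: "v = z + k *\<^sub>R b'"
      by (simp add: z_def b'_def algebra_simps)
    show ?thesis
      using orth_B[OF z] orth_b' V p'V z spanV insert.prems
      by (auto simp: v_eq ip_add_right ip_scale_right subset_iff)
  qed
  moreover have "p' \<in> span (insert b B)"
  proof -
    have "p \<in> span (insert b B)" "pb \<in> span (insert b B)" "b \<in> span (insert b B)"
      using p(1) pb(1) span_mono[of B "insert b B"] by (auto intro: span_base)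
    then show ?thesis
      unfolding p'_def b'_def by (intro span_add span_scale span_diff)
  qed
  ultimately show ?case by blast
qed

lemma semi_inner_subspace:
  assumes "subspace U" "U \<subseteq> V"
  shows "semi_inner_space U ip"
  using assms by unfold_locales (auto simp: ip_simps ip_nonneg subset_iff intro: ip_commute)

end

section \<open>Complete orthonormal systems in weighted coordinate space\<close>

text \<open>
  Orthonormal rows of a square matrix have orthonormal columns. Let \<open>e k\<close> be the part of the \<open>k\<close>-th unit
  vector orthogonal to all rows. Its squared norm is one minus the squared norm of the \<open>k\<close>-th column, and
  the sum of these over \<open>k\<close> is the number of columns minus the number of rows, hence zero.
\<close>
lemma orthonormal_square_complete:
  fixes b :: "'i \<Rightarrow> 'i \<Rightarrow> real"
  assumes fin: "finite I"
    and orth: "\<And>i k. i \<in> I \<Longrightarrow> k \<in> I \<Longrightarrow> (\<Sum>j\<in>I. b i j * b k j) = (if i = k then 1 else 0)"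
    and jk: "j \<in> I" "k \<in> I"
  shows "(\<Sum>i\<in>I. b i j * b i k) = (if j = k then 1 else 0)"
proof -
  define e where "e k j = (if j = k then 1 else 0) - (\<Sum>i\<in>I. b i k * b i j)" for k j
  have e_sq: "(\<Sum>j\<in>I. (e k j)\<^sup>2) = 1 - (\<Sum>i\<in>I. (b i k)\<^sup>2)" if k: "k \<in> I" for k
  proof -
    have delta: "(if j = k then 1 else 0) * (x::real) = (if j = k then x else 0)" for j and x :: real
      by simp
    have "(\<Sum>j\<in>I. (e k j)\<^sup>2)
        = (\<Sum>j\<in>I. if j = k then 1 else 0)
          - 2 * (\<Sum>j\<in>I. (if j = k then (\<Sum>i\<in>I. b i k * b i j) else 0))
          + (\<Sum>j\<in>I. (\<Sum>i\<in>I. b i k * b i j)\<^sup>2)"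
      by (simp add: sum_distrib_left flip: sum.distrib sum_subtractf)
         (intro sum.cong refl, simp add: e_def power2_eq_square algebra_simps)
    also have "(\<Sum>j\<in>I. if j = k then 1 else (0::real)) = 1"
      using fin k by simp
    also have "(\<Sum>j\<in>I. (if j = k then (\<Sum>i\<in>I. b i k * b i j) else 0)) = (\<Sum>i\<in>I. (b i k)\<^sup>2)"
      using fin k by (simp add: power2_eq_square)
    also have "(\<Sum>j\<in>I. (\<Sum>i\<in>I. b i k * b i j)\<^sup>2)
        = (\<Sum>j\<in>I. \<Sum>i\<in>I. \<Sum>l\<in>I. b i k * b l k * (b i j * b l j))"
      by (simp add: power2_eq_square sum_product algebra_simps)
    also have "\<dots> = (\<Sum>i\<in>I. \<Sum>j\<in>I. \<Sum>l\<in>I. b i k * b l k * (b i j * b l j))"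
      by (rule sum.swap)
    also have "\<dots> = (\<Sum>i\<in>I. \<Sum>l\<in>I. \<Sum>j\<in>I. b i k * b l k * (b i j * b l j))"
      by (intro sum.cong refl sum.swap)
    also have "\<dots> = (\<Sum>i\<in>I. \<Sum>l\<in>I. b i k * b l k * (if i = l then 1 else 0))"
      by (intro sum.cong refl) (simp add: orth flip: sum_distrib_left)
    also have "\<dots> = (\<Sum>i\<in>I. \<Sum>l\<in>I. (if i = l then b i k * b l k else 0))"
      by (intro sum.cong refl) simp
    also have "\<dots> = (\<Sum>i\<in>I. (b i k)\<^sup>2)"
      using fin by (simp add: power2_eq_square)
    finally show ?thesis by simp
  qed
  have "(\<Sum>k\<in>I. \<Sum>j\<in>I. (e k j)\<^sup>2) = (\<Sum>k\<in>I. 1) - (\<Sum>k\<in>I. \<Sum>i\<in>I. (b i k)\<^sup>2)"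
    by (simp add: e_sq sum_subtractf)
  also have "(\<Sum>k\<in>I. \<Sum>i\<in>I. (b i k)\<^sup>2) = (\<Sum>i\<in>I. \<Sum>k\<in>I. (b i k)\<^sup>2)"
    by (rule sum.swap)
  also have "\<dots> = (\<Sum>i\<in>I. 1)"
    by (intro sum.cong refl) (simp add: orth power2_eq_square)
  finally have "(\<Sum>k\<in>I. \<Sum>j\<in>I. (e k j)\<^sup>2) = 0"
    by simp
  then have "(\<Sum>j\<in>I. (e k j)\<^sup>2) = 0" if "k \<in> I" for k
    using fin that by (subst (asm) sum_nonneg_eq_0_iff) (auto intro: sum_nonneg)
  then have "(e k j)\<^sup>2 = 0"
    using fin jk by (subst (asm) sum_nonneg_eq_0_iff) auto
  then have "(\<Sum>i\<in>I. b i k * b i j) = (if j = k then 1 else 0)"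
    by (simp add: e_def)
  then show ?thesis
    by (simp add: mult.commute)
qed

text \<open>
  The unweighted case for \<open>sqrt (w j) * a i j\<close>.
\<close>
lemma weighted_orthonormal_complete:
  fixes a :: "'i \<Rightarrow> 'i \<Rightarrow> real" and w :: "'i \<Rightarrow> real"
  assumes fin: "finite I" and w: "\<And>j. j \<in> I \<Longrightarrow> w j > 0"
    and orth: "\<And>i k. i \<in> I \<Longrightarrow> k \<in> I \<Longrightarrow>
      (\<Sum>j\<in>I. w j * (a i j * a k j)) = (if i = k then 1 else 0)"
    and jk: "j \<in> I" "k \<in> I"
  shows "(\<Sum>i\<in>I. a i j * (w k * a i k)) = (if j = k then 1 else 0)"
proof -
  have "(\<Sum>j\<in>I. (sqrt (w j) * a i j) * (sqrt (w j) * a k j)) = (if i = k then 1 else 0)"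
    if "i \<in> I" "k \<in> I" for i k
  proof -
    have "(\<Sum>j\<in>I. (sqrt (w j) * a i j) * (sqrt (w j) * a k j))
        = (\<Sum>j\<in>I. w j * (a i j * a k j))"
    proof (intro sum.cong refl)
      fix j assume "j \<in> I"
      then have "sqrt (w j) * sqrt (w j) = w j"
        using w[of j] by simp
      then show "(sqrt (w j) * a i j) * (sqrt (w j) * a k j) = w j * (a i j * a k j)"
        by (metis (no_types, opaque_lifting) mult.assoc mult.left_commute)
    qed
    then show ?thesis using orth that by simp
  qed
  from orthonormal_square_complete[OF fin this jk]
  have eq: "(\<Sum>i\<in>I. sqrt (w j) * a i j * (sqrt (w k) * a i k)) = (if j = k then 1 else 0)" .
  have s: "sqrt (w j) > 0" "sqrt (w k) * sqrt (w k) = w k"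
    using w[OF jk(1)] w[OF jk(2)] by auto
  have "sqrt (w j) * (\<Sum>i\<in>I. a i j * (w k * a i k))
      = sqrt (w k) * (\<Sum>i\<in>I. sqrt (w j) * a i j * (sqrt (w k) * a i k))"
    unfolding sum_distrib_left
  proof (intro sum.cong refl)
    fix i
    show "sqrt (w j) * (a i j * (w k * a i k))
        = sqrt (w k) * (sqrt (w j) * a i j * (sqrt (w k) * a i k))"
      by (subst s(2)[symmetric]) (simp only: mult_ac)
  qed
  also have "\<dots> = sqrt (w j) * (if j = k then 1 else 0)"
    unfolding eq by simp
  finally show ?thesis
    using s(1) by simp
qed

section \<open>Reduced-order backward Euler in an abstract energy space\<close>

text \<open>
  In the application, \<open>m\<close> is the \<open>L2\<close> product and \<open>q\<close> the \<open>L2\<close> product of the weak gradients.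
  By Poincare's inequality vectors that are null for \<open>q\<close> are null for \<open>m\<close>; \<open>null_transfer\<close> is the
  converse, which holds for \<open>L2\<close> and \<open>H01\<close> because functions that are equal almost everywhere have
  the same weak gradient.
\<close>
locale energy_space =
  M: semi_inner_space V m + Q: semi_inner_space V q
  for V :: "'v::real_vector set" and m q :: "'v \<Rightarrow> 'v \<Rightarrow> real" +
  fixes K :: real
  assumes K_pos: "K > 0"
    and poincare: "v \<in> V \<Longrightarrow> m v v \<le> K * q v v"
    and null_transfer: "v \<in> V \<Longrightarrow> m v v = 0 \<Longrightarrow> q v v = 0"
begin

text \<open>
  Test with the new value \<open>v'\<close>. Young's inequality with parameter \<open>K / \<nu>\<close> leaves \<open>(\<nu> / K) * m v' v'\<close>, which
  Poincare's inequality turns into \<open>\<nu> * q v' v'\<close>, half of what the left-hand side provides.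
\<close>
lemma energy_step:
  assumes V: "v \<in> V" "v' \<in> V" "d \<in> V" and pos: "dt > 0" "\<nu> > 0"
    and eq: "m ((1 / dt) *\<^sub>R (v' - v)) v' + \<nu> * q v' v' = m d v'"
  shows "m v' v' + \<nu> * dt * q v' v' \<le> m v v + K / \<nu> * dt * m d d"
proof -
  have "2 * m d v' \<le> K / \<nu> * m d d + m v' v' / (K / \<nu>)"
    using V K_pos pos by (intro M.cross_le_scaled) auto
  also have "m v' v' / (K / \<nu>) \<le> \<nu> * q v' v'"
  proof -
    have "m v' v' * \<nu> \<le> K * q v' v' * \<nu>"
      using poincare[OF V(2)] pos by (intro mult_right_mono) auto
    then show ?thesis
      using K_pos pos by (simp add: divide_simps mult_ac)
  qed
  finally have d: "2 * m d v' \<le> K / \<nu> * m d d + \<nu> * q v' v'" by simp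
  have "m v' v' - m v v \<le> 2 * m (v' - v) v'"
    using M.cross_le[of v v'] V by (simp add: M.ip_simps)
  also have "2 * m (v' - v) v' = dt * (2 * m ((1 / dt) *\<^sub>R (v' - v)) v')"
    using V pos by (simp add: M.ip_simps)
  also have "\<dots> = dt * (2 * m d v' - 2 * (\<nu> * q v' v'))"
    using eq by simp
  also have "\<dots> \<le> dt * (K / \<nu> * m d d - \<nu> * q v' v')"
    using d pos by (intro mult_left_mono) auto
  finally show ?thesis
    by (simp add: algebra_simps)
qed

lemma backward_euler_stability:
  assumes V: "\<And>n. n \<in> {1..Suc k} \<Longrightarrow> p n \<in> V" "\<And>n. n \<in> {1..k} \<Longrightarrow> d n \<in> V"
    and pos: "dt > 0" "\<nu> > 0"
    and eq: "\<And>n. n \<in> {1..k} \<Longrightarrow>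
      m ((1 / dt) *\<^sub>R (p (Suc n) - p n)) (p (Suc n)) + \<nu> * q (p (Suc n)) (p (Suc n))
      = m (d n) (p (Suc n))"
  shows "m (p (Suc k)) (p (Suc k)) + \<nu> * dt * (\<Sum>n=1..k. q (p (Suc n)) (p (Suc n)))
    \<le> m (p 1) (p 1) + K / \<nu> * (\<Sum>n=1..k. dt * m (d n) (d n))"
  using V eq
proof (induction k)
  case 0
  then show ?case by simp
next
  case (Suc k)
  have "m (p (Suc (Suc k))) (p (Suc (Suc k)))
        + \<nu> * dt * q (p (Suc (Suc k))) (p (Suc (Suc k)))
      \<le> m (p (Suc k)) (p (Suc k)) + K / \<nu> * dt * m (d (Suc k)) (d (Suc k))"
    using Suc.prems by (intro energy_step pos) auto
  moreover have "m (p (Suc k)) (p (Suc k)) + \<nu> * dt * (\<Sum>n=1..k. q (p (Suc n)) (p (Suc n)))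
    \<le> m (p 1) (p 1) + K / \<nu> * (\<Sum>n=1..k. dt * m (d n) (d n))"
    using Suc.prems by (intro Suc.IH) auto
  ultimately show ?case
    by (simp add: distrib_left)
qed

end

text \<open>
  \<open>R\<close> picks one of several projections that differ by null vectors, and it may do so without
  any regard to linearity. Linearity of \<open>w - R w\<close> therefore holds only up to null vectors.
\<close>
locale ritz_projection = energy_space V m q K
  for V :: "'v::real_vector set" and m q K +
  fixes W :: "'v set" and R :: "'v \<Rightarrow> 'v"
  assumes subspace_W: "subspace W" and W_V: "W \<subseteq> V"
    and R_mem: "w \<in> V \<Longrightarrow> R w \<in> W"
    and R_orth: "\<lbrakk>w \<in> V; v \<in> W\<rbrakk> \<Longrightarrow> q (w - R w) v = 0"
begin

definition ritz_err :: "'v \<Rightarrow> 'v" where "ritz_err w = w - R w"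

lemma R_V [simp]: "w \<in> V \<Longrightarrow> R w \<in> V"
  using R_mem W_V by auto

lemma ritz_err_mem [simp]: "w \<in> V \<Longrightarrow> ritz_err w \<in> V"
  by (simp add: ritz_err_def)

text \<open>
  Uniqueness of the projection up to null vectors rests on this, and through it on Poincare's inequality.
\<close>
lemma orth_imp_null:
  assumes "d \<in> W" "\<And>v. v \<in> W \<Longrightarrow> q d v = 0"
  shows "m d d = 0" "q d d = 0"
proof -
  have d: "d \<in> V" "q d d = 0"
    using assms W_V by auto
  then show "q d d = 0" by simp
  show "m d d = 0"
    using poincare[OF d(1)] M.ip_nonneg[OF d(1)] d(2) by simp
qed

text \<open>
  The defect is a combination of projections, hence in \<open>W\<close>, and also orthogonal to \<open>W\<close>.
\<close>
lemma ritz_err_linear: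
  fixes w :: "'j \<Rightarrow> 'v" and c :: "'j \<Rightarrow> real"
  assumes "\<And>j. j \<in> J \<Longrightarrow> w j \<in> V"
  defines "D \<equiv> ritz_err (\<Sum>j\<in>J. c j *\<^sub>R w j) - (\<Sum>j\<in>J. c j *\<^sub>R ritz_err (w j))"
  shows "m D D = 0" "q D D = 0"
proof -
  let ?s = "\<Sum>j\<in>J. c j *\<^sub>R w j"
  have s: "?s \<in> V"
    using assms by simp
  have D_eq: "D = (\<Sum>j\<in>J. c j *\<^sub>R R (w j)) - R ?s"
    by (simp add: D_def ritz_err_def scaleR_diff_right sum_subtractf)
  have D_W: "D \<in> W"
    unfolding D_eq using assms(1) s
    by (intro subspace_diff[OF subspace_W] subspace_sum[OF subspace_W]
        subspace_scale[OF subspace_W] R_mem)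
  have "q D v = 0" if v: "v \<in> W" for v
  proof -
    have vV: "v \<in> V" using v W_V by auto
    have "q D v = q (ritz_err ?s) v - (\<Sum>j\<in>J. c j * q (ritz_err (w j)) v)"
      unfolding D_def using assms(1) s vV by (simp add: Q.ip_simps Q.ip_sum_left)
    then show ?thesis
      using R_orth[OF _ v] s assms(1) by (simp add: ritz_err_def)
  qed
  then show "m D D = 0" "q D D = 0"
    using orth_imp_null[OF D_W] by auto
qed

lemma ritz_err_null_cong:
  assumes "x \<in> V" "y \<in> V" "m (x - y) (x - y) = 0"
  shows "m (ritz_err x) (ritz_err x) = m (ritz_err y) (ritz_err y)" "q (ritz_err x) (ritz_err x) = q (ritz_err y) (ritz_err y)"
proof -
  let ?d = "ritz_err x - ritz_err y"
  have q0: "q (x - y) (x - y) = 0"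
    using assms by (intro null_transfer) auto
  have RW: "R y - R x \<in> W"
    using assms by (intro subspace_diff[OF subspace_W] R_mem)
  have "q (R y - R x) v = 0" if v: "v \<in> W" for v
  proof -
    have vV: "v \<in> V" using v W_V by auto
    have "q (x - y) v = 0"
      using Q.ip_null(2)[OF vV _ q0] assms by simp
    then show ?thesis
      using R_orth[OF _ v, of x] R_orth[OF _ v, of y] assms vV by (simp add: Q.ip_simps)
  qed
  from orth_imp_null[OF RW this]
  have n: "m (R y - R x) (R y - R x) = 0" "q (R y - R x) (R y - R x) = 0" by auto
  have d: "?d = (x - y) + (R y - R x)"
    by (simp add: ritz_err_def)
  have "m ?d ?d \<le> 0"
  proof -
    have "m (x - y) (R y - R x) = 0" "m (R y - R x) (x - y) = 0"
      using M.ip_null[of "x - y" "R y - R x"] n assms by auto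
    then show ?thesis
      unfolding d using n assms by (subst M.ip_add_left M.ip_add_right; simp)+
  qed
  moreover have "q ?d ?d \<le> 0"
  proof -
    have "q (x - y) (R y - R x) = 0" "q (R y - R x) (x - y) = 0"
      using Q.ip_null[of "x - y" "R y - R x"] n assms by auto
    then show ?thesis
      unfolding d using n q0 assms by (subst Q.ip_add_left Q.ip_add_right; simp)+
  qed
  ultimately have "m ?d ?d = 0" "q ?d ?d = 0"
    using M.ip_nonneg[of ?d] Q.ip_nonneg[of ?d] assms by auto
  then show "m (ritz_err x) (ritz_err x) = m (ritz_err y) (ritz_err y)" "q (ritz_err x) (ritz_err x) = q (ritz_err y) (ritz_err y)"
    using M.ip_self_cong[of "ritz_err x" "ritz_err y"] Q.ip_self_cong[of "ritz_err x" "ritz_err y"] assms by auto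
qed

lemma ritz_err_W_null:
  assumes "w \<in> W"
  shows "m (ritz_err w) (ritz_err w) = 0" "q (ritz_err w) (ritz_err w) = 0"
proof -
  have "ritz_err w \<in> W"
    unfolding ritz_err_def using assms W_V by (intro subspace_diff[OF subspace_W] R_mem) auto
  moreover have "q (ritz_err w) v = 0" if "v \<in> W" for v
    using R_orth that assms W_V by (auto simp: ritz_err_def)
  ultimately show "m (ritz_err w) (ritz_err w) = 0" "q (ritz_err w) (ritz_err w) = 0"
    using orth_imp_null by blast+
qed

end

section \<open>Proper orthogonal decomposition of a trajectory\<close>

text \<open>
  The inner product of \<open>S\<close> weights the first coordinate by \<open>1\<close> and the others by the time step. The snapshots
  are the initial value followed by the difference quotients, so that weighted partial sums of
  snapshots telescope to the solution.
\<close>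
definition pod_weight :: "real \<Rightarrow> nat \<Rightarrow> real" where
  "pod_weight dt j = (if j = 1 then 1 else dt)"

definition pod_snapshot :: "real \<Rightarrow> (nat \<Rightarrow> 'v::real_vector) \<Rightarrow> nat \<Rightarrow> 'v" where
  "pod_snapshot dt u j = (if j = 1 then u 1 else (1 / dt) *\<^sub>R (u j - u (j - 1)))"

definition pod_map :: "real \<Rightarrow> nat \<Rightarrow> (nat \<Rightarrow> 'v::real_vector) \<Rightarrow> (nat \<Rightarrow> real) \<Rightarrow> 'v" where
  "pod_map dt N u c = (\<Sum>j=1..N. (pod_weight dt j * c j) *\<^sub>R pod_snapshot dt u j)"

lemma pod_snapshot_mem:
  assumes "subspace V" and u: "\<And>n. n \<in> {1..N} \<Longrightarrow> u n \<in> V" and j: "j \<in> {1..N}"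
  shows "pod_snapshot dt u j \<in> V"
proof (cases "j = 1")
  case True
  then show ?thesis using u j by (simp add: pod_snapshot_def)
next
  case False
  then have "u j \<in> V" "u (j - 1) \<in> V"
    using j by (auto intro!: u)
  then show ?thesis
    using assms(1) False by (simp add: pod_snapshot_def subspace_scale subspace_diff)
qed

lemma snapshot_sum:
  assumes "dt > 0" "n \<ge> 1"
  shows "u n = (\<Sum>j=1..n. pod_weight dt j *\<^sub>R pod_snapshot dt u j)"
  using assms(2)
proof (induction n rule: nat_induct_at_least)
  case base
  then show ?case by (simp add: pod_weight_def pod_snapshot_def)
next
  case (Suc n)
  then show ?case
    using assms(1) by (simp add: pod_weight_def pod_snapshot_def flip: Suc.IH)
qed

text \<open>
  Each snapshot is the image under \<open>pod_map\<close> of a unit vector, expanded in the orthonormal basis \<open>a\<close> of \<open>S\<close>.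
\<close>
lemma snapshot_expansion:
  fixes u :: "nat \<Rightarrow> 'v::real_vector"
  assumes dt: "dt > 0" and j: "j \<in> {1..N}"
    and orth: "\<And>i k. i \<in> {1..N} \<Longrightarrow> k \<in> {1..N} \<Longrightarrow>
      (\<Sum>j=1..N. pod_weight dt j * (a i j * a k j)) = (if i = k then 1 else 0)"
  shows "pod_snapshot dt u j = (\<Sum>i=1..N. a i j *\<^sub>R pod_map dt N u (a i))"
proof -
  have "(\<Sum>i=1..N. a i j *\<^sub>R pod_map dt N u (a i))
      = (\<Sum>i=1..N. \<Sum>l=1..N. (a i j * (pod_weight dt l * a i l)) *\<^sub>R pod_snapshot dt u l)"
    by (simp add: pod_map_def scaleR_sum_right)
  also have "\<dots> = (\<Sum>l=1..N. (\<Sum>i=1..N. a i j * (pod_weight dt l * a i l)) *\<^sub>R pod_snapshot dt u l)"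
    by (subst sum.swap) (simp add: scaleR_sum_left)
  also have "\<dots> = (\<Sum>l=1..N. (if j = l then 1 else 0) *\<^sub>R pod_snapshot dt u l)"
    using j dt by (intro sum.cong refl arg_cong2[where f = scaleR] weighted_orthonormal_complete orth)
      (auto simp: pod_weight_def)
  also have "\<dots> = (\<Sum>l=1..N. if j = l then pod_snapshot dt u l else 0)"
    by (intro sum.cong) auto
  also have "\<dots> = pod_snapshot dt u j"
    using j by simp
  finally show ?thesis by simp
qed

context ritz_projection
begin

text \<open>
  The snapshot errors are, up to null vectors, the orthonormal transform of the errors of the vectors
  \<open>pod_map dt N u (a i)\<close>, which are \<open>sqrt (lam i)\<close> times the modes. For \<open>i \<le> r\<close> the mode lies in \<open>W\<close> and has no error;
  for \<open>i > s\<close> the vector itself is null.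
\<close>
lemma pod_projection_error:
  assumes dt: "dt > 0"
    and u: "\<And>n. n \<in> {1..N} \<Longrightarrow> u n \<in> V"
    and orth: "\<And>i k. i \<in> {1..N} \<Longrightarrow> k \<in> {1..N} \<Longrightarrow>
      (\<Sum>j=1..N. pod_weight dt j * (a i j * a k j)) = (if i = k then 1 else 0)"
    and sN: "s \<le> N" and lam: "\<And>i. i \<in> {1..N} \<Longrightarrow> 0 \<le> lam i"
    and phi: "\<And>i. i \<in> {1..s} \<Longrightarrow> phi i \<in> V" "\<And>i. i \<in> {1..r} \<Longrightarrow> phi i \<in> W"
    and svd: "\<And>i. i \<in> {1..s} \<Longrightarrow>
        m (pod_map dt N u (a i) - sqrt (lam i) *\<^sub>R phi i) (pod_map dt N u (a i) - sqrt (lam i) *\<^sub>R phi i) = 0"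
      "\<And>i. i \<in> {s+1..N} \<Longrightarrow> m (pod_map dt N u (a i)) (pod_map dt N u (a i)) = 0"
  defines "y \<equiv> \<lambda>j. ritz_err (pod_snapshot dt u j)"
  shows "(\<Sum>j=1..N. pod_weight dt j * m (y j) (y j)) = (\<Sum>i=r+1..s. lam i * m (ritz_err (phi i)) (ritz_err (phi i)))"
    and "(\<Sum>j=1..N. pod_weight dt j * q (y j) (y j)) = (\<Sum>i=r+1..s. lam i * q (ritz_err (phi i)) (ritz_err (phi i)))"
proof -
  let ?z = "\<lambda>i. pod_map dt N u (a i)"
  have snap: "pod_snapshot dt u j \<in> V" if "j \<in> {1..N}" for j
    using pod_snapshot_mem[OF M.subspace_V u that] .
  have z: "?z i \<in> V" for i
    unfolding pod_map_def using snap by (intro M.mem_sum M.mem) auto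
  have lin: "m (y j - (\<Sum>i=1..N. a i j *\<^sub>R ritz_err (?z i))) (y j - (\<Sum>i=1..N. a i j *\<^sub>R ritz_err (?z i))) = 0"
    "q (y j - (\<Sum>i=1..N. a i j *\<^sub>R ritz_err (?z i))) (y j - (\<Sum>i=1..N. a i j *\<^sub>R ritz_err (?z i))) = 0"
    if "j \<in> {1..N}" for j
  proof -
    have "pod_snapshot dt u j = (\<Sum>i=1..N. a i j *\<^sub>R ?z i)"
      by (rule snapshot_expansion[OF dt that orth])
    then show "m (y j - (\<Sum>i=1..N. a i j *\<^sub>R ritz_err (?z i))) (y j - (\<Sum>i=1..N. a i j *\<^sub>R ritz_err (?z i))) = 0"
      "q (y j - (\<Sum>i=1..N. a i j *\<^sub>R ritz_err (?z i))) (y j - (\<Sum>i=1..N. a i j *\<^sub>R ritz_err (?z i))) = 0"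
      using ritz_err_linear[of "{1..N}" ?z "\<lambda>i. a i j"] z by (simp_all add: y_def)
  qed
  have yV: "y j \<in> V" if "j \<in> {1..N}" for j
    using snap that by (simp add: y_def)
  have mode: "m (ritz_err (?z i)) (ritz_err (?z i)) = (if i \<in> {r+1..s} then lam i * m (ritz_err (phi i)) (ritz_err (phi i)) else 0) \<and>
      q (ritz_err (?z i)) (ritz_err (?z i)) = (if i \<in> {r+1..s} then lam i * q (ritz_err (phi i)) (ritz_err (phi i)) else 0)"
    if i: "i \<in> {1..N}" for i
  proof (cases "i \<le> s")
    case True
    then have i1: "i \<in> {1..s}" using i by simp
    have pV: "phi i \<in> V" using phi(1) i1 by simp
    let ?c = "sqrt (lam i)"
    have c: "?c * ?c = lam i" using lam i by simp
    have zc: "m (ritz_err (?z i)) (ritz_err (?z i)) = m (ritz_err (?c *\<^sub>R phi i)) (ritz_err (?c *\<^sub>R phi i))"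
      "q (ritz_err (?z i)) (ritz_err (?z i)) = q (ritz_err (?c *\<^sub>R phi i)) (ritz_err (?c *\<^sub>R phi i))"
      using ritz_err_null_cong[OF z _ svd(1)[OF i1]] pV by auto
    show ?thesis
    proof (cases "i \<le> r")
      case True
      then have "?c *\<^sub>R phi i \<in> W"
        using phi(2)[of i] i subspace_W by (auto intro: subspace_scale)
      then show ?thesis
        using ritz_err_W_null True zc by auto
    next
      case False
      have nul: "m (ritz_err (?c *\<^sub>R phi i) - ?c *\<^sub>R ritz_err (phi i)) (ritz_err (?c *\<^sub>R phi i) - ?c *\<^sub>R ritz_err (phi i)) = 0"
        "q (ritz_err (?c *\<^sub>R phi i) - ?c *\<^sub>R ritz_err (phi i)) (ritz_err (?c *\<^sub>R phi i) - ?c *\<^sub>R ritz_err (phi i)) = 0"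
        using ritz_err_linear[of "{i}" phi "\<lambda>_. ?c"] pV by auto
      have "m (ritz_err (?c *\<^sub>R phi i)) (ritz_err (?c *\<^sub>R phi i)) = m (?c *\<^sub>R ritz_err (phi i)) (?c *\<^sub>R ritz_err (phi i))"
        "q (ritz_err (?c *\<^sub>R phi i)) (ritz_err (?c *\<^sub>R phi i)) = q (?c *\<^sub>R ritz_err (phi i)) (?c *\<^sub>R ritz_err (phi i))"
        using M.ip_self_cong[OF _ _ nul(1)] Q.ip_self_cong[OF _ _ nul(2)] pV by auto
      then show ?thesis
        using zc c pV False True by (simp add: M.ip_simps Q.ip_simps flip: mult.assoc)
    qed
  next
    case False
    have "m (?z i - 0) (?z i - 0) = 0"
      using svd(2)[of i] False i by simp
    from ritz_err_null_cong[OF z _ this] show ?thesis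
      using False ritz_err_W_null[of 0] subspace_W by (simp add: subspace_0)
  qed
  have restrict: "(\<Sum>i=1..N. if i \<in> {r+1..s} then f i else 0) = (\<Sum>i=r+1..s. f i)" for f :: "nat \<Rightarrow> real"
  proof -
    have "(\<Sum>i=1..N. if i \<in> {r+1..s} then f i else 0) = (\<Sum>i\<in>{1..N} \<inter> {r+1..s}. f i)"
      by (subst sum.inter_restrict) auto
    also have "{1..N} \<inter> {r+1..s} = {r+1..s}"
      using sN by auto
    finally show ?thesis .
  qed
  have "(\<Sum>j=1..N. pod_weight dt j * m (y j) (y j)) = (\<Sum>i=1..N. m (ritz_err (?z i)) (ritz_err (?z i)))"
    using z yV lin orth by (intro M.orthonormal_transform[where a = a]) auto
  also have "\<dots> = (\<Sum>i=1..N. if i \<in> {r+1..s} then lam i * m (ritz_err (phi i)) (ritz_err (phi i)) else 0)"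
    using mode by (intro sum.cong) auto
  finally show "(\<Sum>j=1..N. pod_weight dt j * m (y j) (y j)) = (\<Sum>i=r+1..s. lam i * m (ritz_err (phi i)) (ritz_err (phi i)))"
    by (simp only: restrict)
  have "(\<Sum>j=1..N. pod_weight dt j * q (y j) (y j)) = (\<Sum>i=1..N. q (ritz_err (?z i)) (ritz_err (?z i)))"
    using z yV lin orth by (intro Q.orthonormal_transform[where a = a]) auto
  also have "\<dots> = (\<Sum>i=1..N. if i \<in> {r+1..s} then lam i * q (ritz_err (phi i)) (ritz_err (phi i)) else 0)"
    using mode by (intro sum.cong) auto
  finally show "(\<Sum>j=1..N. pod_weight dt j * q (y j) (y j)) = (\<Sum>i=r+1..s. lam i * q (ritz_err (phi i)) (ritz_err (phi i)))"
    by (simp only: restrict)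
qed

text \<open>
  The solution at step \<open>n\<close> is the weighted sum of the first \<open>n\<close> snapshots, and the weights add up to at most
  \<open>1 + dt * k\<close>, where \<open>dt * k\<close> is the final time.
\<close>
lemma solution_projection_error:
  fixes k :: nat
  assumes dt: "dt > 0" and n: "n \<in> {1..Suc k}"
    and u: "\<And>n. n \<in> {1..Suc k} \<Longrightarrow> u n \<in> V"
  defines "y \<equiv> \<lambda>j. ritz_err (pod_snapshot dt u j)"
  shows "m (ritz_err (u n)) (ritz_err (u n)) \<le> (1 + dt * k) * (\<Sum>j=1..Suc k. pod_weight dt j * m (y j) (y j))"
    and "q (ritz_err (u n)) (ritz_err (u n)) \<le> (1 + dt * k) * (\<Sum>j=1..Suc k. pod_weight dt j * q (y j) (y j))"
proof -
  have w0: "0 \<le> pod_weight dt j" for j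
    using dt by (simp add: pod_weight_def)
  have yV: "y j \<in> V" and sV: "pod_snapshot dt u j \<in> V" if "j \<in> {1..Suc k}" for j
    using pod_snapshot_mem[OF M.subspace_V u that] by (simp_all add: y_def)
  let ?s = "\<Sum>j=1..n. pod_weight dt j *\<^sub>R y j"
  have sub: "{1..n} \<subseteq> {1..Suc k}" using n by auto
  have total: "(\<Sum>j=1..n. pod_weight dt j) \<le> 1 + dt * k"
  proof -
    have "(\<Sum>j=1..n. pod_weight dt j) \<le> (\<Sum>j=1..Suc k. pod_weight dt j)"
      using sub w0 by (intro sum_mono2) auto
    also have "\<dots> = 1 + (\<Sum>j=2..Suc k. pod_weight dt j)"
      by (subst sum.atLeast_Suc_atMost) (auto simp: pod_weight_def numeral_2_eq_2)
    also have "(\<Sum>j=2..Suc k. pod_weight dt j) = dt * k"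
      by (simp add: pod_weight_def)
    finally show ?thesis .
  qed
  have un: "u n = (\<Sum>j=1..n. pod_weight dt j *\<^sub>R pod_snapshot dt u j)"
    using n by (intro snapshot_sum[OF dt]) simp
  have nul: "m (ritz_err (u n) - ?s) (ritz_err (u n) - ?s) = 0" "q (ritz_err (u n) - ?s) (ritz_err (u n) - ?s) = 0"
    unfolding un y_def
    using ritz_err_linear[of "{1..n}" "pod_snapshot dt u" "pod_weight dt"] sV sub by auto
  have sV': "?s \<in> V" using yV sub by (intro M.mem_sum M.mem) auto
  have "m (ritz_err (u n)) (ritz_err (u n)) = m ?s ?s"
    using n u sV' nul by (intro M.ip_self_cong) auto
  also have "\<dots> \<le> (\<Sum>j=1..n. pod_weight dt j) * (\<Sum>j=1..n. pod_weight dt j * m (y j) (y j))"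
    using yV sub w0 by (intro M.ip_weighted_sum_le) auto
  also have "\<dots> \<le> (1 + dt * k) * (\<Sum>j=1..Suc k. pod_weight dt j * m (y j) (y j))"
    using yV sub w0 M.ip_nonneg total dt
    by (intro mult_mono sum_mono2 sum_nonneg mult_nonneg_nonneg) auto
  finally show "m (ritz_err (u n)) (ritz_err (u n)) \<le> (1 + dt * k) * (\<Sum>j=1..Suc k. pod_weight dt j * m (y j) (y j))" .
  have "q (ritz_err (u n)) (ritz_err (u n)) = q ?s ?s"
    using n u sV' nul by (intro Q.ip_self_cong) auto
  also have "\<dots> \<le> (\<Sum>j=1..n. pod_weight dt j) * (\<Sum>j=1..n. pod_weight dt j * q (y j) (y j))"
    using yV sub w0 by (intro Q.ip_weighted_sum_le) auto
  also have "\<dots> \<le> (1 + dt * k) * (\<Sum>j=1..Suc k. pod_weight dt j * q (y j) (y j))"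
    using yV sub w0 Q.ip_nonneg total dt
    by (intro mult_mono sum_mono2 sum_nonneg mult_nonneg_nonneg) auto
  finally show "q (ritz_err (u n)) (ritz_err (u n)) \<le> (1 + dt * k) * (\<Sum>j=1..Suc k. pod_weight dt j * q (y j) (y j))" .
qed

text \<open>
  The difference \<open>p\<close> between the reduced solution and the Ritz projection of the full solution solves a backward
  Euler scheme with source \<open>d\<close>, the difference quotient of the Ritz projection error; \<open>d\<close> agrees with a
  snapshot error up to a null vector. Stability bounds \<open>p\<close>, and \<open>e\<close> differs from \<open>p\<close> by the projection error.
\<close>
lemma rom_error_le_projection_error:
  fixes k :: nat
  assumes dt: "dt > 0" and \<nu>: "\<nu> > 0"
    and u: "\<And>n. n \<in> {1..Suc k} \<Longrightarrow> u n \<in> V" and ur: "\<And>n. n \<in> {1..Suc k} \<Longrightarrow> ur n \<in> W"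
    and galerkin: "\<And>n v. n \<in> {1..k} \<Longrightarrow> v \<in> W \<Longrightarrow>
      m ((1 / dt) *\<^sub>R (u (Suc n) - u n) - (1 / dt) *\<^sub>R (ur (Suc n) - ur n)) v
      + \<nu> * q (u (Suc n) - ur (Suc n)) v = 0"
  defines "y \<equiv> \<lambda>j. ritz_err (pod_snapshot dt u j)" and "e \<equiv> \<lambda>n. u n - ur n"
  defines "Sm \<equiv> \<Sum>j=1..Suc k. pod_weight dt j * m (y j) (y j)"
    and "Sq \<equiv> \<Sum>j=1..Suc k. pod_weight dt j * q (y j) (y j)"
    and "p1 \<equiv> ur 1 - R (u 1)"
  shows "m (e (Suc k)) (e (Suc k)) + \<nu> * dt * (\<Sum>n=1..k. q (e (Suc n)) (e (Suc n)))
    \<le> 2 * (1 + dt * k) * (Sm + \<nu> * (dt * k) * Sq) + 2 * (m p1 p1 + K / \<nu> * Sm)"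
proof -
  define p where "p n = ur n - R (u n)" for n
  define d where "d n = (1 / dt) *\<^sub>R (ritz_err (u (Suc n)) - ritz_err (u n))" for n
  have urV: "ur n \<in> V" if "n \<in> {1..Suc k}" for n
    using ur that W_V by auto
  have pV: "p n \<in> V" if "n \<in> {1..Suc k}" for n
    using u urV that by (simp add: p_def)
  have pW: "p n \<in> W" if "n \<in> {1..Suc k}" for n
    unfolding p_def using u ur that by (intro subspace_diff[OF subspace_W] R_mem) auto
  have dV: "d n \<in> V" if "n \<in> {1..k}" for n
    using that u by (simp add: d_def)
  have e_eq: "e n = ritz_err (u n) - p n" for n
    by (simp add: e_def ritz_err_def p_def)
  have eV: "e n \<in> V" if "n \<in> {1..Suc k}" for n
    using u urV that by (simp add: e_def)
  have y_nonneg: "0 \<le> pod_weight dt j * m (y j) (y j)" "0 \<le> pod_weight dt j * q (y j) (y j)"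
    if "j \<in> {1..Suc k}" for j
  proof -
    have "y j \<in> V"
      using pod_snapshot_mem[OF M.subspace_V u that] by (simp_all add: y_def)
    then show "0 \<le> pod_weight dt j * m (y j) (y j)" "0 \<le> pod_weight dt j * q (y j) (y j)"
      using M.ip_nonneg Q.ip_nonneg dt by (auto simp: pod_weight_def)
  qed
  have eq: "m ((1 / dt) *\<^sub>R (p (Suc n) - p n)) (p (Suc n)) + \<nu> * q (p (Suc n)) (p (Suc n))
      = m (d n) (p (Suc n))" if n: "n \<in> {1..k}" for n
  proof -
    let ?v = "p (Suc n)"
    let ?de = "(1 / dt) *\<^sub>R (u (Suc n) - u n) - (1 / dt) *\<^sub>R (ur (Suc n) - ur n)"
    have mem: "?v \<in> V" "?v \<in> W" "?de \<in> V" "u (Suc n) \<in> V" "e (Suc n) \<in> V" "ur (Suc n) \<in> V"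
      using pV pW n u urV eV by auto
    have "(1 / dt) *\<^sub>R (p (Suc n) - p n) = d n - ?de"
      by (simp add: d_def ritz_err_def p_def algebra_simps)
    then have 1: "m ((1 / dt) *\<^sub>R (p (Suc n) - p n)) ?v = m (d n) ?v - m ?de ?v"
      using mem dV[OF n] by (simp only: M.ip_diff_left)
    have "q ?v ?v = q (ritz_err (u (Suc n)) - e (Suc n)) ?v"
      by (simp add: e_eq)
    also have "\<dots> = q (ritz_err (u (Suc n))) ?v - q (e (Suc n)) ?v"
      using mem by (simp add: Q.ip_diff_left)
    \<comment> \<open>This is why the Ritz projection is used: the projection error leaves no trace in the gradient term.\<close>
    also have "q (ritz_err (u (Suc n))) ?v = 0"
      using R_orth mem by (simp add: ritz_err_def)
    finally show ?thesis
      using 1 galerkin[OF n mem(2)] by (simp add: e_def algebra_simps)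
  qed
  have dy: "m (d n) (d n) = m (y (Suc n)) (y (Suc n))" if n: "n \<in> {1..k}" for n
  proof -
    let ?c = "\<lambda>j. if j = n then - (1 / dt) else 1 / dt"
    have snap: "pod_snapshot dt u (Suc n) = (\<Sum>j\<in>{n, Suc n}. ?c j *\<^sub>R u j)"
      using n by (simp add: pod_snapshot_def algebra_simps)
    have d: "d n = (\<Sum>j\<in>{n, Suc n}. ?c j *\<^sub>R ritz_err (u j))"
      by (simp add: d_def algebra_simps)
    have "m (y (Suc n) - d n) (y (Suc n) - d n) = 0"
      unfolding y_def snap d using u n by (intro ritz_err_linear(1)) auto
    moreover have "y (Suc n) \<in> V"
      using n u by (simp add: y_def pod_snapshot_def)
    ultimately show ?thesis
      using M.ip_self_cong[of "y (Suc n)" "d n"] dV n by simp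
  qed
  have stab: "m (p (Suc k)) (p (Suc k)) + \<nu> * dt * (\<Sum>n=1..k. q (p (Suc n)) (p (Suc n)))
    \<le> m (p 1) (p 1) + K / \<nu> * (\<Sum>n=1..k. dt * m (d n) (d n))"
    using pV dV dt \<nu> eq by (intro backward_euler_stability) auto
  have "(\<Sum>n=1..k. dt * m (d n) (d n))
      = (\<Sum>n=1..k. pod_weight dt (Suc n) * m (y (Suc n)) (y (Suc n)))"
    by (intro sum.cong) (auto simp: dy pod_weight_def)
  also have "\<dots> = (\<Sum>j=2..Suc k. pod_weight dt j * m (y j) (y j))"
    by (simp add: sum.shift_bounds_cl_Suc_ivl numeral_2_eq_2 del: sum.cl_ivl_Suc)
  also have "\<dots> \<le> Sm"
    unfolding Sm_def using y_nonneg by (intro sum_mono2) auto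
  finally have dS: "K / \<nu> * (\<Sum>n=1..k. dt * m (d n) (d n)) \<le> K / \<nu> * Sm"
    using K_pos \<nu> by (intro mult_left_mono) auto
  have m_e: "m (e (Suc k)) (e (Suc k)) \<le> 2 * ((1 + dt * k) * Sm) + 2 * m (p (Suc k)) (p (Suc k))"
  proof -
    have "m (e (Suc k)) (e (Suc k)) \<le> 2 * m (ritz_err (u (Suc k))) (ritz_err (u (Suc k))) + 2 * m (p (Suc k)) (p (Suc k))"
      unfolding e_eq using u pV by (intro M.ip_diff_self_le) auto
    also have "m (ritz_err (u (Suc k))) (ritz_err (u (Suc k))) \<le> (1 + dt * k) * Sm"
      unfolding Sm_def y_def using dt u by (intro solution_projection_error) auto
    finally show ?thesis by simp
  qed
  have "(\<Sum>n=1..k. q (e (Suc n)) (e (Suc n)))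
      \<le> (\<Sum>n=1..k. 2 * ((1 + dt * k) * Sq) + 2 * q (p (Suc n)) (p (Suc n)))"
  proof (intro sum_mono)
    fix n assume n: "n \<in> {1..k}"
    have "q (e (Suc n)) (e (Suc n)) \<le> 2 * q (ritz_err (u (Suc n))) (ritz_err (u (Suc n))) + 2 * q (p (Suc n)) (p (Suc n))"
      unfolding e_eq using u pV n by (intro Q.ip_diff_self_le) auto
    also have "q (ritz_err (u (Suc n))) (ritz_err (u (Suc n))) \<le> (1 + dt * k) * Sq"
      unfolding Sq_def y_def using dt u n by (intro solution_projection_error) auto
    finally show "q (e (Suc n)) (e (Suc n)) \<le> 2 * ((1 + dt * k) * Sq) + 2 * q (p (Suc n)) (p (Suc n))"
      by simp
  qed
  also have "\<dots> = k * (2 * ((1 + dt * k) * Sq)) + 2 * (\<Sum>n=1..k. q (p (Suc n)) (p (Suc n)))"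
    by (simp add: sum.distrib sum_distrib_left)
  finally have "\<nu> * dt * (\<Sum>n=1..k. q (e (Suc n)) (e (Suc n)))
      \<le> \<nu> * dt * (k * (2 * ((1 + dt * k) * Sq)) + 2 * (\<Sum>n=1..k. q (p (Suc n)) (p (Suc n))))"
    using dt \<nu> by (intro mult_left_mono) auto
  then have "m (e (Suc k)) (e (Suc k)) + \<nu> * dt * (\<Sum>n=1..k. q (e (Suc n)) (e (Suc n)))
    \<le> 2 * (1 + dt * k) * (Sm + \<nu> * (dt * k) * Sq)
      + 2 * (m (p (Suc k)) (p (Suc k)) + \<nu> * dt * (\<Sum>n=1..k. q (p (Suc n)) (p (Suc n))))"
    using m_e by (simp add: algebra_simps)
  also have "\<dots> \<le> 2 * (1 + dt * k) * (Sm + \<nu> * (dt * k) * Sq) + 2 * (m p1 p1 + K / \<nu> * Sm)"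
    using stab dS by (simp add: p1_def p_def)
  finally show ?thesis .
qed

end

section \<open>Calculus of smooth functions\<close>

lemma Ck_function_mono_Suc: "Ck_function (Suc k) g \<Longrightarrow> Ck_function k g"
  by (induction k arbitrary: g)
     (auto intro!: differentiable_imp_continuous_on simp: differentiable_on_def)

lemma Ck_function_const: "Ck_function k (\<lambda>x. c)"
  by (induction k arbitrary: c) auto

lemma Ck_function_inner_left: "Ck_function k (\<lambda>x::'a::euclidean_space. x \<bullet> v)"
proof (cases k)
  case 0
  then show ?thesis by (auto intro!: continuous_intros)
next
  case (Suc l)
  have "((\<lambda>x. x \<bullet> v) has_derivative (\<lambda>y. y \<bullet> v)) (at x)" for x :: 'a
    by (auto intro!: derivative_eq_intros)
  then have "frechet_derivative (\<lambda>x. x \<bullet> v) (at x) = (\<lambda>y. y \<bullet> v)"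
    and "(\<lambda>x. x \<bullet> v) differentiable (at x)" for x :: 'a
    by (auto simp: frechet_derivative_at[symmetric] differentiable_def)
  then show ?thesis
    by (simp add: Suc Ck_function_const)
qed

lemma Ck_function_add:
  assumes "Ck_function k g" "Ck_function k h"
  shows "Ck_function k (\<lambda>x. g x + h x)"
  using assms
proof (induction k arbitrary: g h)
  case 0
  then show ?case by (auto intro!: continuous_intros)
next
  case (Suc k)
  have d: "g differentiable (at x)" "h differentiable (at x)" for x
    using Suc.prems by auto
  have "frechet_derivative (\<lambda>x. g x + h x) (at x)
      = (\<lambda>b. frechet_derivative g (at x) b + frechet_derivative h (at x) b)" for x
    using d[of x] by (intro frechet_derivative_at[symmetric] has_derivative_add)
      (auto simp: frechet_derivative_works)
  then show ?case
    using Suc by (auto intro!: Suc.IH derivative_intros)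
qed

lemma frechet_derivative_mult:
  fixes g h :: "'a::real_normed_vector \<Rightarrow> real"
  assumes "g differentiable (at x)" "h differentiable (at x)"
  shows "frechet_derivative (\<lambda>x. g x * h x) (at x) b
      = frechet_derivative g (at x) b * h x + g x * frechet_derivative h (at x) b"
proof -
  have "((\<lambda>x. g x * h x) has_derivative
      (\<lambda>b. g x * frechet_derivative h (at x) b + frechet_derivative g (at x) b * h x)) (at x)"
    using assms by (intro has_derivative_mult) (auto simp: frechet_derivative_works)
  then show ?thesis
    by (simp add: frechet_derivative_at[symmetric])
qed

lemma Ck_function_mult:
  assumes "Ck_function k g" "Ck_function k h"
  shows "Ck_function k (\<lambda>x. g x * h x)"
  using assms
proof (induction k arbitrary: g h)
  case 0
  then show ?case by (auto intro!: continuous_intros)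
next
  case (Suc k)
  have d: "g differentiable (at x)" "h differentiable (at x)" for x
    using Suc.prems by auto
  note Ck_function_mono_Suc[OF Suc.prems(1)] Ck_function_mono_Suc[OF Suc.prems(2)]
  then show ?case
    using Suc.prems d
    by (auto simp: frechet_derivative_mult intro!: Suc.IH Ck_function_add derivative_intros)
qed

section \<open>A smooth bump function\<close>

text \<open>
  The functions \<open>exp (- 1/t) / t ^ m\<close>, extended by zero to \<open>t \<le> 0\<close>. As \<open>flat 0\<close> alone is not closed under
  derivatives, the whole family is shown to be smooth at once.
\<close>
definition flat :: "nat \<Rightarrow> real \<Rightarrow> real" where
  "flat m t = (if t > 0 then inverse t ^ m / exp (inverse t) else 0)"

text \<open>
  The exponential beats every power, so all derivatives match the zero extension at the origin.
\<close>
lemma flat_tendsto_0: "(flat m \<longlongrightarrow> 0) (at 0)"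
proof (rule filterlim_split_at)
  have "eventually (\<lambda>t. flat m t = 0) (at_left 0)"
    by (auto simp: eventually_at_left_field flat_def intro: exI[of _ "-1"])
  then show "(flat m \<longlongrightarrow> 0) (at_left 0)"
    by (rule tendsto_eventually)
  have "((\<lambda>t::real. inverse t ^ m / exp (inverse t)) \<longlongrightarrow> 0) (at_right 0)"
    by (rule filterlim_compose[OF tendsto_power_div_exp_0 filterlim_inverse_at_top_right])
  moreover have "eventually (\<lambda>t. inverse t ^ m / exp (inverse t) = flat m t) (at_right 0)"
    by (auto simp: eventually_at_right_field flat_def intro: exI[of _ 1])
  ultimately show "(flat m \<longlongrightarrow> 0) (at_right 0)"
    by (rule Lim_transform_eventually)
qed

lemma DERIV_flat: "(flat m has_field_derivative (flat (m + 2) t - m * flat (m + 1) t)) (at t)"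
proof -
  consider "t < 0" | "t = 0" | "t > 0" by linarith
  then show ?thesis
  proof cases
    case 1
    have "((\<lambda>_. 0) has_field_derivative 0) (at t)" by simp
    then have "(flat m has_field_derivative 0) (at t)"
      by (rule has_field_derivative_transform_within_open[of _ _ _ "{..<0}"])
         (use 1 in \<open>auto simp: flat_def\<close>)
    then show ?thesis using 1 by (simp add: flat_def)
  next
    case 2
    \<comment> \<open>The difference quotient of \<open>flat m\<close> at zero is \<open>flat (m + 1)\<close>.\<close>
    have "((\<lambda>y. (flat m y - flat m 0) / (y - 0)) \<longlongrightarrow> 0) (at 0)"
    proof (rule Lim_transform_eventually[OF flat_tendsto_0[of "m + 1"]])
      show "eventually (\<lambda>y. flat (m + 1) y = (flat m y - flat m 0) / (y - 0)) (at 0)"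
        by (intro always_eventually) (auto simp: flat_def field_simps)
    qed
    then show ?thesis
      using 2 by (simp add: has_field_derivative_iff flat_def)
  next
    case 3
    let ?u = "inverse t"
    have "((\<lambda>t. inverse t ^ m) has_field_derivative - m * ?u ^ (m + 1)) (at t)"
      using DERIV_power[OF DERIV_inverse[of t], of m] 3
      by (cases m) (simp_all add: algebra_simps)
    moreover have "((\<lambda>t. exp (- inverse t)) has_field_derivative exp (- ?u) * ?u ^ 2) (at t)"
      using 3 by (auto intro!: derivative_eq_intros simp: power2_eq_square)
    ultimately have "((\<lambda>t. inverse t ^ m * exp (- inverse t)) has_field_derivative
        (- m * ?u ^ (m + 1)) * exp (- ?u) + (exp (- ?u) * ?u ^ 2) * ?u ^ m) (at t)"
      by (rule DERIV_mult)
    also have "(- m * ?u ^ (m + 1)) * exp (- ?u) + (exp (- ?u) * ?u ^ 2) * ?u ^ m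
        = ?u ^ (m + 2) / exp ?u - m * (?u ^ (m + 1) / exp ?u)"
      by (simp add: exp_minus divide_inverse power2_eq_square algebra_simps)
    finally have "((\<lambda>t. inverse t ^ m * exp (- inverse t)) has_field_derivative
        (?u ^ (m + 2) / exp ?u - m * (?u ^ (m + 1) / exp ?u))) (at t)" .
    then have "(flat m has_field_derivative
        (inverse t ^ (m + 2) / exp (inverse t) - m * (inverse t ^ (m + 1) / exp (inverse t)))) (at t)"
      by (rule has_field_derivative_transform_within_open[of _ _ _ "{0<..}"])
         (use 3 in \<open>auto simp: flat_def exp_minus divide_inverse\<close>)
    then show ?thesis using 3 by (simp add: flat_def)
  qed
qed

lemma Ck_function_flat_compose:
  assumes "\<And>k. Ck_function k p"
  shows "Ck_function k (\<lambda>x. flat m (p x))"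
proof (induction k arbitrary: m)
  case 0
  have "continuous_on UNIV (flat m)"
    by (meson DERIV_continuous DERIV_flat continuous_at_imp_continuous_on)
  then show ?case
    using assms[of 0] by (auto intro: continuous_on_compose2[of UNIV "flat m"])
next
  case (Suc k)
  have p: "p differentiable (at x)" for x
    using assms[of "Suc 0"] by simp
  have D: "((\<lambda>x. flat m (p x)) has_derivative
      (\<lambda>b. frechet_derivative p (at x) b * (flat (m + 2) (p x) - m * flat (m + 1) (p x)))) (at x)" for x
    using p by (intro DERIV_compose_FDERIV[OF DERIV_flat]) (auto simp: frechet_derivative_works)
  have F: "frechet_derivative (\<lambda>x. flat m (p x)) (at x) b
      = frechet_derivative p (at x) b * (flat (m + 2) (p x) + (- real m) * flat (m + 1) (p x))" for x b
    using D[of x] by (simp add: frechet_derivative_at[symmetric])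
  have "Ck_function k (\<lambda>x. frechet_derivative p (at x) b)" if "b \<in> Basis" for b
    using assms[of "Suc k"] that by simp
  then have "Ck_function k (\<lambda>x. frechet_derivative p (at x) b
      * (flat (m + 2) (p x) + (- real m) * flat (m + 1) (p x)))" if "b \<in> Basis" for b
    using that by (intro Ck_function_mult Ck_function_add Ck_function_const Suc.IH)
  then show ?case
    using D by (auto simp: F differentiable_def)
qed

text \<open>Squared distances make the bump smooth at its centre as well.\<close>
definition bump :: "'a::euclidean_space \<Rightarrow> real \<Rightarrow> 'a \<Rightarrow> real" where
  "bump c s x = flat 0 (s\<^sup>2 - (dist c x)\<^sup>2)"

lemma Ck_function_dist_square: "Ck_function k (\<lambda>x::'a::euclidean_space. (dist c x)\<^sup>2)"
proof -
  have "(dist c x)\<^sup>2 = (\<Sum>b\<in>Basis. (x \<bullet> b + - (c \<bullet> b)) * (x \<bullet> b + - (c \<bullet> b)))" for x :: 'a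
  proof -
    have "(dist c x)\<^sup>2 = (\<Sum>b\<in>Basis. (dist (c \<bullet> b) (x \<bullet> b))\<^sup>2)"
      unfolding euclidean_dist_l2[of c] L2_set_def by (rule real_sqrt_pow2) (simp add: sum_nonneg)
    also have "\<dots> = (\<Sum>b\<in>Basis. (x \<bullet> b + - (c \<bullet> b)) * (x \<bullet> b + - (c \<bullet> b)))"
      by (intro sum.cong) (auto simp: dist_real_def power2_eq_square algebra_simps)
    finally show ?thesis .
  qed
  moreover have "Ck_function k (\<lambda>x. \<Sum>b\<in>B. (x \<bullet> b + - (c \<bullet> b)) * (x \<bullet> b + - (c \<bullet> b)))"
    if "finite B" for B
    using that
    by (induction B)
       (auto intro!: Ck_function_add Ck_function_mult Ck_function_const Ck_function_inner_left
        simp del: add_uminus_conv_diff mult_minus_right)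
  ultimately show ?thesis by simp
qed

lemma Ck_function_bump: "Ck_function k (bump c s)"
proof -
  have "Ck_function k (\<lambda>x. s\<^sup>2 + (-1) * (dist c x)\<^sup>2)" for k
    by (intro Ck_function_add Ck_function_mult Ck_function_const Ck_function_dist_square)
  from Ck_function_flat_compose[OF this] show ?thesis
    by (simp add: bump_def[abs_def])
qed

lemma bump_bounds: "0 \<le> bump c s x" "bump c s x \<le> 1"
  by (auto simp: bump_def flat_def field_simps)

lemma bump_pos_iff:
  assumes "s > 0"
  shows "bump c s x > 0 \<longleftrightarrow> x \<in> ball c s"
proof -
  have "(dist c x)\<^sup>2 < s\<^sup>2 \<longleftrightarrow> dist c x < s"
    using assms by (auto intro: power_strict_mono power2_less_imp_less)
  then show ?thesis
    by (auto simp: bump_def flat_def)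
qed

section \<open>Test functions\<close>

lemma test_functionsI:
  assumes "\<And>k. Ck_function k \<psi>" "compact K" "K \<subseteq> \<Omega>" "\<And>x. x \<notin> K \<Longrightarrow> \<psi> x = 0"
  shows "\<psi> \<in> test_functions \<Omega>"
proof -
  have "closure {x. \<psi> x \<noteq> 0} \<subseteq> K"
    using assms by (intro closure_minimal compact_imp_closed) auto
  moreover have "compact (closure {x. \<psi> x \<noteq> 0})"
    using calculation assms(2) bounded_subset by (auto simp: compact_eq_bounded_closed)
  ultimately show ?thesis
    using assms by (auto simp: test_functions_def)
qed

lemma test_functionsE:
  assumes "\<psi> \<in> test_functions \<Omega>"
  obtains K where "compact K" "K \<subseteq> \<Omega>" "\<And>x. x \<notin> K \<Longrightarrow> \<psi> x = 0"
  using assms closure_subset[of "{x. \<psi> x \<noteq> 0}"]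
  by (intro that[of "closure {x. \<psi> x \<noteq> 0}"]) (auto simp: test_functions_def)

lemma test_functions_Ck: "\<psi> \<in> test_functions \<Omega> \<Longrightarrow> Ck_function k \<psi>"
  by (simp add: test_functions_def)

lemma test_functions_mono: "\<psi> \<in> test_functions U \<Longrightarrow> U \<subseteq> \<Omega> \<Longrightarrow> \<psi> \<in> test_functions \<Omega>"
  by (auto simp: test_functions_def)

lemma test_functions_differentiable: "\<psi> \<in> test_functions \<Omega> \<Longrightarrow> \<psi> differentiable (at x)"
  using test_functions_Ck[of \<psi> \<Omega> 1] by simp

lemma test_functions_continuous: "\<psi> \<in> test_functions \<Omega> \<Longrightarrow> continuous_on A \<psi>"
  using test_functions_Ck[of \<psi> \<Omega> 0] by (auto intro: continuous_on_subset)

lemma test_functions_outside: "\<psi> \<in> test_functions \<Omega> \<Longrightarrow> x \<notin> \<Omega> \<Longrightarrow> \<psi> x = 0"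
  by (metis test_functionsE subsetD)

lemma test_functions_zero: "(\<lambda>x. 0) \<in> test_functions \<Omega>"
  by (rule test_functionsI[of _ "{}"]) (auto intro: Ck_function_const)

lemma test_functions_add:
  assumes "\<psi> \<in> test_functions \<Omega>" "\<eta> \<in> test_functions \<Omega>"
  shows "(\<lambda>x. \<psi> x + \<eta> x) \<in> test_functions \<Omega>"
proof -
  obtain K where K: "compact K" "K \<subseteq> \<Omega>" "\<And>x. x \<notin> K \<Longrightarrow> \<psi> x = 0"
    using test_functionsE[OF assms(1)] by blast
  obtain L where L: "compact L" "L \<subseteq> \<Omega>" "\<And>x. x \<notin> L \<Longrightarrow> \<eta> x = 0"
    using test_functionsE[OF assms(2)] by blast
  show ?thesis
    using K L assms by (intro test_functionsI[of _ "K \<union> L"])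
      (auto intro: Ck_function_add test_functions_Ck)
qed

lemma test_functions_mult_smooth:
  assumes "\<psi> \<in> test_functions \<Omega>" "\<And>k. Ck_function k g"
  shows "(\<lambda>x. g x * \<psi> x) \<in> test_functions \<Omega>"
proof -
  obtain K where K: "compact K" "K \<subseteq> \<Omega>" "\<And>x. x \<notin> K \<Longrightarrow> \<psi> x = 0"
    using test_functionsE[OF assms(1)] by blast
  show ?thesis
    using K assms by (intro test_functionsI[of _ K])
      (auto intro: Ck_function_mult test_functions_Ck)
qed

lemma test_functions_derivative:
  assumes "\<psi> \<in> test_functions \<Omega>" "b \<in> Basis"
  shows "(\<lambda>x. frechet_derivative \<psi> (at x) b) \<in> test_functions \<Omega>"
proof -
  obtain K where K: "compact K" "K \<subseteq> \<Omega>" "\<And>x. x \<notin> K \<Longrightarrow> \<psi> x = 0"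
    using test_functionsE[OF assms(1)] by blast
  have "frechet_derivative \<psi> (at x) b = 0" if "x \<notin> K" for x
  proof -
    have "((\<lambda>_. 0) has_derivative (\<lambda>_. 0)) (at x)" by simp
    then have "(\<psi> has_derivative (\<lambda>_. 0)) (at x)"
      by (rule has_derivative_transform_within_open[of _ _ _ _ "- K"])
         (use K that in \<open>auto simp: compact_imp_closed open_Compl\<close>)
    then show ?thesis
      by (simp add: frechet_derivative_at[symmetric])
  qed
  moreover have "Ck_function k (\<lambda>x. frechet_derivative \<psi> (at x) b)" for k
    using test_functions_Ck[OF assms(1), of "Suc k"] assms(2) by simp
  ultimately show ?thesis
    using K by (intro test_functionsI[of _ K]) auto
qed

lemma test_functions_bounded:
  assumes "\<psi> \<in> test_functions \<Omega>"
  shows "\<exists>B. \<forall>x. \<bar>\<psi> x\<bar> \<le> B"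
proof -
  obtain K where K: "compact K" "K \<subseteq> \<Omega>" "\<And>x. x \<notin> K \<Longrightarrow> \<psi> x = 0"
    using test_functionsE[OF assms] by blast
  have "bounded (\<psi> ` K)"
    using K(1) test_functions_continuous[OF assms] by (intro compact_imp_bounded compact_continuous_image)
  then obtain B where B: "\<And>x. x \<in> K \<Longrightarrow> \<bar>\<psi> x\<bar> \<le> B"
    by (auto simp: bounded_iff)
  have "\<bar>\<psi> x\<bar> \<le> max B 0" for x
    using B[of x] K(3)[of x] by (cases "x \<in> K") auto
  then show ?thesis by blast
qed

lemma integral_translation:
  fixes g :: "'a::euclidean_space \<Rightarrow> real"
  assumes "g \<in> borel_measurable borel"
  shows "(LINT x|lborel. g (c + x)) = (LINT x|lborel. g x)"
proof -
  have "(LINT x|lborel. g x) = (LINT x|distr lborel borel ((+) c). g x)"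
    by (simp add: lborel_distr_plus)
  also have "\<dots> = (LINT x|lborel. g (c + x))"
    using assms by (subst integral_distr) auto
  finally show ?thesis by simp
qed

text \<open>
  The integral of a difference quotient vanishes because Lebesgue measure is translation invariant. The
  quotients converge to the derivative and are bounded by a constant on a fixed ball, so dominated
  convergence applies.
\<close>
lemma integral_derivative_test_function:
  fixes \<psi> :: "'a::euclidean_space \<Rightarrow> real"
  assumes \<psi>: "\<psi> \<in> test_functions \<Omega>" and b: "b \<in> Basis"
  shows "(LINT x|lborel. frechet_derivative \<psi> (at x) b) = 0"
proof -
  let ?D = "\<lambda>x. frechet_derivative \<psi> (at x) b"
  have D: "?D \<in> test_functions \<Omega>"
    using assms by (rule test_functions_derivative)
  obtain B where B_all: "\<forall>x. \<bar>?D x\<bar> \<le> B"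
    using test_functions_bounded[OF D] by (rule exE)
  have B: "\<bar>?D x\<bar> \<le> B" for x
    using B_all by (rule spec)
  obtain K where K: "compact K" "K \<subseteq> \<Omega>" "\<And>x. x \<notin> K \<Longrightarrow> \<psi> x = 0"
    using test_functionsE[OF \<psi>] by blast
  obtain R where R: "\<And>x. x \<in> K \<Longrightarrow> norm x \<le> R"
    using compact_imp_bounded[OF K(1)] by (auto simp: bounded_iff)
  have B0: "B \<ge> 0" using B[of 0] by linarith
  define h where "h n = 1 / (real n + 1)" for n
  have h: "0 < h n" "h n \<le> 1" for n by (auto simp: h_def)
  define q where "q n x = (\<psi> (h n *\<^sub>R b + x) - \<psi> x) / h n" for n x
  have meas: "\<psi> \<in> borel_measurable borel" "?D \<in> borel_measurable borel"
    using test_functions_continuous[OF \<psi>] test_functions_continuous[OF D]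
    by (auto intro: borel_measurable_continuous_onI)
  have meas_q: "q n \<in> borel_measurable lborel" for n
    unfolding q_def using meas(1) by measurable
  have line: "((\<lambda>t. \<psi> (t *\<^sub>R b + x)) has_real_derivative ?D (t *\<^sub>R b + x)) (at t)" for t x
  proof -
    have "(\<psi> has_derivative frechet_derivative \<psi> (at (t *\<^sub>R b + x))) (at (t *\<^sub>R b + x))"
      using test_functions_differentiable[OF \<psi>] by (simp add: frechet_derivative_works)
    moreover have "((\<lambda>t. t *\<^sub>R b + x) has_derivative (\<lambda>t. t *\<^sub>R b)) (at t)"
      by (auto intro!: derivative_eq_intros)
    ultimately have "((\<lambda>t. \<psi> (t *\<^sub>R b + x)) has_derivative
        (\<lambda>s. frechet_derivative \<psi> (at (t *\<^sub>R b + x)) (s *\<^sub>R b))) (at t)"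
      by (rule has_derivative_compose[rotated])
    moreover have "linear (frechet_derivative \<psi> (at (t *\<^sub>R b + x)))"
      using test_functions_differentiable[OF \<psi>] by (rule linear_frechet_derivative)
    ultimately show ?thesis
      by (simp add: has_field_derivative_def linear_cmul mult.commute[of _ "?D _"])
  qed
  \<comment> \<open>The steps are at most one, so the translated support stays within distance one of the original.\<close>
  have bound: "norm (q n x) \<le> B * indicator (cball 0 (R + 1)) x" for n x
  proof (cases "x \<in> cball 0 (R + 1)")
    case True
    obtain z where "\<psi> (h n *\<^sub>R b + x) - \<psi> (0 *\<^sub>R b + x) = (h n - 0) * ?D (z *\<^sub>R b + x)"
      using MVT2[of 0 "h n" "\<lambda>t. \<psi> (t *\<^sub>R b + x)" "\<lambda>t. ?D (t *\<^sub>R b + x)"] line h[of n] by blast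
    then have "q n x = ?D (z *\<^sub>R b + x)"
      using h(1)[of n] by (simp add: q_def)
    then show ?thesis using B True by simp
  next
    case False
    then have "norm x > R + 1" by simp
    moreover have "norm x \<le> norm (h n *\<^sub>R b + x) + norm (h n *\<^sub>R b)"
      using norm_triangle_ineq4[of "h n *\<^sub>R b + x" "h n *\<^sub>R b"] by simp
    moreover have "norm (h n *\<^sub>R b) \<le> 1"
      using h[of n] b by simp
    ultimately have "x \<notin> K" "h n *\<^sub>R b + x \<notin> K"
      using R[of x] R[of "h n *\<^sub>R b + x"] by auto
    then show ?thesis
      using K(3) False by (simp add: q_def)
  qed
  have lim: "(\<lambda>n. q n x) \<longlonglongrightarrow> ?D x" for x
  proof -
    have "((\<lambda>s. (\<psi> (s *\<^sub>R b + x) - \<psi> (0 *\<^sub>R b + x)) / (s - 0)) \<longlongrightarrow> ?D (0 *\<^sub>R b + x)) (at 0)"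
      using line[of x 0] unfolding has_field_derivative_iff .
    moreover have "filterlim h (at 0) sequentially"
      unfolding filterlim_at
    proof
      show "eventually (\<lambda>n. h n \<in> UNIV \<and> h n \<noteq> 0) sequentially"
        using h(1) by (auto intro!: always_eventually less_imp_neq[symmetric])
      show "h \<longlonglongrightarrow> 0"
        unfolding h_def using LIMSEQ_inverse_real_of_nat by (simp add: inverse_eq_divide add.commute)
    qed
    ultimately show ?thesis
      using filterlim_compose by (fastforce simp: q_def)
  qed
  have int_q: "(LINT x|lborel. q n x) = 0" for n
  proof -
    obtain C where C: "\<forall>x. \<bar>\<psi> x\<bar> \<le> C"
      using test_functions_bounded[OF \<psi>] by (rule exE)
    have int: "integrable lborel \<psi>"
    proof (rule Bochner_Integration.integrable_bound)
      show "integrable lborel (\<lambda>x. C * indicator K x :: real)"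
        using K(1) emeasure_compact_finite[of K] by (auto simp: compact_imp_closed less_top)
      show "AE x in lborel. norm (\<psi> x) \<le> norm (C * indicator K x)"
        using C K(3) by (intro AE_I2) (auto simp: indicator_def intro: order_trans[OF _ abs_ge_self])
    qed (use meas in simp)
    have "integrable lborel (\<lambda>x. \<psi> (h n *\<^sub>R b + x))"
    proof -
      have "integrable (distr lborel borel ((+) (h n *\<^sub>R b))) \<psi>"
        using int by (simp add: lborel_distr_plus)
      then show ?thesis
        using meas(1) by (subst (asm) integrable_distr_eq) auto
    qed
    then show ?thesis
      using int integral_translation[OF meas(1)] by (simp add: q_def)
  qed
  have "(\<lambda>n. LINT x|lborel. q n x) \<longlonglongrightarrow> (LINT x|lborel. ?D x)"
  proof (rule integral_dominated_convergence[where w = "\<lambda>x. B * indicator (cball 0 (R + 1)) x"])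
    show "integrable lborel (\<lambda>x::'a. B * indicator (cball 0 (R + 1)) x :: real)"
      using emeasure_lborel_cball_finite[of 0 "R+1"] by (auto simp: less_top)
  qed (use meas meas_q bound lim in auto)
  then show ?thesis
    by (simp add: int_q LIMSEQ_const_iff)
qed

section \<open>Functions as vectors\<close>

text \<open>Pointwise operations let the abstract theory above apply to spaces of functions.\<close>
instantiation "fun" :: (type, real_vector) real_vector
begin

definition scaleR_fun :: "real \<Rightarrow> ('a \<Rightarrow> 'b) \<Rightarrow> 'a \<Rightarrow> 'b" where
  "scaleR_fun c g = (\<lambda>x. c *\<^sub>R g x)"

instance
  by standard (simp_all add: scaleR_fun_def fun_eq_iff scaleR_add_right scaleR_add_left)

end

lemma scaleR_fun_apply [simp]: "(c *\<^sub>R g) x = c *\<^sub>R g x"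
  by (simp add: scaleR_fun_def)

lemma sum_fun_apply: "(\<Sum>j\<in>J. g j) x = (\<Sum>j\<in>J. g j x)"
  by (induction J rule: infinite_finite_induct) auto

section \<open>Square-integrable functions\<close>

lemma L2_integrable_inner:
  assumes "g \<in> L2 \<Omega>" "h \<in> L2 \<Omega>"
  shows "integrable (lebesgue_on \<Omega>) (\<lambda>x. g x \<bullet> h x)"
proof (rule Bochner_Integration.integrable_bound)
  show "integrable (lebesgue_on \<Omega>) (\<lambda>x. (norm (g x))\<^sup>2 + (norm (h x))\<^sup>2)"
    using assms by (simp add: L2_def)
  show "(\<lambda>x. g x \<bullet> h x) \<in> borel_measurable (lebesgue_on \<Omega>)"
    using assms by (auto simp: L2_def intro: borel_measurable_inner)
  have "\<bar>a \<bullet> b\<bar> \<le> \<bar>(norm a)\<^sup>2 + (norm b)\<^sup>2\<bar>" for a b :: 'b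
  proof -
    have "\<bar>a \<bullet> b\<bar> \<le> norm a * norm b"
      by (rule Cauchy_Schwarz_ineq2)
    also have "\<dots> \<le> (norm a)\<^sup>2 + (norm b)\<^sup>2"
      using sum_squares_bound[of "norm a" "norm b"] mult_nonneg_nonneg[of "norm a" "norm b"]
      by (simp del: mult_nonneg_nonneg)
    finally show ?thesis by simp
  qed
  then show "AE x in lebesgue_on \<Omega>. norm (g x \<bullet> h x) \<le> norm ((norm (g x))\<^sup>2 + (norm (h x))\<^sup>2)"
    by simp
qed

lemma subspace_L2: "subspace (L2 \<Omega> :: ('a::euclidean_space \<Rightarrow> 'b::euclidean_space) set)"
proof (rule subspaceI)
  show "0 \<in> (L2 \<Omega> :: ('a \<Rightarrow> 'b) set)"
    by (simp add: L2_def zero_fun_def)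
next
  fix g h :: "'a \<Rightarrow> 'b" assume gh: "g \<in> L2 \<Omega>" "h \<in> L2 \<Omega>"
  have meas: "(\<lambda>x. g x + h x) \<in> borel_measurable (lebesgue_on \<Omega>)"
    using gh by (auto simp: L2_def)
  have "integrable (lebesgue_on \<Omega>) (\<lambda>x. (norm (g x))\<^sup>2 + 2 * (g x \<bullet> h x) + (norm (h x))\<^sup>2)"
    using gh L2_integrable_inner[OF gh] by (simp add: L2_def)
  also have "(\<lambda>x. (norm (g x))\<^sup>2 + 2 * (g x \<bullet> h x) + (norm (h x))\<^sup>2) = (\<lambda>x. (norm (g x + h x))\<^sup>2)"
    by (simp add: fun_eq_iff power2_norm_eq_inner inner_add_left inner_add_right inner_commute)
  finally show "g + h \<in> L2 \<Omega>"
    using meas by (simp add: L2_def plus_fun_def)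
next
  fix c and g :: "'a \<Rightarrow> 'b" assume g: "g \<in> L2 \<Omega>"
  then show "c *\<^sub>R g \<in> L2 \<Omega>"
    by (auto simp: L2_def scaleR_fun_def power_mult_distrib)
qed

interpretation L2: semi_inner_space "L2 \<Omega> :: ('a::euclidean_space \<Rightarrow> 'b::euclidean_space) set"
  "L2_inner \<Omega>" for \<Omega> :: "'a::euclidean_space set"
proof
  show "subspace (L2 \<Omega> :: ('a \<Rightarrow> 'b) set)" by (rule subspace_L2)
next
  fix x y z :: "'a \<Rightarrow> 'b" assume "x \<in> L2 \<Omega>" "y \<in> L2 \<Omega>" "z \<in> L2 \<Omega>"
  then show "L2_inner \<Omega> (x + y) z = L2_inner \<Omega> x z + L2_inner \<Omega> y z"
    by (simp add: L2_inner_def inner_add_left L2_integrable_inner)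
next
  fix c and x z :: "'a \<Rightarrow> 'b"
  show "L2_inner \<Omega> (c *\<^sub>R x) z = c * L2_inner \<Omega> x z"
    by (simp add: L2_inner_def)
next
  fix x y :: "'a \<Rightarrow> 'b"
  show "L2_inner \<Omega> x y = L2_inner \<Omega> y x"
    by (simp add: L2_inner_def inner_commute)
next
  fix x :: "'a \<Rightarrow> 'b"
  show "0 \<le> L2_inner \<Omega> x x"
    by (simp add: L2_inner_def)
qed

lemma L2_norm_square: "(L2_norm \<Omega> g)\<^sup>2 = L2_inner \<Omega> g g"
  by (simp add: L2_norm_def L2_inner_def)

lemma L2_null_iff:
  assumes "g \<in> L2 \<Omega>"
  shows "L2_inner \<Omega> g g = 0 \<longleftrightarrow> (AE x in lebesgue_on \<Omega>. g x = 0)"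
  using L2_integrable_inner[OF assms assms]
  by (simp add: L2_inner_def integral_nonneg_eq_0_iff_AE)

lemma L2_inner_AE_cong:
  assumes "g \<in> L2 \<Omega>" "g' \<in> L2 \<Omega>" "h \<in> L2 \<Omega>" "h' \<in> L2 \<Omega>"
    and "AE x in lebesgue_on \<Omega>. g x = g' x" "AE x in lebesgue_on \<Omega>. h x = h' x"
  shows "L2_inner \<Omega> g h = L2_inner \<Omega> g' h'"
proof -
  have "L2_inner \<Omega> (g - g') (g - g') = 0" "L2_inner \<Omega> (h - h') (h - h') = 0"
    using assms by (auto simp: L2_null_iff)
  then have "L2_inner \<Omega> (g - g') h = 0" "L2_inner \<Omega> g' (h - h') = 0"
    using assms L2.ip_null[of h \<Omega> "g - g'"] L2.ip_null[of g' \<Omega> "h - h'"] by auto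
  then show ?thesis
    using assms by (simp add: L2.ip_simps)
qed

lemma L2_AE_closed:
  assumes "\<Omega> \<in> sets lebesgue" "g \<in> L2 \<Omega>" and eq: "AE x in lebesgue_on \<Omega>. g x = h x"
  shows "h \<in> L2 \<Omega>"
proof -
  have "(\<lambda>x. if x \<in> \<Omega> then g x else 0) \<in> borel_measurable lebesgue"
    using assms by (simp add: L2_def borel_measurable_if)
  moreover have "AE x in lebesgue. (if x \<in> \<Omega> then g x else 0) = (if x \<in> \<Omega> then h x else 0)"
    using eq assms(1) by (auto simp: AE_restrict_space_iff)
  ultimately have "(\<lambda>x. if x \<in> \<Omega> then h x else 0) \<in> borel_measurable lebesgue"
    by (rule borel_measurable_AE)
  then have h: "h \<in> borel_measurable (lebesgue_on \<Omega>)"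
    using assms(1) by (simp add: borel_measurable_if)
  moreover have "integrable (lebesgue_on \<Omega>) (\<lambda>x. (norm (h x))\<^sup>2)"
  proof (subst integrable_cong_AE)
    show "integrable (lebesgue_on \<Omega>) (\<lambda>x. (norm (g x))\<^sup>2)"
      "(\<lambda>x. (norm (g x))\<^sup>2) \<in> borel_measurable (lebesgue_on \<Omega>)"
      using assms(2) by (auto simp: L2_def)
  qed (use h eq in auto)
  ultimately show ?thesis
    by (simp add: L2_def)
qed

lemma L2_bounded_mult:
  fixes g h :: "'a::euclidean_space \<Rightarrow> real"
  assumes "h \<in> L2 \<Omega>" "g \<in> borel_measurable (lebesgue_on \<Omega>)" "\<And>x. x \<in> \<Omega> \<Longrightarrow> \<bar>g x\<bar> \<le> B"
  shows "(\<lambda>x. g x * h x) \<in> L2 \<Omega>"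
    and "L2_inner \<Omega> (\<lambda>x. g x * h x) (\<lambda>x. g x * h x) \<le> B\<^sup>2 * L2_inner \<Omega> h h"
proof -
  have meas: "(\<lambda>x. g x * h x) \<in> borel_measurable (lebesgue_on \<Omega>)"
    using assms by (auto simp: L2_def)
  have int: "integrable (lebesgue_on \<Omega>) (\<lambda>x. B\<^sup>2 * (h x)\<^sup>2)"
    using assms(1) by (simp add: L2_def)
  have le: "(g x * h x)\<^sup>2 \<le> B\<^sup>2 * (h x)\<^sup>2" if "x \<in> \<Omega>" for x
  proof -
    have "(g x)\<^sup>2 \<le> B\<^sup>2"
      using assms(3)[OF that] by (rule abs_le_square_iff[THEN iffD1, OF order_trans]) simp
    then show ?thesis
      by (simp add: power_mult_distrib mult_right_mono)
  qed
  have int2: "integrable (lebesgue_on \<Omega>) (\<lambda>x. (g x * h x)\<^sup>2)"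
    using int meas le by (intro Bochner_Integration.integrable_bound[OF int] AE_I2) auto
  then show "(\<lambda>x. g x * h x) \<in> L2 \<Omega>"
    using meas by (simp add: L2_def)
  have "(LINT x|lebesgue_on \<Omega>. (g x * h x)\<^sup>2) \<le> (LINT x|lebesgue_on \<Omega>. B\<^sup>2 * (h x)\<^sup>2)"
    using int int2 le by (intro integral_mono) auto
  then show "L2_inner \<Omega> (\<lambda>x. g x * h x) (\<lambda>x. g x * h x) \<le> B\<^sup>2 * L2_inner \<Omega> h h"
    by (simp add: L2_inner_def power2_eq_square)
qed

lemma L2_component:
  assumes "G \<in> L2 \<Omega>" "b \<in> Basis"
  shows "(\<lambda>x. G x \<bullet> b) \<in> L2 \<Omega>"
    and "L2_inner \<Omega> (\<lambda>x. G x \<bullet> b) (\<lambda>x. G x \<bullet> b) \<le> L2_inner \<Omega> G G"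
proof -
  have le: "(G x \<bullet> b)\<^sup>2 \<le> (norm (G x))\<^sup>2" for x
    using Basis_le_norm[OF assms(2), of "G x"] by (simp add: abs_le_square_iff[symmetric])
  have meas: "(\<lambda>x. G x \<bullet> b) \<in> borel_measurable (lebesgue_on \<Omega>)"
    and int: "integrable (lebesgue_on \<Omega>) (\<lambda>x. (norm (G x))\<^sup>2)"
    using assms(1) by (auto simp: L2_def)
  have int2: "integrable (lebesgue_on \<Omega>) (\<lambda>x. (G x \<bullet> b)\<^sup>2)"
    using meas le by (intro Bochner_Integration.integrable_bound[OF int]) auto
  then show "(\<lambda>x. G x \<bullet> b) \<in> L2 \<Omega>"
    using meas by (simp add: L2_def)
  have "(LINT x|lebesgue_on \<Omega>. (G x \<bullet> b)\<^sup>2) \<le> (LINT x|lebesgue_on \<Omega>. (norm (G x))\<^sup>2)"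
    using int int2 le by (intro integral_mono) auto
  then show "L2_inner \<Omega> (\<lambda>x. G x \<bullet> b) (\<lambda>x. G x \<bullet> b) \<le> L2_inner \<Omega> G G"
    by (simp add: L2_inner_def power2_eq_square power2_norm_eq_inner[symmetric])
qed

section \<open>The fundamental lemma of the calculus of variations\<close>

text \<open>
  On functions with values in the unit interval, complementing, multiplying and complementing again acts as a union.
\<close>
lemma test_functions_one_minus_prod:
  assumes "finite J" "\<And>j. j \<in> J \<Longrightarrow> \<psi> j \<in> test_functions U"
  shows "(\<lambda>x. 1 - (\<Prod>j\<in>J. 1 - \<psi> j x)) \<in> test_functions U"
  using assms
proof (induction J rule: finite_induct)
  case empty
  then show ?case by (simp add: test_functions_zero)
next
  case (insert j J)
  let ?P = "\<lambda>x. 1 - (\<Prod>j\<in>J. 1 - \<psi> j x)"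
  have IH: "?P \<in> test_functions U" and \<psi>: "\<psi> j \<in> test_functions U"
    using insert by auto
  have "Ck_function k (\<lambda>x. 1 + (-1) * ?P x)" for k
    by (intro Ck_function_add Ck_function_mult Ck_function_const test_functions_Ck[OF IH])
  from test_functions_add[OF IH test_functions_mult_smooth[OF \<psi> this]]
  have "(\<lambda>x. ?P x + (1 + (-1) * ?P x) * \<psi> j x) \<in> test_functions U" .
  also have "(\<lambda>x. ?P x + (1 + (-1) * ?P x) * \<psi> j x) = (\<lambda>x. 1 - (\<Prod>j\<in>insert j J. 1 - \<psi> j x))"
    using insert.hyps by (simp add: fun_eq_iff algebra_simps)
  finally show ?case .
qed

text \<open>
  Cover \<open>U\<close> by countably many balls whose closures lie in \<open>U\<close>, with a bump \<open>b k\<close> for each. The complement of the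
  product of the powers \<open>(1 - b k) ^ n\<close> over \<open>k < n\<close> is zero outside \<open>U\<close>; at a point of \<open>U\<close> some
  \<open>b k\<close> is positive and the powers of \<open>1 - b k\<close> tend to zero.
\<close>
lemma test_functions_approximate_open:
  fixes U :: "'b::euclidean_space set"
  assumes "open U"
  obtains \<psi> :: "nat \<Rightarrow> 'b \<Rightarrow> real" where "\<And>n. \<psi> n \<in> test_functions U"
    "\<And>n x. 0 \<le> \<psi> n x \<and> \<psi> n x \<le> 1" "\<And>x. (\<lambda>n. \<psi> n x) \<longlonglongrightarrow> indicator U x"
proof (cases "U = {}")
  case True
  then show ?thesis
    by (intro that[of "\<lambda>_ _. 0"]) (auto simp: test_functions_zero)
next
  case False
  define F where "F = {ball c s | c s. s > 0 \<and> cball c s \<subseteq> U}"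
  obtain F' where F': "F' \<subseteq> F" "countable F'" "\<Union>F' = \<Union>F"
    by (rule Lindelof[of F]) (auto simp: F_def)
  have "\<Union>F = U"
  proof
    show "\<Union>F \<subseteq> U" by (auto simp: F_def)
    show "U \<subseteq> \<Union>F"
    proof
      fix x assume "x \<in> U"
      then obtain s where "s > 0" "cball x s \<subseteq> U"
        using assms open_contains_cball by blast
      then show "x \<in> \<Union>F"
        by (auto simp: F_def intro!: exI[of _ "ball x s"])
    qed
  qed
  with F' False have un: "\<Union>F' = U" "F' \<noteq> {}" by auto
  have "\<exists>c s. from_nat_into F' k = ball c s \<and> s > 0 \<and> cball c s \<subseteq> U" for k
    using from_nat_into[OF un(2), of k] F'(1) by (auto simp: F_def)
  then obtain c s where cs: "\<And>k. from_nat_into F' k = ball (c k) (s k)" "\<And>k. s k > 0"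
    "\<And>k. cball (c k) (s k) \<subseteq> U"
    by metis
  have U: "x \<in> U \<longleftrightarrow> (\<exists>k. x \<in> ball (c k) (s k))" for x
    using un range_from_nat_into[OF un(2) F'(2)] cs(1) by (metis UN_iff rangeI Union_iff image_iff)
  define b where "b k = bump (c k) (s k)" for k
  have b01: "0 \<le> b k x" "b k x \<le> 1" for k x
    by (auto simp: b_def bump_bounds)
  have b_pos: "b k x > 0 \<longleftrightarrow> x \<in> ball (c k) (s k)" for k x
    using bump_pos_iff[OF cs(2)] by (simp add: b_def)
  have b_test: "b k \<in> test_functions U" for k
  proof (rule test_functionsI[of _ "cball (c k) (s k)"])
    show "b k x = 0" if "x \<notin> cball (c k) (s k)" for x
      using b_pos[of k x] b01(1)[of k x] that by auto
  qed (use cs in \<open>auto simp: b_def Ck_function_bump\<close>)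
  \<comment> \<open>The second index only repeats each factor \<open>n\<close> times.\<close>
  define P where "P n x = (\<Prod>j\<in>{..<n} \<times> {..<n}. 1 - b (fst j) x)" for n x
  have P: "P n x = (\<Prod>k<n. (1 - b k x) ^ n)" for n x
  proof -
    have "(\<Prod>k<n. (1 - b k x) ^ n) = (\<Prod>k<n. \<Prod>l<n. 1 - b k x)"
      by simp
    also have "\<dots> = P n x"
      by (subst prod.cartesian_product) (simp add: P_def case_prod_unfold)
    finally show ?thesis by simp
  qed
  have P01: "0 \<le> P n x" "P n x \<le> 1" for n x
    using b01 by (auto simp: P_def intro!: prod_nonneg prod_le_1)
  show ?thesis
  proof (rule that[of "\<lambda>n x. 1 - P n x"])
    show "(\<lambda>x. 1 - P n x) \<in> test_functions U" for n
      unfolding P_def using b_test by (intro test_functions_one_minus_prod) auto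
    show "0 \<le> 1 - P n x \<and> 1 - P n x \<le> 1" for n x
      using P01 by auto
    show "(\<lambda>n. 1 - P n x) \<longlonglongrightarrow> indicator U x" for x
    proof (cases "x \<in> U")
      case True
      then obtain k where "x \<in> ball (c k) (s k)" using U by auto
      then have bk: "b k x > 0" using b_pos by simp
      have le: "P n x \<le> (1 - b k x) ^ n" if "n \<ge> Suc k" for n
      proof -
        have "P n x = (1 - b k x) ^ n * (\<Prod>j\<in>{..<n} - {k}. (1 - b j x) ^ n)"
          unfolding P using that by (intro prod.remove) auto
        also have "\<dots> \<le> (1 - b k x) ^ n * 1"
          using b01 by (intro mult_left_mono prod_le_1) (auto simp: power_le_one)
        finally show ?thesis by simp
      qed
      have "(\<lambda>n. P n x) \<longlonglongrightarrow> 0"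
      proof (rule tendsto_sandwich[of "\<lambda>_. 0" _ _ "\<lambda>n. (1 - b k x) ^ n"])
        show "eventually (\<lambda>n. P n x \<le> (1 - b k x) ^ n) sequentially"
          using le unfolding eventually_sequentially by blast
        show "(\<lambda>n. (1 - b k x) ^ n) \<longlonglongrightarrow> 0"
          using bk b01[of k x] by (intro LIMSEQ_realpow_zero) auto
      qed (use P01 in auto)
      then have "(\<lambda>n. 1 - P n x) \<longlonglongrightarrow> 1 - 0"
        by (intro tendsto_diff tendsto_const)
      then show ?thesis using True by simp
    next
      case False
      then have "b k x = 0" for k
        using U[of x] b_pos[of k x] b01(1)[of k x] by (metis order_le_less)
      then show ?thesis using False by (simp add: P)
    qed
  qed
qed

context
  fixes \<Omega> :: "'a::euclidean_space set"
  assumes \<Omega>: "open \<Omega>" "bounded \<Omega>"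
begin

lemma lmeasurable_\<Omega>: "\<Omega> \<in> lmeasurable" "\<Omega> \<in> sets lebesgue"
  using \<Omega> by (auto intro: lmeasurable_open)

lemma finite_measure_\<Omega>: "finite_measure (lebesgue_on \<Omega>)"
  by (rule finite_measure_lebesgue_on) (rule lmeasurable_\<Omega>)

lemma L2_integrable:
  fixes g :: "'a \<Rightarrow> real"
  assumes "g \<in> L2 \<Omega>"
  shows "integrable (lebesgue_on \<Omega>) g"
proof -
  interpret finite_measure "lebesgue_on \<Omega>" by (rule finite_measure_\<Omega>)
  have "(\<lambda>x. 1 :: real) \<in> L2 \<Omega>"
    by (simp add: L2_def)
  from L2_integrable_inner[OF assms this] show ?thesis
    by simp
qed

lemma test_functions_L2:
  assumes "\<psi> \<in> test_functions \<Omega>"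
  shows "\<psi> \<in> L2 \<Omega>"
proof -
  interpret finite_measure "lebesgue_on \<Omega>" by (rule finite_measure_\<Omega>)
  obtain B where B: "\<forall>x. \<bar>\<psi> x\<bar> \<le> B"
    using test_functions_bounded[OF assms] by (rule exE)
  have meas: "\<psi> \<in> borel_measurable (lebesgue_on \<Omega>)"
    using test_functions_continuous[OF assms] lmeasurable_\<Omega>
    by (intro continuous_imp_measurable_on_sets_lebesgue)
  have "(\<psi> x)\<^sup>2 \<le> B\<^sup>2" for x
    using B by (metis abs_ge_self abs_le_square_iff order_trans)
  then have "integrable (lebesgue_on \<Omega>) (\<lambda>x. (\<psi> x)\<^sup>2)"
    using meas by (intro integrable_const_bound[of _ "B\<^sup>2"]) auto
  then show ?thesis
    using meas by (simp add: L2_def)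
qed

text \<open>
  Approximating indicators of open sets by test functions shows that \<open>g\<close> integrates to zero over every open subset
  of \<open>\<Omega>\<close>, hence over every relatively closed one. The set where \<open>g\<close> is positive is exhausted by closed sets up to
  arbitrarily small measure, and each of these is null since \<open>g\<close> is positive there with integral zero.
\<close>
lemma nonpos_if_orthogonal_to_test_functions:
  assumes g: "g \<in> L2 \<Omega>"
    and orth: "\<And>\<psi>. \<psi> \<in> test_functions \<Omega> \<Longrightarrow> L2_inner \<Omega> g \<psi> = 0"
  shows "AE x in lebesgue_on \<Omega>. g x \<le> 0"
proof -
  let ?M = "lebesgue_on \<Omega>"
  have int: "integrable ?M g"
    using L2_integrable[OF g] .
  have meas: "g \<in> borel_measurable ?M"
    using g by (simp add: L2_def)
  have int_ind: "integrable ?M (\<lambda>x. g x * indicator A x)" if "A \<in> sets lebesgue" for A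
  proof -
    have "A \<inter> \<Omega> \<in> sets ?M"
      using that lmeasurable_\<Omega> by (auto simp: sets_restrict_space_iff)
    then have "integrable ?M (\<lambda>x. indicator (A \<inter> \<Omega>) x *\<^sub>R g x)"
      using int by (rule integrable_mult_indicator)
    moreover have "integrable ?M (\<lambda>x. g x * indicator A x)
        \<longleftrightarrow> integrable ?M (\<lambda>x. indicator (A \<inter> \<Omega>) x *\<^sub>R g x)"
      by (intro Bochner_Integration.integrable_cong) (auto simp: indicator_def)
    ultimately show ?thesis by simp
  qed
  have opn: "(LINT x|?M. g x * indicator U x) = 0" if U: "open U" "U \<subseteq> \<Omega>" for U
  proof -
    obtain \<psi> :: "nat \<Rightarrow> 'a \<Rightarrow> real" where \<psi>: "\<And>n. \<psi> n \<in> test_functions U"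
      "\<And>n x. 0 \<le> \<psi> n x \<and> \<psi> n x \<le> 1" "\<And>x. (\<lambda>n. \<psi> n x) \<longlonglongrightarrow> indicator U x"
      using test_functions_approximate_open[OF U(1)] by blast
    have T: "\<psi> n \<in> test_functions \<Omega>" for n
      using test_functions_mono[OF \<psi>(1) U(2)] .
    have "(\<lambda>n. LINT x|?M. g x * \<psi> n x) \<longlonglongrightarrow> (LINT x|?M. g x * indicator U x)"
    proof (rule integral_dominated_convergence[where w = "\<lambda>x. \<bar>g x\<bar>"])
      show "(\<lambda>x. g x * indicator U x) \<in> borel_measurable ?M"
        using int_ind[of U] U(1) by auto
      show "(\<lambda>x. g x * \<psi> n x) \<in> borel_measurable ?M" for n
        using meas test_functions_L2[OF T]
        by (intro borel_measurable_times) (auto simp: L2_def)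
      show "AE x in ?M. (\<lambda>n. g x * \<psi> n x) \<longlonglongrightarrow> g x * indicator U x"
        using \<psi>(3) by (auto intro!: tendsto_mult)
      show "AE x in ?M. norm (g x * \<psi> n x) \<le> \<bar>g x\<bar>" for n
        using \<psi>(2) by (auto simp: abs_mult mult_left_le)
    qed (use int in auto)
    moreover have "(LINT x|?M. g x * \<psi> n x) = 0" for n
      using orth[OF T] by (simp add: L2_inner_def)
    ultimately show ?thesis
      by (simp add: LIMSEQ_const_iff)
  qed
  have cls: "(LINT x|?M. g x * indicator T x) = 0" if T: "closed T" for T
  proof -
    have "(LINT x|?M. g x * indicator T x) = (LINT x|?M. g x * indicator \<Omega> x - g x * indicator (\<Omega> - T) x)"
      by (rule Bochner_Integration.integral_cong) (auto simp: indicator_def)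
    also have "\<dots> = (LINT x|?M. g x * indicator \<Omega> x) - (LINT x|?M. g x * indicator (\<Omega> - T) x)"
      using \<Omega> T by (intro Bochner_Integration.integral_diff int_ind) (auto simp: open_Diff)
    also have "\<dots> = 0"
      using opn[of \<Omega>] opn[of "\<Omega> - T"] \<Omega> T by (simp add: open_Diff)
    finally show ?thesis .
  qed
  define S where "S = {x \<in> \<Omega>. g x > 0}"
  have S: "S \<in> sets lebesgue"
  proof -
    have "{x \<in> space ?M. g x > 0} \<in> sets ?M"
      using meas by measurable
    then show ?thesis
      using lmeasurable_\<Omega> by (auto simp: S_def sets_restrict_space_iff space_restrict_space)
  qed
  have "emeasure lebesgue S \<le> ennreal e" if e: "e > 0" for e
  proof -
    obtain T where T: "closed T" "T \<subseteq> S" "emeasure lebesgue (S - T) < ennreal e"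
      using sets_lebesgue_inner_closed[OF S e] by metis
    have Tm: "T \<in> sets lebesgue" using T(1) by auto
    have nn: "AE x in ?M. 0 \<le> g x * indicator T x"
      using T(2) by (intro AE_I2) (auto simp: indicator_def S_def)
    have "AE x in ?M. g x * indicator T x = 0"
      using integral_nonneg_eq_0_iff_AE[OF int_ind[OF Tm] nn] cls[OF T(1)] by simp
    then have "AE x in lebesgue. x \<in> \<Omega> \<longrightarrow> g x * indicator T x = 0"
      using lmeasurable_\<Omega> by (simp add: AE_restrict_space_iff)
    then have "AE x in lebesgue. x \<notin> T"
      by eventually_elim (use T(2) in \<open>auto simp: S_def indicator_def split: if_splits\<close>)
    then have "emeasure lebesgue T = 0"
      using Tm by (subst (asm) AE_iff_measurable[of T]) auto
    moreover have "emeasure lebesgue S \<le> emeasure lebesgue T + emeasure lebesgue (S - T)"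
      using T(2) Tm S by (metis Diff_partition emeasure_subadditive sets.Diff)
    ultimately show ?thesis
      using T(3) by (simp add: order_trans less_imp_le)
  qed
  then have "emeasure lebesgue S \<le> 0"
    using ennreal_le_epsilon[of 0 "emeasure lebesgue S"] by simp
  then have "AE x in lebesgue. x \<notin> S"
    using S by (subst AE_iff_measurable[of S]) auto
  then have "AE x in lebesgue. x \<in> \<Omega> \<longrightarrow> g x \<le> 0"
    by eventually_elim (auto simp: S_def not_less)
  then show ?thesis
    using lmeasurable_\<Omega> by (simp add: AE_restrict_space_iff)
qed

lemma fundamental_lemma_variations:
  assumes g: "g \<in> L2 \<Omega>"
    and orth: "\<And>\<psi>. \<psi> \<in> test_functions \<Omega> \<Longrightarrow> L2_inner \<Omega> g \<psi> = 0"
  shows "AE x in lebesgue_on \<Omega>. g x = 0"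
proof -
  have "AE x in lebesgue_on \<Omega>. g x \<le> 0"
    using assms by (rule nonpos_if_orthogonal_to_test_functions)
  moreover have "AE x in lebesgue_on \<Omega>. ((-1) *\<^sub>R g) x \<le> 0"
  proof (rule nonpos_if_orthogonal_to_test_functions)
    show "(-1) *\<^sub>R g \<in> L2 \<Omega>"
      using g by (rule L2.mem)
    show "L2_inner \<Omega> ((-1) *\<^sub>R g) \<psi> = 0" if "\<psi> \<in> test_functions \<Omega>" for \<psi>
      using g orth[OF that] test_functions_L2[OF that] by (subst L2.ip_scale_left) auto
  qed
  ultimately show ?thesis
    by eventually_elim simp
qed

end

section \<open>Weak gradients\<close>

text \<open>The gradient is assembled from the partial derivatives, which are what \<open>is_weak_grad\<close> speaks of.\<close>
definition classical_grad :: "('a::euclidean_space \<Rightarrow> real) \<Rightarrow> 'a \<Rightarrow> 'a" where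
  "classical_grad \<psi> x = (\<Sum>b\<in>Basis. frechet_derivative \<psi> (at x) b *\<^sub>R b)"

lemma classical_grad_component:
  "b \<in> Basis \<Longrightarrow> classical_grad \<psi> x \<bullet> b = frechet_derivative \<psi> (at x) b"
  by (simp add: classical_grad_def)

lemma is_weak_grad_iff:
  "is_weak_grad \<Omega> w G \<longleftrightarrow> (\<forall>\<psi>\<in>test_functions \<Omega>. \<forall>b\<in>Basis.
     L2_inner \<Omega> w (\<lambda>x. frechet_derivative \<psi> (at x) b) = - L2_inner \<Omega> (\<lambda>x. G x \<bullet> b) \<psi>)"
  by (simp add: is_weak_grad_def L2_inner_def)

context
  fixes \<Omega> :: "'a::euclidean_space set"
  assumes \<Omega>: "open \<Omega>" "bounded \<Omega>"
begin

lemmas test_L2 = test_functions_L2[OF \<Omega>]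
lemmas AE_closed = L2_AE_closed[OF lmeasurable_\<Omega>(2)[OF \<Omega>]]

text \<open>
  The fundamental lemma, applied to each component of the difference.
\<close>
lemma weak_grad_unique:
  assumes "G \<in> L2 \<Omega>" "G' \<in> L2 \<Omega>" "is_weak_grad \<Omega> w G" "is_weak_grad \<Omega> w G'"
  shows "AE x in lebesgue_on \<Omega>. G x = G' x"
proof -
  have "AE x in lebesgue_on \<Omega>. ((\<lambda>x. G x \<bullet> b) - (\<lambda>x. G' x \<bullet> b)) x = 0" if b: "b \<in> Basis" for b
  proof (rule fundamental_lemma_variations[OF \<Omega>])
    have L: "(\<lambda>x. G x \<bullet> b) \<in> L2 \<Omega>" "(\<lambda>x. G' x \<bullet> b) \<in> L2 \<Omega>"
      using assms b by (auto intro: L2_component)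
    then show "(\<lambda>x. G x \<bullet> b) - (\<lambda>x. G' x \<bullet> b) \<in> L2 \<Omega>"
      by simp
    fix \<psi> :: "'a \<Rightarrow> real" assume \<psi>: "\<psi> \<in> test_functions \<Omega>"
    have "- L2_inner \<Omega> (\<lambda>x. G x \<bullet> b) \<psi> = - L2_inner \<Omega> (\<lambda>x. G' x \<bullet> b) \<psi>"
      using assms(3,4) \<psi> b by (metis is_weak_grad_iff)
    then show "L2_inner \<Omega> ((\<lambda>x. G x \<bullet> b) - (\<lambda>x. G' x \<bullet> b)) \<psi> = 0"
      using L test_L2[OF \<psi>] by (simp add: L2.ip_simps)
  qed
  then have "AE x in lebesgue_on \<Omega>. \<forall>b\<in>Basis. ((\<lambda>x. G x \<bullet> b) - (\<lambda>x. G' x \<bullet> b)) x = 0"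
    by (intro AE_finite_allI) auto
  then show ?thesis
    by eventually_elim (auto intro: euclidean_eqI)
qed

lemma weak_grad:
  assumes "w \<in> H1 \<Omega>"
  shows "weak_grad \<Omega> w \<in> L2 \<Omega>" "is_weak_grad \<Omega> w (weak_grad \<Omega> w)"
proof -
  have "\<exists>G. G \<in> L2 \<Omega> \<and> is_weak_grad \<Omega> w G"
    using assms by (auto simp: H1_def)
  from someI_ex[OF this] show "weak_grad \<Omega> w \<in> L2 \<Omega>" "is_weak_grad \<Omega> w (weak_grad \<Omega> w)"
    by (auto simp: weak_grad_def)
qed

lemma H1_L2: "w \<in> H1 \<Omega> \<Longrightarrow> w \<in> L2 \<Omega>"
  by (simp add: H1_def)

text \<open>
  The way to compute \<open>weak_grad\<close>, which is an arbitrary choice among the weak gradients: exhibit one of them.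
\<close>
lemma weak_gradI:
  assumes "w \<in> L2 \<Omega>" "G \<in> L2 \<Omega>" "is_weak_grad \<Omega> w G"
  shows "w \<in> H1 \<Omega>" "AE x in lebesgue_on \<Omega>. weak_grad \<Omega> w x = G x"
proof -
  show w: "w \<in> H1 \<Omega>"
    using assms by (auto simp: H1_def)
  show "AE x in lebesgue_on \<Omega>. weak_grad \<Omega> w x = G x"
    using weak_grad[OF w] assms by (intro weak_grad_unique) auto
qed

lemma is_weak_grad_add:
  assumes "v \<in> L2 \<Omega>" "w \<in> L2 \<Omega>" "G \<in> L2 \<Omega>" "H \<in> L2 \<Omega>"
    and "is_weak_grad \<Omega> v G" "is_weak_grad \<Omega> w H"
  shows "is_weak_grad \<Omega> (v + w) (G + H)"
  unfolding is_weak_grad_iff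
proof (intro ballI)
  fix \<psi> and b :: 'a assume \<psi>: "\<psi> \<in> test_functions \<Omega>" and b: "b \<in> Basis"
  have D: "(\<lambda>x. frechet_derivative \<psi> (at x) b) \<in> L2 \<Omega>"
    using test_L2 test_functions_derivative \<psi> b by blast
  have GH: "(\<lambda>x. G x \<bullet> b) \<in> L2 \<Omega>" "(\<lambda>x. H x \<bullet> b) \<in> L2 \<Omega>"
    using assms b by (auto intro: L2_component)
  have "(\<lambda>x. (G + H) x \<bullet> b) = (\<lambda>x. G x \<bullet> b) + (\<lambda>x. H x \<bullet> b)"
    by (simp add: fun_eq_iff inner_add_left)
  then show "L2_inner \<Omega> (v + w) (\<lambda>x. frechet_derivative \<psi> (at x) b)
      = - L2_inner \<Omega> (\<lambda>x. (G + H) x \<bullet> b) \<psi>"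
    using assms \<psi> b GH D test_L2[OF \<psi>] by (simp add: L2.ip_add_left is_weak_grad_iff)
qed

lemma is_weak_grad_scale:
  assumes "w \<in> L2 \<Omega>" "G \<in> L2 \<Omega>" "is_weak_grad \<Omega> w G"
  shows "is_weak_grad \<Omega> (c *\<^sub>R w) (c *\<^sub>R G)"
  unfolding is_weak_grad_iff
proof (intro ballI)
  fix \<psi> and b :: 'a assume \<psi>: "\<psi> \<in> test_functions \<Omega>" and b: "b \<in> Basis"
  have D: "(\<lambda>x. frechet_derivative \<psi> (at x) b) \<in> L2 \<Omega>"
    using test_L2 test_functions_derivative \<psi> b by blast
  have G: "(\<lambda>x. G x \<bullet> b) \<in> L2 \<Omega>"
    using assms b by (auto intro: L2_component)
  have "(\<lambda>x. (c *\<^sub>R G) x \<bullet> b) = c *\<^sub>R (\<lambda>x. G x \<bullet> b)"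
    by (simp add: fun_eq_iff)
  then show "L2_inner \<Omega> (c *\<^sub>R w) (\<lambda>x. frechet_derivative \<psi> (at x) b)
      = - L2_inner \<Omega> (\<lambda>x. (c *\<^sub>R G) x \<bullet> b) \<psi>"
    using assms \<psi> b G D test_L2[OF \<psi>] by (simp add: L2.ip_scale_left is_weak_grad_iff)
qed

lemma is_weak_grad_AE_cong:
  assumes "v \<in> L2 \<Omega>" "w \<in> L2 \<Omega>" "AE x in lebesgue_on \<Omega>. v x = w x" "is_weak_grad \<Omega> v G"
  shows "is_weak_grad \<Omega> w G"
  unfolding is_weak_grad_iff
proof (intro ballI)
  fix \<psi> and b :: 'a assume \<psi>: "\<psi> \<in> test_functions \<Omega>" and b: "b \<in> Basis"
  have D: "(\<lambda>x. frechet_derivative \<psi> (at x) b) \<in> L2 \<Omega>"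
    using test_L2 test_functions_derivative \<psi> b by blast
  have "L2_inner \<Omega> w (\<lambda>x. frechet_derivative \<psi> (at x) b)
      = L2_inner \<Omega> v (\<lambda>x. frechet_derivative \<psi> (at x) b)"
    using assms D by (intro L2_inner_AE_cong) auto
  then show "L2_inner \<Omega> w (\<lambda>x. frechet_derivative \<psi> (at x) b) = - L2_inner \<Omega> (\<lambda>x. G x \<bullet> b) \<psi>"
    using assms(4) \<psi> b by (simp add: is_weak_grad_iff)
qed

lemma weak_grad_add:
  assumes "v \<in> H1 \<Omega>" "w \<in> H1 \<Omega>"
  shows "v + w \<in> H1 \<Omega>"
    and "AE x in lebesgue_on \<Omega>. weak_grad \<Omega> (v + w) x = (weak_grad \<Omega> v + weak_grad \<Omega> w) x"
  using weak_gradI[of "v + w" "weak_grad \<Omega> v + weak_grad \<Omega> w"] is_weak_grad_add assms weak_grad H1_L2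
  by auto

lemma weak_grad_scale:
  assumes "w \<in> H1 \<Omega>"
  shows "c *\<^sub>R w \<in> H1 \<Omega>"
    and "AE x in lebesgue_on \<Omega>. weak_grad \<Omega> (c *\<^sub>R w) x = (c *\<^sub>R weak_grad \<Omega> w) x"
  using weak_gradI[of "c *\<^sub>R w" "c *\<^sub>R weak_grad \<Omega> w"] is_weak_grad_scale assms weak_grad H1_L2
  by auto

lemma weak_grad_AE_cong:
  assumes "v \<in> H1 \<Omega>" "AE x in lebesgue_on \<Omega>. v x = w x"
  shows "w \<in> H1 \<Omega>" and "AE x in lebesgue_on \<Omega>. weak_grad \<Omega> w x = weak_grad \<Omega> v x"
  using weak_gradI[of w "weak_grad \<Omega> v"] is_weak_grad_AE_cong[of v w] AE_closed[of v w]
    assms weak_grad H1_L2 by auto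

lemma H01_inner_eq:
  assumes "v \<in> L2 \<Omega>" "G \<in> L2 \<Omega>" "is_weak_grad \<Omega> v G"
    and "w \<in> L2 \<Omega>" "H \<in> L2 \<Omega>" "is_weak_grad \<Omega> w H"
  shows "H01_inner \<Omega> v w = L2_inner \<Omega> G H"
  unfolding H01_inner_def using assms weak_gradI weak_grad by (intro L2_inner_AE_cong) blast+

lemma subspace_H1: "subspace (H1 \<Omega>)"
proof (rule subspaceI)
  have "is_weak_grad \<Omega> 0 0"
    by (simp add: is_weak_grad_def)
  then show "0 \<in> H1 \<Omega>"
    using weak_gradI(1)[of 0 0] by simp
qed (auto intro: weak_grad_add weak_grad_scale)

lemma semi_inner_space_H1: "semi_inner_space (H1 \<Omega>) (H01_inner \<Omega>)"
proof
  show "subspace (H1 \<Omega>)" by (rule subspace_H1)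
next
  fix x y z assume "x \<in> H1 \<Omega>" "y \<in> H1 \<Omega>" "z \<in> H1 \<Omega>"
  note L = weak_grad(1)[OF this(1)] weak_grad(1)[OF this(2)] weak_grad(1)[OF this(3)]
    weak_grad(1)[OF weak_grad_add(1)[OF this(1,2)]] weak_grad_add(2)[OF this(1,2)]
  have "H01_inner \<Omega> (x + y) z = L2_inner \<Omega> (weak_grad \<Omega> x + weak_grad \<Omega> y) (weak_grad \<Omega> z)"
    unfolding H01_inner_def using L by (intro L2_inner_AE_cong) auto
  then show "H01_inner \<Omega> (x + y) z = H01_inner \<Omega> x z + H01_inner \<Omega> y z"
    unfolding H01_inner_def using L by (simp add: L2.ip_add_left)
next
  fix x z c assume "x \<in> H1 \<Omega>" "z \<in> H1 \<Omega>"
  note L = weak_grad(1)[OF this(1)] weak_grad(1)[OF this(2)]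
    weak_grad(1)[OF weak_grad_scale(1)[OF this(1)]] weak_grad_scale(2)[OF this(1)]
  have "H01_inner \<Omega> (c *\<^sub>R x) z = L2_inner \<Omega> (c *\<^sub>R weak_grad \<Omega> x) (weak_grad \<Omega> z)"
    unfolding H01_inner_def using L by (intro L2_inner_AE_cong) auto
  then show "H01_inner \<Omega> (c *\<^sub>R x) z = c * H01_inner \<Omega> x z"
    unfolding H01_inner_def using L by (simp add: L2.ip_scale_left)
next
  fix x y assume "x \<in> H1 \<Omega>" "y \<in> H1 \<Omega>"
  then show "H01_inner \<Omega> x y = H01_inner \<Omega> y x"
    unfolding H01_inner_def by (intro L2.ip_commute weak_grad)
next
  fix x assume "x \<in> H1 \<Omega>"
  then show "0 \<le> H01_inner \<Omega> x x"
    unfolding H01_inner_def by (intro L2.ip_nonneg weak_grad)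
qed

lemma integral_\<Omega>_eq_lborel:
  fixes g :: "'a \<Rightarrow> real"
  assumes "g \<in> test_functions \<Omega>"
  shows "(LINT x|lebesgue_on \<Omega>. g x) = (LINT x|lborel. g x)"
proof -
  have "(LINT x|lebesgue_on \<Omega>. g x) = (LINT x|lebesgue. (if x \<in> \<Omega> then g x else 0))"
    using lmeasurable_\<Omega>[OF \<Omega>] by (simp add: Lebesgue_Measure.integral_restrict_UNIV)
  also have "(\<lambda>x. if x \<in> \<Omega> then g x else 0) = g"
    using test_functions_outside[OF assms] by auto
  also have "(LINT x|lebesgue. g x) = (LINT x|lborel. g x)"
    using test_functions_continuous[OF assms]
    by (intro integral_completion) (auto intro: borel_measurable_continuous_onI)
  finally show ?thesis .
qed

text \<open>
  Integration by parts: the derivative of the product of two test functions has integral zero.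
\<close>
lemma is_weak_grad_classical:
  assumes \<psi>: "\<psi> \<in> test_functions \<Omega>"
  shows "is_weak_grad \<Omega> \<psi> (classical_grad \<psi>)"
  unfolding is_weak_grad_iff
proof (intro ballI)
  fix \<eta> and b :: 'a assume \<eta>: "\<eta> \<in> test_functions \<Omega>" and b: "b \<in> Basis"
  let ?D = "\<lambda>g x. frechet_derivative g (at x) b"
  have D: "?D \<psi> \<in> L2 \<Omega>" "?D \<eta> \<in> L2 \<Omega>"
    using test_L2 test_functions_derivative \<psi> \<eta> b by blast+
  have T: "(\<lambda>x. \<psi> x * \<eta> x) \<in> test_functions \<Omega>"
    using \<psi> \<eta> by (intro test_functions_mult_smooth test_functions_Ck)
  have eq: "?D (\<lambda>x. \<psi> x * \<eta> x) x = \<psi> x * ?D \<eta> x + ?D \<psi> x * \<eta> x" for x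
    using test_functions_differentiable[OF \<psi>] test_functions_differentiable[OF \<eta>]
    by (simp add: frechet_derivative_mult)
  have "0 = (LINT x|lborel. ?D (\<lambda>x. \<psi> x * \<eta> x) x)"
    using integral_derivative_test_function[OF T b] by simp
  also have "\<dots> = (LINT x|lebesgue_on \<Omega>. ?D (\<lambda>x. \<psi> x * \<eta> x) x)"
    using integral_\<Omega>_eq_lborel[OF test_functions_derivative[OF T b]] by simp
  also have "\<dots> = L2_inner \<Omega> \<psi> (?D \<eta>) + L2_inner \<Omega> (?D \<psi>) \<eta>"
    unfolding eq L2_inner_def
    using L2_integrable_inner[OF test_L2[OF \<psi>] D(2)] L2_integrable_inner[OF D(1) test_L2[OF \<eta>]]
    by simp
  finally show "L2_inner \<Omega> \<psi> (?D \<eta>) = - L2_inner \<Omega> (\<lambda>x. classical_grad \<psi> x \<bullet> b) \<eta>"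
    by (simp add: classical_grad_component b)
qed

lemma classical_grad_L2:
  assumes \<psi>: "\<psi> \<in> test_functions \<Omega>"
  shows "classical_grad \<psi> \<in> L2 \<Omega>"
proof -
  have "(\<lambda>x. frechet_derivative \<psi> (at x) b *\<^sub>R b) \<in> L2 \<Omega>" if b: "b \<in> Basis" for b
    using test_L2[OF test_functions_derivative[OF \<psi> b]] b
    by (auto simp: L2_def intro: borel_measurable_scaleR)
  then have "(\<Sum>b\<in>Basis. (\<lambda>x. frechet_derivative \<psi> (at x) b *\<^sub>R b)) \<in> L2 \<Omega>"
    by (rule L2.mem_sum)
  also have "(\<Sum>b\<in>Basis. (\<lambda>x. frechet_derivative \<psi> (at x) b *\<^sub>R b)) = classical_grad \<psi>"
    by (simp add: fun_eq_iff sum_fun_apply classical_grad_def)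
  finally show ?thesis .
qed

lemma test_functions_H1: "\<psi> \<in> test_functions \<Omega> \<Longrightarrow> \<psi> \<in> H1 \<Omega>"
  using weak_gradI(1) test_L2 classical_grad_L2 is_weak_grad_classical by blast

section \<open>Poincare's inequality\<close>

text \<open>
  Test the weak gradient of \<open>\<psi>\<close> with \<open>p \<psi>\<close>, where \<open>p\<close> is a coordinate. Its derivative is \<open>\<psi> + p \<partial>\<psi>\<close>, which gives
  \<open>\<parallel>\<psi>\<parallel>\<^sup>2 = - 2 (\<partial>\<psi>, p \<psi>)\<close>. On \<open>\<Omega>\<close> the coordinate is at most \<open>R\<close> in absolute value, so the Cauchy-Schwarz inequality yields
  \<open>\<parallel>\<psi>\<parallel> \<le> 2 R \<parallel>\<partial>\<psi>\<parallel>\<close>.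
\<close>
lemma poincare_test_functions:
  assumes \<psi>: "\<psi> \<in> test_functions \<Omega>" and R: "\<Omega> \<subseteq> cball 0 R"
  shows "L2_inner \<Omega> \<psi> \<psi> \<le> (2 * R)\<^sup>2 * H01_inner \<Omega> \<psi> \<psi>"
proof -
  obtain b :: 'a where b: "b \<in> Basis"
    using nonempty_Basis by blast
  let ?D = "\<lambda>g x. frechet_derivative g (at x) b"
  define p where "p x = x \<bullet> b" for x :: 'a
  have p: "p differentiable (at x)" "frechet_derivative p (at x) b = 1" for x
  proof -
    have "(p has_derivative (\<lambda>y. y \<bullet> b)) (at x)"
      unfolding p_def by (auto intro!: derivative_eq_intros)
    then show "p differentiable (at x)" "frechet_derivative p (at x) b = 1"
      using b by (auto simp: differentiable_def frechet_derivative_at[symmetric])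
  qed
  have p_bound: "\<bar>p x\<bar> \<le> R" if "x \<in> \<Omega>" for x
    using Basis_le_norm[OF b, of x] R that by (auto simp: p_def)
  have p_meas: "p \<in> borel_measurable (lebesgue_on \<Omega>)"
    unfolding p_def using lmeasurable_\<Omega>[OF \<Omega>]
    by (intro continuous_imp_measurable_on_sets_lebesgue continuous_intros)
  let ?\<eta> = "\<lambda>x. p x * \<psi> x"
  have \<eta>: "?\<eta> \<in> test_functions \<Omega>"
    unfolding p_def using \<psi> by (intro test_functions_mult_smooth Ck_function_inner_left)
  have D\<eta>: "?D ?\<eta> = \<psi> + (\<lambda>x. p x * ?D \<psi> x)"
    using p test_functions_differentiable[OF \<psi>] by (simp add: fun_eq_iff frechet_derivative_mult)
  have L: "\<psi> \<in> L2 \<Omega>" "?\<eta> \<in> L2 \<Omega>" "?D \<psi> \<in> L2 \<Omega>"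
    using test_L2 \<psi> \<eta> test_functions_derivative[OF \<psi> b] by auto
  have pD: "(\<lambda>x. p x * ?D \<psi> x) \<in> L2 \<Omega>"
    using L(3) p_meas p_bound by (rule L2_bounded_mult)
  have \<eta>_le: "L2_inner \<Omega> ?\<eta> ?\<eta> \<le> R\<^sup>2 * L2_inner \<Omega> \<psi> \<psi>"
    using L(1) p_meas p_bound by (rule L2_bounded_mult)
  have "L2_inner \<Omega> \<psi> (?D ?\<eta>) = - L2_inner \<Omega> (?D \<psi>) ?\<eta>"
    using is_weak_grad_classical[OF \<psi>] \<eta> b by (simp add: is_weak_grad_iff classical_grad_component)
  moreover have "L2_inner \<Omega> \<psi> (?D ?\<eta>) = L2_inner \<Omega> \<psi> \<psi> + L2_inner \<Omega> \<psi> (\<lambda>x. p x * ?D \<psi> x)"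
    unfolding D\<eta> using L pD by (intro L2.ip_add_right)
  moreover have "L2_inner \<Omega> \<psi> (\<lambda>x. p x * ?D \<psi> x) = L2_inner \<Omega> (?D \<psi>) ?\<eta>"
    by (simp add: L2_inner_def mult_ac)
  ultimately have eq: "L2_inner \<Omega> \<psi> \<psi> = - 2 * L2_inner \<Omega> (?D \<psi>) ?\<eta>"
    by simp
  let ?n = "L2_inner \<Omega> \<psi> \<psi>"
  have n0: "?n \<ge> 0" using L2.ip_nonneg[OF L(1)] .
  have "?n\<^sup>2 = 4 * (L2_inner \<Omega> (?D \<psi>) ?\<eta>)\<^sup>2"
    unfolding eq by (simp add: power_mult_distrib)
  also have "\<dots> \<le> 4 * (L2_inner \<Omega> (?D \<psi>) (?D \<psi>) * L2_inner \<Omega> ?\<eta> ?\<eta>)"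
    using L2.Cauchy_Schwarz[OF L(3,2)] by simp
  also have "\<dots> \<le> 4 * (L2_inner \<Omega> (?D \<psi>) (?D \<psi>) * (R\<^sup>2 * ?n))"
    using \<eta>_le L2.ip_nonneg[OF L(3)] by (intro mult_left_mono) auto
  finally have "?n * ?n \<le> (2 * R)\<^sup>2 * L2_inner \<Omega> (?D \<psi>) (?D \<psi>) * ?n"
    by (simp add: power2_eq_square mult_ac)
  then have "?n \<le> (2 * R)\<^sup>2 * L2_inner \<Omega> (?D \<psi>) (?D \<psi>)"
    using n0 L2.ip_nonneg[OF L(3)] by (cases "?n = 0") auto
  also have "L2_inner \<Omega> (?D \<psi>) (?D \<psi>) \<le> L2_inner \<Omega> (classical_grad \<psi>) (classical_grad \<psi>)"
    using L2_component(2)[OF classical_grad_L2[OF \<psi>] b] by (simp add: classical_grad_component b)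
  also have "L2_inner \<Omega> (classical_grad \<psi>) (classical_grad \<psi>) = H01_inner \<Omega> \<psi> \<psi>"
    using test_L2 classical_grad_L2 is_weak_grad_classical \<psi> by (intro H01_inner_eq[symmetric]) auto
  finally show ?thesis by (simp add: mult_left_mono)
qed

interpretation H1: semi_inner_space "H1 \<Omega>" "H01_inner \<Omega>"
  by (rule semi_inner_space_H1)

lemma H1_norm_eq: "H1_norm \<Omega> w = sqrt (L2_inner \<Omega> w w + H01_inner \<Omega> w w)"
  by (simp add: H1_norm_def L2_norm_square H01_inner_def)

text \<open>The form behind \<open>H1_norm\<close>; its triangle inequality makes \<open>H01 \<Omega>\<close> a subspace.\<close>
interpretation N: semi_inner_space "H1 \<Omega>" "\<lambda>v w. L2_inner \<Omega> v w + H01_inner \<Omega> v w"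
proof
  fix x y assume "x \<in> H1 \<Omega>" "y \<in> H1 \<Omega>"
  then show "L2_inner \<Omega> x y + H01_inner \<Omega> x y = L2_inner \<Omega> y x + H01_inner \<Omega> y x"
    using L2.ip_commute[of x \<Omega> y] H1.ip_commute[of x y] H1_L2 by auto
qed (auto simp: subspace_H1 H1_L2 L2.ip_simps H1.ip_simps L2.ip_nonneg H1.ip_nonneg algebra_simps)

lemma H01I:
  assumes "w \<in> H1 \<Omega>" "\<And>k. \<psi> k \<in> test_functions \<Omega>"
    "(\<lambda>k. H1_norm \<Omega> (w - \<psi> k)) \<longlonglongrightarrow> 0"
  shows "w \<in> H01 \<Omega>"
  using assms by (auto simp: H01_def fun_diff_def)

lemma H01E:
  assumes "w \<in> H01 \<Omega>"
  obtains \<psi> :: "nat \<Rightarrow> 'a \<Rightarrow> real" where "\<And>k. \<psi> k \<in> test_functions \<Omega>" "(\<lambda>k. H1_norm \<Omega> (w - \<psi> k)) \<longlonglongrightarrow> 0"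
  using assms by (auto simp: H01_def fun_diff_def)

lemma H01_H1: "w \<in> H01 \<Omega> \<Longrightarrow> w \<in> H1 \<Omega>"
  by (simp add: H01_def)

lemma subspace_H01: "subspace (H01 \<Omega>)"
proof (rule subspaceI)
  have [simp]: "0 \<in> test_functions \<Omega>"
    using test_functions_zero[of \<Omega>] by (simp add: zero_fun_def)
  show "0 \<in> H01 \<Omega>"
    by (rule H01I[of _ "\<lambda>_. 0"]) (auto simp: H1_norm_eq N.ip_zero_left)
next
  fix v w assume vw: "v \<in> H01 \<Omega>" "w \<in> H01 \<Omega>"
  obtain \<psi> where \<psi>: "\<And>k. \<psi> k \<in> test_functions \<Omega>" "(\<lambda>k. H1_norm \<Omega> (v - \<psi> k)) \<longlonglongrightarrow> 0"
    using H01E[OF vw(1)] by blast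
  obtain \<eta> where \<eta>: "\<And>k. \<eta> k \<in> test_functions \<Omega>" "(\<lambda>k. H1_norm \<Omega> (w - \<eta> k)) \<longlonglongrightarrow> 0"
    using H01E[OF vw(2)] by blast
  have H: "v \<in> H1 \<Omega>" "w \<in> H1 \<Omega>" "\<And>k. \<psi> k \<in> H1 \<Omega>" "\<And>k. \<eta> k \<in> H1 \<Omega>"
    using vw \<psi> \<eta> by (auto intro: H01_H1 test_functions_H1)
  show "v + w \<in> H01 \<Omega>"
  proof (rule H01I)
    show "v + w \<in> H1 \<Omega>" using H by simp
    show "\<psi> k + \<eta> k \<in> test_functions \<Omega>" for k
      using test_functions_add[OF \<psi>(1) \<eta>(1)] by (simp add: plus_fun_def)
    have le: "H1_norm \<Omega> (v + w - (\<psi> k + \<eta> k)) \<le> H1_norm \<Omega> (v - \<psi> k) + H1_norm \<Omega> (w - \<eta> k)" for k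
    proof -
      have "v + w - (\<psi> k + \<eta> k) = (v - \<psi> k) + (w - \<eta> k)" by simp
      then show ?thesis
        using N.sqrt_ip_triangle[of "v - \<psi> k" "w - \<eta> k"] H by (simp only: H1_norm_eq N.mem)
    qed
    show "(\<lambda>k. H1_norm \<Omega> (v + w - (\<psi> k + \<eta> k))) \<longlonglongrightarrow> 0"
    proof (rule tendsto_sandwich[of "\<lambda>_. 0"])
      show "(\<lambda>k. H1_norm \<Omega> (v - \<psi> k) + H1_norm \<Omega> (w - \<eta> k)) \<longlonglongrightarrow> 0"
        using tendsto_add[OF \<psi>(2) \<eta>(2)] by simp
    qed (use le in \<open>auto simp: H1_norm_def\<close>)
  qed
next
  fix c and w assume w: "w \<in> H01 \<Omega>"
  obtain \<psi> where \<psi>: "\<And>k. \<psi> k \<in> test_functions \<Omega>" "(\<lambda>k. H1_norm \<Omega> (w - \<psi> k)) \<longlonglongrightarrow> 0"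
    using H01E[OF w] by blast
  have H: "w \<in> H1 \<Omega>" "\<And>k. \<psi> k \<in> H1 \<Omega>"
    using w \<psi> by (auto intro: H01_H1 test_functions_H1)
  show "c *\<^sub>R w \<in> H01 \<Omega>"
  proof (rule H01I)
    show "c *\<^sub>R w \<in> H1 \<Omega>" using H by simp
    show "c *\<^sub>R \<psi> k \<in> test_functions \<Omega>" for k
      using test_functions_mult_smooth[OF \<psi>(1) Ck_function_const] by (simp add: scaleR_fun_def)
    have eq: "H1_norm \<Omega> (c *\<^sub>R w - c *\<^sub>R \<psi> k) = \<bar>c\<bar> * H1_norm \<Omega> (w - \<psi> k)" for k
    proof -
      let ?N = "\<lambda>v w. L2_inner \<Omega> v w + H01_inner \<Omega> v w"
      have "w - \<psi> k \<in> H1 \<Omega>" using H by simp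
      then have "?N (c *\<^sub>R (w - \<psi> k)) (c *\<^sub>R (w - \<psi> k)) = c\<^sup>2 * ?N (w - \<psi> k) (w - \<psi> k)"
        by (simp only: N.ip_scale_left N.ip_scale_right N.mem power2_eq_square mult.assoc)
      then show ?thesis
        by (simp add: H1_norm_eq scaleR_diff_right real_sqrt_mult)
    qed
    show "(\<lambda>k. H1_norm \<Omega> (c *\<^sub>R w - c *\<^sub>R \<psi> k)) \<longlonglongrightarrow> 0"
      unfolding eq using tendsto_mult_left[OF \<psi>(2), of "\<bar>c\<bar>"] by simp
  qed
qed

lemma H01_AE_closed:
  assumes v: "v \<in> H01 \<Omega>" and eq: "AE x in lebesgue_on \<Omega>. v x = w x"
  shows "w \<in> H01 \<Omega>"
proof -
  obtain \<psi> where \<psi>: "\<And>k. \<psi> k \<in> test_functions \<Omega>" "(\<lambda>k. H1_norm \<Omega> (v - \<psi> k)) \<longlonglongrightarrow> 0"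
    using H01E[OF v] by blast
  have H: "v \<in> H1 \<Omega>" "\<And>k. \<psi> k \<in> H1 \<Omega>"
    using v \<psi> by (auto intro: H01_H1 test_functions_H1)
  have w: "w \<in> H1 \<Omega>"
    using H(1) eq by (rule weak_grad_AE_cong)
  have "H1_norm \<Omega> (w - \<psi> k) = H1_norm \<Omega> (v - \<psi> k)" for k
  proof -
    have D: "w - \<psi> k \<in> H1 \<Omega>" "v - \<psi> k \<in> H1 \<Omega>" using H w by auto
    have e: "AE x in lebesgue_on \<Omega>. (v - \<psi> k) x = (w - \<psi> k) x"
      using eq by eventually_elim simp
    have "L2_inner \<Omega> (w - \<psi> k) (w - \<psi> k) = L2_inner \<Omega> (v - \<psi> k) (v - \<psi> k)"
      using e D H1_L2 by (intro L2_inner_AE_cong) (auto elim: AE_mp)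
    moreover have "H01_inner \<Omega> (w - \<psi> k) (w - \<psi> k) = H01_inner \<Omega> (v - \<psi> k) (v - \<psi> k)"
      unfolding H01_inner_def using weak_grad_AE_cong(2)[of "v - \<psi> k" "w - \<psi> k", OF D(2) e] weak_grad D
      by (intro L2_inner_AE_cong) auto
    ultimately show ?thesis by (simp add: H1_norm_eq)
  qed
  then show ?thesis
    using H01I[OF w \<psi>(1)] \<psi>(2) by simp
qed

text \<open>
  Both sides are continuous in the \<open>H1\<close> norm, so the inequality passes from test functions to limits.
\<close>
lemma poincare_H01:
  assumes w: "w \<in> H01 \<Omega>" and R: "\<Omega> \<subseteq> cball 0 R" "R > 0"
  shows "L2_inner \<Omega> w w \<le> (2 * R)\<^sup>2 * H01_inner \<Omega> w w"
proof -
  obtain \<psi> where \<psi>: "\<And>k. \<psi> k \<in> test_functions \<Omega>" "(\<lambda>k. H1_norm \<Omega> (w - \<psi> k)) \<longlonglongrightarrow> 0"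
    using H01E[OF w] by blast
  have H: "w \<in> H1 \<Omega>" "\<And>k. \<psi> k \<in> H1 \<Omega>"
    using w \<psi> by (auto intro: H01_H1 test_functions_H1)
  let ?m = "\<lambda>v. sqrt (L2_inner \<Omega> v v)" and ?q = "\<lambda>v. sqrt (H01_inner \<Omega> v v)"
  have "?m w \<le> (1 + 2 * R) * H1_norm \<Omega> (w - \<psi> k) + 2 * R * ?q w" for k
  proof -
    have d: "w - \<psi> k \<in> H1 \<Omega>" "\<psi> k - w \<in> H1 \<Omega>" using H by auto
    have sym: "H01_inner \<Omega> (\<psi> k - w) (\<psi> k - w) = H01_inner \<Omega> (w - \<psi> k) (w - \<psi> k)"
      using H by (simp add: H1.ip_simps)
    have "?m w \<le> ?m (w - \<psi> k) + ?m (\<psi> k)"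
      using L2.sqrt_ip_triangle[of "w - \<psi> k" \<Omega> "\<psi> k"] H1_L2 d H by simp
    moreover have "?m (\<psi> k) \<le> 2 * R * ?q (\<psi> k)"
    proof -
      have "?m (\<psi> k) \<le> sqrt ((2 * R)\<^sup>2 * H01_inner \<Omega> (\<psi> k) (\<psi> k))"
        using poincare_test_functions[OF \<psi>(1) R(1)] by (rule real_sqrt_le_mono)
      then show ?thesis using R(2) by (simp add: real_sqrt_mult)
    qed
    moreover have "2 * R * ?q (\<psi> k) \<le> 2 * R * (?q (w - \<psi> k) + ?q w)"
      using H1.sqrt_ip_triangle[of "\<psi> k - w" w] d H R(2) by (simp add: sym)
    moreover have "?m (w - \<psi> k) \<le> H1_norm \<Omega> (w - \<psi> k)" "?q (w - \<psi> k) \<le> H1_norm \<Omega> (w - \<psi> k)"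
      using d L2.ip_nonneg[OF H1_L2[OF d(1)]] H1.ip_nonneg[OF d(1)] by (auto simp: H1_norm_eq)
    moreover from this(2) have "2 * R * ?q (w - \<psi> k) \<le> 2 * R * H1_norm \<Omega> (w - \<psi> k)"
      using R(2) by (intro mult_left_mono) auto
    ultimately show ?thesis by (simp add: algebra_simps)
  qed
  moreover have "(\<lambda>k. (1 + 2 * R) * H1_norm \<Omega> (w - \<psi> k) + 2 * R * ?q w) \<longlonglongrightarrow> (1 + 2 * R) * 0 + 2 * R * ?q w"
    by (intro tendsto_intros \<psi>(2))
  ultimately have "?m w \<le> 2 * R * ?q w"
    by (intro LIMSEQ_le_const[of _ "2 * R * ?q w"]) auto
  then have "(?m w)\<^sup>2 \<le> (2 * R * ?q w)\<^sup>2"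
    using L2.ip_nonneg[OF H1_L2[OF H(1)]] by (intro power_mono) auto
  then show ?thesis
    using L2.ip_nonneg[OF H1_L2[OF H(1)]] H1.ip_nonneg[OF H(1)] by (simp add: power_mult_distrib)
qed

end

section \<open>Finite element and POD spaces\<close>

lemma H01_norm_square: "(H01_norm \<Omega> w)\<^sup>2 = H01_inner \<Omega> w w"
  by (simp add: H01_norm_def H01_inner_def L2_inner_def)

text \<open>
  Spans up to null sets are reduced to the algebraic span, for which projections exist.
\<close>
lemma ae_span_iff:
  assumes "finite B"
  shows "w \<in> ae_span \<Omega> B \<longleftrightarrow> (\<exists>p\<in>span B. AE x in lebesgue_on \<Omega>. w x = p x)"
proof -
  have "(\<Sum>b\<in>B. c b *\<^sub>R b) x = (\<Sum>b\<in>B. c b * b x)" for c x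
    by (simp add: sum_fun_apply)
  then show ?thesis
    using assms by (auto simp: ae_span_def span_finite)
qed

lemma ae_span_AE_closed:
  assumes "v \<in> ae_span \<Omega> B" "AE x in lebesgue_on \<Omega>. w x = v x"
  shows "w \<in> ae_span \<Omega> B"
proof -
  obtain c where "AE x in lebesgue_on \<Omega>. v x = (\<Sum>b\<in>B. c b * b x)"
    using assms(1) by (auto simp: ae_span_def)
  with assms(2) have "AE x in lebesgue_on \<Omega>. w x = (\<Sum>b\<in>B. c b * b x)"
    by eventually_elim simp
  then show ?thesis by (auto simp: ae_span_def)
qed

lemma subspace_ae_span:
  assumes "finite B"
  shows "subspace (ae_span \<Omega> B)"
proof (rule subspaceI)
  show "0 \<in> ae_span \<Omega> B"
    using assms by (auto simp: ae_span_iff intro!: bexI[of _ 0] span_zero)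
next
  fix v w assume "v \<in> ae_span \<Omega> B" "w \<in> ae_span \<Omega> B"
  then obtain p p' where p: "p \<in> span B" "AE x in lebesgue_on \<Omega>. v x = p x"
    and p': "p' \<in> span B" "AE x in lebesgue_on \<Omega>. w x = p' x"
    using assms by (auto simp: ae_span_iff)
  have "AE x in lebesgue_on \<Omega>. (v + w) x = (p + p') x"
    using p(2) p'(2) by eventually_elim simp
  then show "v + w \<in> ae_span \<Omega> B"
    using assms p(1) p'(1) span_add by (subst ae_span_iff) blast+
next
  fix c w assume "w \<in> ae_span \<Omega> B"
  then obtain p where p: "p \<in> span B" "AE x in lebesgue_on \<Omega>. w x = p x"
    using assms by (auto simp: ae_span_iff)
  have "AE x in lebesgue_on \<Omega>. (c *\<^sub>R w) x = (c *\<^sub>R p) x"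
    using p(2) by eventually_elim simp
  then show "c *\<^sub>R w \<in> ae_span \<Omega> B"
    using assms p(1) span_scale by (subst ae_span_iff) blast+
qed

lemma span_subset_ae_span: "finite B \<Longrightarrow> span B \<subseteq> ae_span \<Omega> B"
  by (auto simp: ae_span_iff intro!: bexI AE_I2)

lemma ae_span_minimal:
  assumes "finite B" "B \<subseteq> U" "subspace U"
    and closed: "\<And>v w. v \<in> U \<Longrightarrow> AE x in lebesgue_on \<Omega>. w x = v x \<Longrightarrow> w \<in> U"
  shows "ae_span \<Omega> B \<subseteq> U"
proof
  fix w assume "w \<in> ae_span \<Omega> B"
  then obtain p where p: "p \<in> span B" "AE x in lebesgue_on \<Omega>. w x = p x"
    using assms(1) by (auto simp: ae_span_iff)
  then have "p \<in> U"
    using span_minimal[OF assms(2,3)] by blast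
  then show "w \<in> U"
    using p(2) by (rule closed)
qed

lemma initial_segment_eq:
  fixes A :: "nat set"
  assumes A: "A \<subseteq> {1..N}" and down: "\<And>i j. i \<in> A \<Longrightarrow> 1 \<le> j \<Longrightarrow> j \<le> i \<Longrightarrow> j \<in> A"
  shows "A = {1..card A}"
proof (cases "A = {}")
  case False
  have fin: "finite A" using A finite_subset by blast
  have "A = {1..Max A}"
    using A fin Max_in[OF fin False] down by (auto intro: Max_ge)
  then show ?thesis by (metis card_atLeastAtMost diff_Suc_1)
qed simp

lemma diff_quot_eq: "diff_quot dt z n = (1 / dt) *\<^sub>R (z (Suc n) - z n)"
  by (simp add: diff_quot_def fun_eq_iff)

lemma S_inner_eq:
  assumes "N \<ge> 1"
  shows "S_inner dt N g h = (\<Sum>j=1..N. pod_weight dt j * (g j * h j))"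
proof -
  have "(\<Sum>j=1..N. pod_weight dt j * (g j * h j))
      = g 1 * h 1 + (\<Sum>j=2..N. pod_weight dt j * (g j * h j))"
    using assms by (subst sum.atLeast_Suc_atMost) (auto simp: pod_weight_def numeral_2_eq_2)
  also have "(\<Sum>j=2..N. pod_weight dt j * (g j * h j)) = dt * (\<Sum>j=2..N. g j * h j)"
    unfolding sum_distrib_left by (intro sum.cong) (auto simp: pod_weight_def)
  finally show ?thesis by (simp add: S_inner_def)
qed

lemma K1_eq:
  assumes "N \<ge> 1"
  shows "K1 dt N u c = pod_map dt N u c"
proof
  fix x
  obtain k where N: "N = Suc k" using assms by (cases N) auto
  have "pod_map dt N u c x = (\<Sum>j=1..Suc k. pod_weight dt j * c j * pod_snapshot dt u j x)"
    by (simp add: pod_map_def N sum_fun_apply)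
  also have "\<dots> = c 1 * u 1 x + (\<Sum>j=Suc 1..Suc k. pod_weight dt j * c j * pod_snapshot dt u j x)"
    by (subst sum.atLeast_Suc_atMost) (auto simp: pod_weight_def pod_snapshot_def)
  also have "(\<Sum>j=Suc 1..Suc k. pod_weight dt j * c j * pod_snapshot dt u j x)
      = (\<Sum>j=1..k. pod_weight dt (Suc j) * c (Suc j) * pod_snapshot dt u (Suc j) x)"
    by (rule sum.shift_bounds_cl_Suc_ivl)
  also have "\<dots> = (\<Sum>j=1..k. dt * c (j + 1) * diff_quot dt u j x)"
    by (intro sum.cong) (auto simp: pod_weight_def pod_snapshot_def diff_quot_eq)
  finally show "K1 dt N u c x = pod_map dt N u c x"
    by (simp add: K1_def N)
qed

section \<open>The reduced-order model in \<open>H01\<close>\<close>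

context
  fixes \<Omega> :: "'a::euclidean_space set"
  assumes \<Omega>: "open \<Omega>" "bounded \<Omega>"
begin

lemma H01_subset: "H01 \<Omega> \<subseteq> H1 \<Omega>" "H01 \<Omega> \<subseteq> L2 \<Omega>"
  using H01_H1[OF \<Omega>] H1_L2[OF \<Omega>] by blast+

lemma energy_space_H01:
  assumes "\<Omega> \<subseteq> cball 0 R" "R > 0"
  shows "energy_space (H01 \<Omega>) (L2_inner \<Omega>) (H01_inner \<Omega>) ((2 * R)\<^sup>2)"
proof -
  interpret M: semi_inner_space "H01 \<Omega>" "L2_inner \<Omega>"
    using L2.semi_inner_subspace subspace_H01[OF \<Omega>] H01_subset by blast
  interpret H1: semi_inner_space "H1 \<Omega>" "H01_inner \<Omega>"
    by (rule semi_inner_space_H1[OF \<Omega>])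
  interpret Q: semi_inner_space "H01 \<Omega>" "H01_inner \<Omega>"
    using H1.semi_inner_subspace subspace_H01[OF \<Omega>] H01_subset by blast
  show ?thesis
  proof
    show "(2 * R)\<^sup>2 > 0" using assms by simp
    show "L2_inner \<Omega> v v \<le> (2 * R)\<^sup>2 * H01_inner \<Omega> v v" if "v \<in> H01 \<Omega>" for v
      using poincare_H01[OF \<Omega> that assms] .
    show "H01_inner \<Omega> v v = 0" if v: "v \<in> H01 \<Omega>" "L2_inner \<Omega> v v = 0" for v
    proof -
      have H: "v \<in> H1 \<Omega>" "v \<in> L2 \<Omega>" "0 \<in> H1 \<Omega>" using v H01_subset by auto
      have "AE x in lebesgue_on \<Omega>. 0 x = v x"
        using v(2) L2_null_iff[OF H(2)] by simp
      from weak_grad_AE_cong(2)[of _ 0 v, OF \<Omega> H(3) this]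
      have "H01_inner \<Omega> v v = H01_inner \<Omega> 0 0"
        unfolding H01_inner_def using weak_grad(1)[OF \<Omega>] H by (intro L2_inner_AE_cong) auto
      then show ?thesis by (simp add: H1.ip_zero_left)
    qed
  qed
qed

lemma L2_null_diff:
  assumes "v \<in> H01 \<Omega>" "w \<in> H01 \<Omega>" "AE x in lebesgue_on \<Omega>. v x = w x"
  shows "L2_inner \<Omega> (v - w) (v - w) = 0"
proof -
  have "v - w \<in> L2 \<Omega>" using assms H01_subset by (intro L2.mem) auto
  then show ?thesis using assms(3) by (simp add: L2_null_iff)
qed

text \<open>
  The projection onto the algebraic span is orthogonal to all of \<open>ae_span \<Omega> B\<close>, because changing a test vector on a null
  set changes it by a null vector. Hence the choice in \<open>ritz_proj\<close> has a witness.
\<close>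
lemma ritz_projection_ritz_proj:
  assumes R: "\<Omega> \<subseteq> cball 0 R" "R > 0" and B: "finite B" "B \<subseteq> H01 \<Omega>"
  shows "ritz_projection (H01 \<Omega>) (L2_inner \<Omega>) (H01_inner \<Omega>) ((2 * R)\<^sup>2)
    (ae_span \<Omega> B) (ritz_proj \<Omega> (ae_span \<Omega> B))"
proof -
  interpret energy_space "H01 \<Omega>" "L2_inner \<Omega>" "H01_inner \<Omega>" "(2 * R)\<^sup>2"
    using R by (rule energy_space_H01)
  let ?W = "ae_span \<Omega> B"
  have W: "?W \<subseteq> H01 \<Omega>"
    using B M.subspace_V
  proof (rule ae_span_minimal)
    fix v w assume "v \<in> H01 \<Omega>" "AE x in lebesgue_on \<Omega>. w x = v x"
    then show "w \<in> H01 \<Omega>"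
      using H01_AE_closed[OF \<Omega>, of v w] by (auto simp: eq_commute)
  qed
  have ritz: "ritz_proj \<Omega> ?W w \<in> ?W \<and> (\<forall>v\<in>?W. H01_inner \<Omega> (w - ritz_proj \<Omega> ?W w) v = 0)"
    if w: "w \<in> H01 \<Omega>" for w
  proof -
    obtain p where p: "p \<in> span B" "\<And>v. v \<in> span B \<Longrightarrow> H01_inner \<Omega> (w - p) v = 0"
      using Q.orthogonal_projection_exists[OF B w] by blast
    have pW: "p \<in> ?W" using p(1) span_subset_ae_span B(1) by blast
    have "H01_inner \<Omega> (w - p) v = 0" if v: "v \<in> ?W" for v
    proof -
      obtain v' where v': "v' \<in> span B" "AE x in lebesgue_on \<Omega>. v x = v' x"
        using v B(1) by (auto simp: ae_span_iff)
      have mem: "v \<in> H01 \<Omega>" "v' \<in> H01 \<Omega>" "w - p \<in> H01 \<Omega>"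
        using v v'(1) W w pW span_subset_ae_span[OF B(1)] by auto
      have "H01_inner \<Omega> (v - v') (v - v') = 0"
        using null_transfer[OF _ L2_null_diff[OF mem(1,2) v'(2)]] mem by simp
      then have "H01_inner \<Omega> (w - p) (v - v') = 0"
        using Q.ip_null(1)[of "w - p" "v - v'"] mem by simp
      then show ?thesis
        using p(2)[OF v'(1)] mem by (simp add: Q.ip_diff_right)
    qed
    with pW have "\<exists>p. p \<in> ?W \<and> (\<forall>v\<in>?W. L2_inner \<Omega> (weak_grad \<Omega> (\<lambda>x. w x - p x)) (weak_grad \<Omega> v) = 0)"
      by (auto simp: H01_inner_def fun_diff_def)
    from someI_ex[OF this] show ?thesis
      by (simp add: ritz_proj_def H01_inner_def fun_diff_def)
  qed
  show ?thesis
    by unfold_locales (use ritz W subspace_ae_span[OF B(1)] in auto)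
qed

text \<open>
  The abstract estimate for \<open>H01 \<Omega>\<close>. Since the POD space is contained in \<open>Vh\<close>, the two schemes can be subtracted on it.
  The modes belonging to positive eigenvalues are weakly differentiable because up to null sets they are multiples of
  images under the snapshot map, that is, of combinations of finite element functions.
\<close>
lemma rom_error_estimate:
  assumes \<nu>: "\<nu> > 0" and T: "T > 0" and R: "\<Omega> \<subseteq> cball 0 R" "R > 0"
    and Vh: "conforming_fe_space \<Omega> Vh" and N: "N \<ge> 2"
    and be: "backward_euler \<Omega> \<nu> T f N Vh u"
    and svd: "pod_svd \<Omega> (time_step T N) N u lam a \<phi>"
    and \<phi>: "\<forall>i\<in>{1..r}. \<phi> i \<in> Vh"
    and rom: "backward_euler \<Omega> \<nu> T f N (pod_space \<Omega> \<phi> r) ur"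
  defines "P \<equiv> ritz_proj \<Omega> (pod_space \<Omega> \<phi> r)" and "s \<equiv> num_pos_eigenvalues N lam"
  defines "A \<equiv> \<Sum>i=r+1..s. lam i * L2_inner \<Omega> (\<phi> i - P (\<phi> i)) (\<phi> i - P (\<phi> i))"
    and "B \<equiv> \<Sum>i=r+1..s. lam i * H01_inner \<Omega> (\<phi> i - P (\<phi> i)) (\<phi> i - P (\<phi> i))"
    and "p1 \<equiv> ur 1 - P (u 1)" and "e \<equiv> \<lambda>n. u n - ur n"
  shows "L2_inner \<Omega> (e N) (e N)
      + \<nu> * time_step T N * (\<Sum>n=1..N-1. H01_inner \<Omega> (e (Suc n)) (e (Suc n)))
    \<le> (2 * (1 + T) * (1 + \<nu> * T) + 2 + 2 * ((2 * R)\<^sup>2 / \<nu>)) * ((A + B) + L2_inner \<Omega> p1 p1)"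
proof -
  define k where "k = N - 1"
  have Nk: "N = Suc k" "k \<ge> 1" "N \<ge> 1" using N by (auto simp: k_def)
  define dt where "dt = time_step T N"
  have dt: "dt > 0" "dt * k = T"
    using T Nk by (auto simp: dt_def time_step_def)
  obtain F where F: "finite F" "F \<subseteq> H01 \<Omega>" "Vh = ae_span \<Omega> F"
    using Vh by (auto simp: conforming_fe_space_def)
  interpret energy_space "H01 \<Omega>" "L2_inner \<Omega>" "H01_inner \<Omega>" "(2 * R)\<^sup>2"
    using R by (rule energy_space_H01)
  have closed: "w \<in> H01 \<Omega>" if "v \<in> H01 \<Omega>" "AE x in lebesgue_on \<Omega>. w x = v x" for v w
    using that H01_AE_closed[OF \<Omega>, of v w] by (auto simp: eq_commute)
  have Vh_H01: "Vh \<subseteq> H01 \<Omega>"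
    unfolding F(3) using F(1,2) M.subspace_V closed by (rule ae_span_minimal)
  let ?W = "pod_space \<Omega> \<phi> r"
  have W: "?W = ae_span \<Omega> (\<phi> ` {1..r})" "finite (\<phi> ` {1..r})"
    by (auto simp: pod_space_def)
  have W_Vh: "?W \<subseteq> Vh"
    unfolding W(1)
  proof (rule ae_span_minimal[OF W(2)])
    show "\<phi> ` {1..r} \<subseteq> Vh" using \<phi> by auto
    show "subspace Vh" unfolding F(3) by (rule subspace_ae_span[OF F(1)])
    show "w \<in> Vh" if "v \<in> Vh" "AE x in lebesgue_on \<Omega>. w x = v x" for v w
      using that unfolding F(3) by (rule ae_span_AE_closed)
  qed
  interpret ritz_projection "H01 \<Omega>" "L2_inner \<Omega>" "H01_inner \<Omega>" "(2 * R)\<^sup>2" ?W P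
    unfolding P_def W(1) using \<phi> Vh_H01 by (intro ritz_projection_ritz_proj[OF R W(2)]) auto
  have u: "u n \<in> H01 \<Omega>" if "n \<in> {1..Suc k}" for n
    using be that Vh_H01 by (auto simp: backward_euler_def Nk)
  have ur: "ur n \<in> ?W" if "n \<in> {1..Suc k}" for n
    using rom that by (auto simp: backward_euler_def Nk)
  have galerkin: "L2_inner \<Omega> ((1 / dt) *\<^sub>R (u (Suc n) - u n) - (1 / dt) *\<^sub>R (ur (Suc n) - ur n)) v
      + \<nu> * H01_inner \<Omega> (u (Suc n) - ur (Suc n)) v = 0" if n: "n \<in> {1..k}" and v: "v \<in> ?W" for n v
  proof -
    have mem: "u n \<in> H01 \<Omega>" "u (Suc n) \<in> H01 \<Omega>" "ur n \<in> H01 \<Omega>" "ur (Suc n) \<in> H01 \<Omega>" "v \<in> H01 \<Omega>"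
      using n u ur v W_V by auto
    have "L2_inner \<Omega> (diff_quot dt u n) v + \<nu> * H01_inner \<Omega> (u (Suc n)) v
        = L2_inner \<Omega> (diff_quot dt ur n) v + \<nu> * H01_inner \<Omega> (ur (Suc n)) v"
      using be rom n v W_Vh by (auto simp: backward_euler_def Nk dt_def H01_inner_def)
    moreover have "L2_inner \<Omega> (diff_quot dt u n - diff_quot dt ur n) v
        = L2_inner \<Omega> (diff_quot dt u n) v - L2_inner \<Omega> (diff_quot dt ur n) v"
      unfolding diff_quot_eq using mem by (intro M.ip_diff_left M.mem)
    moreover have "H01_inner \<Omega> (u (Suc n) - ur (Suc n)) v
        = H01_inner \<Omega> (u (Suc n)) v - H01_inner \<Omega> (ur (Suc n)) v"
      using mem by (intro Q.ip_diff_left)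
    ultimately show ?thesis
      unfolding diff_quot_eq by (simp add: right_diff_distrib)
  qed
  have orth: "(\<Sum>j=1..N. pod_weight dt j * (a i j * a l j)) = (if i = l then 1 else 0)"
    if "i \<in> {1..N}" "l \<in> {1..N}" for i l
    using svd that S_inner_eq[OF Nk(3), of dt "a i" "a l"] by (auto simp: pod_svd_def dt_def)
  have lam: "0 \<le> lam i" if "i \<in> {1..N}" for i
    using svd that by (auto simp: pod_svd_def)
  \<comment> \<open>The eigenvalues are nonincreasing, so counting the positive ones identifies them.\<close>
  have pos: "{i \<in> {1..N}. 0 < lam i} = {1..s}"
    unfolding s_def num_pos_eigenvalues_def
  proof (rule initial_segment_eq)
    fix i j assume "i \<in> {i \<in> {1..N}. 0 < lam i}" "1 \<le> j" "j \<le> i"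
    moreover from this have "lam i \<le> lam j"
      using svd by (auto simp: pod_svd_def)
    ultimately show "j \<in> {i \<in> {1..N}. 0 < lam i}" by auto
  qed auto
  have "card {1..s} \<le> card {1..N}"
    unfolding pos[symmetric] by (intro card_mono) auto
  then have sN: "s \<le> N" by simp
  have svd_AE: "AE x in lebesgue_on \<Omega>. pod_map dt N u (a i) x = (sqrt (lam i) *\<^sub>R \<phi> i) x"
    if "i \<in> {1..N}" for i
    using svd that by (auto simp: pod_svd_def K1_eq[OF Nk(3)] dt_def)
  have map: "pod_map dt N u c \<in> H01 \<Omega>" for c
    unfolding pod_map_def
    using u by (intro M.mem_sum M.mem pod_snapshot_mem[OF M.subspace_V, of N]) (auto simp: Nk)
  have phi: "\<phi> i \<in> H01 \<Omega>" if i: "i \<in> {1..s}" for i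
  proof (rule closed)
    show "(1 / sqrt (lam i)) *\<^sub>R pod_map dt N u (a i) \<in> H01 \<Omega>"
      using map by simp
    have "i \<in> {i \<in> {1..N}. 0 < lam i}" unfolding pos by (rule i)
    then have "i \<in> {1..N}" "lam i > 0" by auto
    then show "AE x in lebesgue_on \<Omega>. \<phi> i x = ((1 / sqrt (lam i)) *\<^sub>R pod_map dt N u (a i)) x"
      using svd_AE[of i] by (auto elim!: eventually_mono)
  qed
  have phiW: "\<phi> i \<in> ?W" if "i \<in> {1..r}" for i
    unfolding W(1) using that
    by (intro subsetD[OF span_subset_ae_span[OF W(2)]] span_base imageI)
  have svd1: "L2_inner \<Omega> (pod_map dt N u (a i) - sqrt (lam i) *\<^sub>R \<phi> i)
      (pod_map dt N u (a i) - sqrt (lam i) *\<^sub>R \<phi> i) = 0" if "i \<in> {1..s}" for i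
    using map phi that svd_AE sN by (intro L2_null_diff) auto
  have svd2: "L2_inner \<Omega> (pod_map dt N u (a i)) (pod_map dt N u (a i)) = 0" if i: "i \<in> {s+1..N}" for i
  proof -
    have iN: "i \<in> {1..N}" "i \<notin> {1..s}" using i by auto
    then have "i \<notin> {i \<in> {1..N}. 0 < lam i}" unfolding pos by simp
    then have "lam i = 0" using lam[OF iN(1)] iN(1) by simp
    then have "AE x in lebesgue_on \<Omega>. pod_map dt N u (a i) x = 0 x"
      using svd_AE[OF iN(1)] by simp
    then show ?thesis
      using L2_null_diff[of "pod_map dt N u (a i)" 0] map by simp
  qed
  let ?y = "\<lambda>j. ritz_err (pod_snapshot dt u j)"
  have main: "L2_inner \<Omega> (e (Suc k)) (e (Suc k)) + \<nu> * dt * (\<Sum>n=1..k. H01_inner \<Omega> (e (Suc n)) (e (Suc n)))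
    \<le> 2 * (1 + dt * k) * ((\<Sum>j=1..Suc k. pod_weight dt j * L2_inner \<Omega> (?y j) (?y j))
        + \<nu> * (dt * k) * (\<Sum>j=1..Suc k. pod_weight dt j * H01_inner \<Omega> (?y j) (?y j)))
      + 2 * (L2_inner \<Omega> p1 p1
        + (2 * R)\<^sup>2 / \<nu> * (\<Sum>j=1..Suc k. pod_weight dt j * L2_inner \<Omega> (?y j) (?y j)))"
    unfolding e_def p1_def using dt(1) \<nu> u ur galerkin by (rule rom_error_le_projection_error)
  have AB: "(\<Sum>j=1..Suc k. pod_weight dt j * L2_inner \<Omega> (?y j) (?y j)) = A"
    "(\<Sum>j=1..Suc k. pod_weight dt j * H01_inner \<Omega> (?y j) (?y j)) = B"
    using pod_projection_error[where r = r, OF dt(1) u[folded Nk(1)] orth sN lam phi phiW svd1 svd2]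
    by (simp_all add: A_def B_def ritz_err_def Nk)
  have p1: "L2_inner \<Omega> p1 p1 \<ge> 0"
    unfolding p1_def using u ur W_V by (intro M.ip_nonneg M.mem R_V) auto
  have nn: "0 \<le> lam i" "\<phi> i - P (\<phi> i) \<in> H01 \<Omega>" if "i \<in> {r+1..s}" for i
    using that lam phi sN by auto
  have A0: "A \<ge> 0" "B \<ge> 0"
    unfolding A_def B_def using nn M.ip_nonneg Q.ip_nonneg by (auto intro!: sum_nonneg)
  define K where "K = (2 * R)\<^sup>2 / \<nu>"
  have K0: "K \<ge> 0" using \<nu> by (simp add: K_def)
  have "0 \<le> (1 + T) * B" "0 \<le> (1 + T) * (\<nu> * T) * A" "0 \<le> (1 + T) * (1 + \<nu> * T) * L2_inner \<Omega> p1 p1"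
    "0 \<le> K * B" "0 \<le> K * L2_inner \<Omega> p1 p1"
    using A0 p1 K0 T \<nu> by auto
  then have "2 * (1 + T) * (A + \<nu> * T * B) + 2 * (L2_inner \<Omega> p1 p1 + K * A)
      \<le> (2 * (1 + T) * (1 + \<nu> * T) + 2 + 2 * K) * ((A + B) + L2_inner \<Omega> p1 p1)"
    using A0 by (simp add: algebra_simps)
  with main show ?thesis
    unfolding AB dt(2) K_def by (simp add: Nk dt_def)
qed

end

theorem theorem4p4:
  fixes \<Omega> :: "'a::euclidean_space set" and \<nu> T :: real and f :: "real \<Rightarrow> 'a \<Rightarrow> real"
  assumes "bounded_lipschitz_domain \<Omega>"
    and "\<nu> > 0" and "T > 0"
    and "\<forall>t\<in>{0..T}. f t \<in> L2 \<Omega>"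
  shows "\<exists>C>0. \<forall>Vh (N::nat) u lam a \<phi> (r::nat) ur.
    conforming_fe_space \<Omega> Vh \<longrightarrow> N \<ge> 2 \<longrightarrow>
    backward_euler \<Omega> \<nu> T f N Vh u \<longrightarrow>
    pod_svd \<Omega> (time_step T N) N u lam a \<phi> \<longrightarrow>
    r \<ge> 1 \<longrightarrow> (\<forall>i\<in>{1..r}. \<phi> i \<in> Vh) \<longrightarrow>
    be_pod_rom \<Omega> \<nu> T f N u \<phi> r ur \<longrightarrow>
    (let dt = time_step T N;
         s = num_pos_eigenvalues N lam;
         R = ritz_proj \<Omega> (pod_space \<Omega> \<phi> r);
         e = (\<lambda>n x. u n x - ur n x)
     in (L2_norm \<Omega> (e N))\<^sup>2
          + \<nu> * dt * (\<Sum>n=1..N-1. (L2_norm \<Omega> (weak_grad \<Omega> (e (n + 1))))\<^sup>2)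
        \<le> C * ((\<Sum>i=r+1..s. lam i *
                   ((L2_norm \<Omega> (\<lambda>x. \<phi> i x - R (\<phi> i) x))\<^sup>2
                    + (H01_norm \<Omega> (\<lambda>x. \<phi> i x - R (\<phi> i) x))\<^sup>2))
               + (L2_norm \<Omega> (\<lambda>x. ur 1 x - R (u 1) x))\<^sup>2))"
proof -
  have \<Omega>: "open \<Omega>" "bounded \<Omega>"
    using assms(1) by (auto simp: bounded_lipschitz_domain_def)
  obtain R where R: "R > 0" "\<Omega> \<subseteq> cball 0 R"
    using \<Omega>(2) by (auto simp: bounded_pos subset_iff)
  let ?C = "2 * (1 + T) * (1 + \<nu> * T) + 2 + 2 * ((2 * R)\<^sup>2 / \<nu>)"
  show ?thesis
  proof (intro exI[of _ ?C] conjI allI impI)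
    show "?C > 0"
      using assms(2,3) by (intro add_pos_nonneg add_nonneg_pos) auto
  next
    fix Vh and N r :: nat and u lam a \<phi> ur
    assume "conforming_fe_space \<Omega> Vh" "N \<ge> 2" "backward_euler \<Omega> \<nu> T f N Vh u"
      "pod_svd \<Omega> (time_step T N) N u lam a \<phi>" "\<forall>i\<in>{1..r}. \<phi> i \<in> Vh"
      and "be_pod_rom \<Omega> \<nu> T f N u \<phi> r ur"
    then have "backward_euler \<Omega> \<nu> T f N (pod_space \<Omega> \<phi> r) ur"
      by (simp add: be_pod_rom_def)
    note est = rom_error_estimate[OF \<Omega> assms(2,3) R(2,1) \<open>conforming_fe_space \<Omega> Vh\<close> \<open>N \<ge> 2\<close>
        \<open>backward_euler \<Omega> \<nu> T f N Vh u\<close> \<open>pod_svd \<Omega> (time_step T N) N u lam a \<phi>\<close>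
        \<open>\<forall>i\<in>{1..r}. \<phi> i \<in> Vh\<close> this]
    have diff: "(\<lambda>x. g x - h x) = g - h" for g h :: "'a \<Rightarrow> real"
      by (simp add: fun_diff_def)
    have sum_eq: "(\<Sum>i\<in>I. lam i * (p i + q i)) = (\<Sum>i\<in>I. lam i * p i) + (\<Sum>i\<in>I. lam i * q i)"
      for I p q
      by (simp add: distrib_left sum.distrib)
    show "let dt = time_step T N;
         s = num_pos_eigenvalues N lam;
         R = ritz_proj \<Omega> (pod_space \<Omega> \<phi> r);
         e = (\<lambda>n x. u n x - ur n x)
     in (L2_norm \<Omega> (e N))\<^sup>2
          + \<nu> * dt * (\<Sum>n=1..N-1. (L2_norm \<Omega> (weak_grad \<Omega> (e (n + 1))))\<^sup>2)
        \<le> ?C * ((\<Sum>i=r+1..s. lam i *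
                   ((L2_norm \<Omega> (\<lambda>x. \<phi> i x - R (\<phi> i) x))\<^sup>2
                    + (H01_norm \<Omega> (\<lambda>x. \<phi> i x - R (\<phi> i) x))\<^sup>2))
               + (L2_norm \<Omega> (\<lambda>x. ur 1 x - R (u 1) x))\<^sup>2)"
      using est
      unfolding Let_def diff H01_norm_square L2_norm_square H01_inner_def sum_eq Suc_eq_plus1 .
  qed
qed

end
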